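(* Let $0\le\beta<4$. (i) For every $\alpha>0$ and every $u\in W^{2,2}(\mathbb{R}^4)$, $$\int_{\mathbb{R}^4}\frac{e^{\alpha u^2}-1}{|x|^\beta}dx<\infty.$$ (ii) Let $\tau>0$ and $\sigma>0$ be constants. For every $\alpha<32\pi^2\left(1-\frac{\beta}{4}\right)$, $$\sup\left\{\int_{\mathbb{R}^4}\frac{e^{\alpha u^2}-1}{|x|^\beta}dx:\ u\in W^{2,2}(\mathbb{R}^4),\ \int_{\mathbb{R}^4}\left(|\Delta u|^2+\tau|\nabla u|^2+\sigma u^2\right)dx\le 1\right\}<\infty.$$ (iii) For every $\alpha>32\pi^2\left(1-\frac{\beta}{4}\right)$, the supremum in (ii) is infinite.
   Context: $W^{2,2}(\mathbb{R}^4)$ is the usual Sobolev space of functions on $\mathbb{R}^4$ with square-integrable derivatives up to order two. *)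

theory Defs
  imports "HOL-Analysis.Analysis"
begin

type_synonym R4 = "real ^ 4"

definition cpartial :: "4 \<Rightarrow> (R4 \<Rightarrow> real) \<Rightarrow> R4 \<Rightarrow> real" where
  "cpartial i f x = frechet_derivative f (at x) (axis i 1)"

fun dpart :: "4 list \<Rightarrow> (R4 \<Rightarrow> real) \<Rightarrow> R4 \<Rightarrow> real" where
  "dpart [] f = f"
| "dpart (i # is) f = cpartial i (dpart is f)"

definition smooth :: "(R4 \<Rightarrow> real) \<Rightarrow> bool" where
  "smooth f \<longleftrightarrow> (\<forall>is. \<forall>x. dpart is f differentiable (at x))"

definition test_fun :: "(R4 \<Rightarrow> real) \<Rightarrow> bool" where
  "test_fun \<phi> \<longleftrightarrow> smooth \<phi> \<and> bounded {x. \<phi> x \<noteq> 0}"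

definition L2 :: "(R4 \<Rightarrow> real) \<Rightarrow> bool" where
  "L2 f \<longleftrightarrow> f \<in> borel_measurable lebesgue \<and> integrable lebesgue (\<lambda>x. (f x)\<^sup>2)"

definition weak_partial :: "(R4 \<Rightarrow> real) \<Rightarrow> 4 \<Rightarrow> (R4 \<Rightarrow> real) \<Rightarrow> bool" where
  "weak_partial u i g \<longleftrightarrow>
     (\<forall>\<phi>. test_fun \<phi> \<longrightarrow>
        (\<integral>x. u x * cpartial i \<phi> x \<partial>lebesgue) = - (\<integral>x. g x * \<phi> x \<partial>lebesgue))"

definition W22_derivs :: "(R4 \<Rightarrow> real) \<Rightarrow> (4 \<Rightarrow> R4 \<Rightarrow> real) \<Rightarrow> (4 \<Rightarrow> 4 \<Rightarrow> R4 \<Rightarrow> real) \<Rightarrow> bool" where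
  "W22_derivs u g h \<longleftrightarrow> L2 u \<and>
     (\<forall>i. weak_partial u i (g i) \<and> L2 (g i)) \<and>
     (\<forall>i j. weak_partial (g i) j (h i j) \<and> L2 (h i j))"

definition W22 :: "(R4 \<Rightarrow> real) set" where
  "W22 = {u. \<exists>g h. W22_derivs u g h}"

definition TM :: "real \<Rightarrow> real \<Rightarrow> (R4 \<Rightarrow> real) \<Rightarrow> ennreal" where
  "TM \<alpha> \<beta> u = (\<integral>\<^sup>+ x. ennreal ((exp (\<alpha> * (u x)\<^sup>2) - 1) / (norm x powr \<beta>)) \<partial>lebesgue)"

definition admissible :: "real \<Rightarrow> real \<Rightarrow> (R4 \<Rightarrow> real) set" where
  "admissible \<tau> \<sigma> = {u. \<exists>g h. W22_derivs u g h \<and>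
     (\<integral>\<^sup>+ x. ennreal ((\<Sum>i\<in>UNIV. h i i x)\<^sup>2 + \<tau> * (\<Sum>i\<in>UNIV. (g i x)\<^sup>2) + \<sigma> * (u x)\<^sup>2) \<partial>lebesgue) \<le> 1}"

end

theory Submission
  imports Defs
begin

text \<open>Parts (i) and (ii). Let $w$ be the weak Laplacian of $u$ and let $E$ be a compact subset of
  the level set where $u \ge s$. Testing with a smoothed truncation of $1/|x-y|^2$ (up to the factor
  $-1/4\pi^2$ the fundamental solution of the Laplacian), integrating over $y \in E$ and removing
  the smoothing gives
  $4\pi^2 s\,|E| \le C |E| + \int |w|\,P$ with $P(x) = \int_E 1_{|x-y|\le 1} |x-y|^{-2} dy$. Expanding the square,
  $\int P^2 \le |E|^2 (\frac{\pi^2}{2}\theta \ln(1/|E|) + C_\theta)$ for every $\theta > 1$. If $w$ is the sum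
  of a bounded function and a function of norm at most $d$ in $L^2$, it follows that
  $|E| \le e^{-a s^2}$ for every $a < 32\pi^2/d^2$ and all large $s$. Summing over level sets, with
  $\int_E |x|^{-\beta} dx \le C |E|^{1-\beta/4}$, gives the bounds: $d$ can be taken arbitrarily small for a single
  function, and $d = 1$ for admissible functions.

  Part (iii). Normalise $\ln(1 + (|x|^2+\varepsilon)^{-2})$ and let $\varepsilon$ tend to $0$.\<close>

subsection \<open>Test functions\<close>

text \<open>A function in \<open>W22\<close> is determined only almost everywhere, so the inequality
  is obtained in averaged form over y in E; compactness of E makes the mass that the smoothing
  spills outside E vanish in the limit. Duality against E takes the place of symmetrisation: the L^2
  norm of the potential only needs an upper bound in terms of |E|, whatever the shape of E. The
  critical constant is the outcome of Cauchy-Schwarz: for \<theta> near 1 and up to bounded terms, 4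
  pi^2 s \<le> d sqrt((pi^2/2) ln(1/|E|)), and squaring gives ln(1/|E|) \<ge> 32 pi^2 s^2/d^2. The
  power 1 - \<beta>/4 of |E| in the weighted measure multiplies this rate. Cutting off the
  fundamental solution costs only multiples of |E|, with a constant depending on the L^2 norm of u.
  In part (iii) the functions before normalisation have energy at most 32 pi^2 L + C with L = ln(1 +
  1/\<epsilon>^2) and are at least L - ln 4 on the ball of radius sqrt \<epsilon>, of measure
  (pi^2/2) \<epsilon>^2; the ratio (L - ln 4)^2/(32 pi^2 L + C) reproduces the same
  constant.\<close>

lemma cpartial_eq:
  assumes "(f has_derivative D) (at x)"
  shows "cpartial i f x = D (axis i 1)"
  using frechet_derivative_at[OF assms] by (simp add: cpartial_def)

lemma cpartial_cong_open:
  assumes "open S" "x \<in> S" "\<And>y. y \<in> S \<Longrightarrow> f y = g y"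
  shows "cpartial i f x = cpartial i g x"
proof -
  have "\<And>D. (f has_derivative D) (at x) \<longleftrightarrow> (g has_derivative D) (at x)"
    using assms has_derivative_transform_within_open[of _ _ x UNIV S]
    by (metis has_derivative_transform_within_open)
  then show ?thesis by (simp add: cpartial_def frechet_derivative_def)
qed

lemma dpart_append: "dpart (is @ js) f = dpart is (dpart js f)"
  by (induction "is") auto

lemma smooth_cpartial: "smooth f \<Longrightarrow> smooth (cpartial i f)"
  unfolding smooth_def
proof (intro allI)
  fix "is" x assume "\<forall>is x. dpart is f differentiable at x"
  then have "dpart (is @ [i]) f differentiable at x" by blast
  then show "dpart is (cpartial i f) differentiable at x" by (simp add: dpart_append)
qed

lemma smooth_differentiable: "smooth f \<Longrightarrow> f differentiable (at x)"
  unfolding smooth_def by (metis dpart.simps(1))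

lemma smooth_continuous_on: "smooth f \<Longrightarrow> continuous_on S f"
  by (meson differentiable_imp_continuous_within continuous_at_imp_continuous_on smooth_differentiable)

lemma test_fun_cpartial:
  assumes "test_fun f"
  shows "test_fun (cpartial i f)"
proof -
  obtain R where R: "\<And>x. f x \<noteq> 0 \<Longrightarrow> norm x \<le> R"
    using assms by (auto simp: test_fun_def bounded_iff)
  have "cpartial i f x = 0" if "norm x > R" for x
  proof -
    have "cpartial i f x = cpartial i (\<lambda>x. 0) x"
    proof (rule cpartial_cong_open[where S = "- cball 0 R"])
      show "f y = 0" if "y \<in> - cball 0 R" for y using R[of y] that by force
    qed (use that in auto)
    then show ?thesis using cpartial_eq[of "\<lambda>x. 0" "\<lambda>x. 0" x i] by simp
  qed
  then have "bounded {x. cpartial i f x \<noteq> 0}"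
    unfolding bounded_iff by (intro exI[of _ R]) (metis mem_Collect_eq not_le)
  then show ?thesis using assms smooth_cpartial by (simp add: test_fun_def)
qed

text \<open>\<open>smooth\<close> speaks of all iterated partial derivatives at once. A class of
  differentiable functions that is closed under \<open>cpartial\<close> contains all iterates of its
  members, so explicit formulas for higher derivatives are avoided.\<close>

lemma smooth_coinduct:
  assumes "P f"
    and "\<And>f x. P f \<Longrightarrow> f differentiable (at x)"
    and "\<And>f i. P f \<Longrightarrow> P (cpartial i f)"
  shows "smooth f"
proof -
  have "P (dpart is f)" for "is" by (induction "is") (use assms in auto)
  then show ?thesis using assms(2) by (simp add: smooth_def)
qed

text \<open>Dividing by powers of $t$ makes the family closed under differentiation.\<close>

definition bump :: "nat \<Rightarrow> real \<Rightarrow> real" where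
  "bump k t = (if t > 0 then exp (-1/t) / t ^ k else 0)"

lemma bump_nonneg: "bump k t \<ge> 0"
  by (auto simp: bump_def)

text \<open>A single term of the exponential series at 1/t, the one of order k + j, already gives
  the bound. The case j = 2 yields differentiability at the origin, j = 0 the uniform bounds on the
  family.\<close>

lemma bump_le_power:
  shows "bump k t \<le> fact (k + j) * \<bar>t\<bar> ^ j"
proof (cases "t > 0")
  case True
  have "(1/t) ^ (k+j) / fact (k+j) \<le> exp (1/t)"
  proof -
    have "(\<Sum>n\<in>{k+j}. (1/t) ^ n /\<^sub>R fact n) \<le> (\<Sum>n. (1/t) ^ n /\<^sub>R fact n)"
      by (rule sum_le_suminf[OF summable_exp_generic]) (use True in auto)
    then show ?thesis by (simp add: exp_def divide_inverse mult.commute)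
  qed
  then have "(1/t) ^ (k+j) \<le> fact (k+j) * exp (1/t)"
    by (simp only: pos_divide_le_eq[OF fact_gt_zero] mult.commute)
  then have "1 \<le> t ^ k * t ^ j * (fact (k+j) * exp (1/t))"
    using True by (simp add: power_divide power_add field_simps)
  then show ?thesis
    using True by (simp add: bump_def exp_minus field_simps)
qed (simp add: bump_def)

lemma bump_le: "bump k t \<le> fact k"
  using bump_le_power[of k t 0] by simp

lemma bump_has_derivative:
  "(bump k has_real_derivative (bump (k+2) t - k * bump (k+1) t)) (at t)"
proof -
  consider "t > 0" | "t < 0" | "t = 0" by linarith
  then show ?thesis
  proof cases
    case 1
    have "((\<lambda>t. exp (-1/t) / t ^ k) has_real_derivative (bump (k+2) t - k * bump (k+1) t)) (at t)"
    proof -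
      have "((\<lambda>t. exp (-1/t) / t ^ k) has_real_derivative
          ((exp (-1/t) / t^2) * t ^ k - exp (-1/t) * (k * t ^ (k-1))) / (t ^ k * t ^ k)) (at t)"
        using 1 by (auto intro!: derivative_eq_intros simp: power2_eq_square)
      moreover have "((exp (-1/t) / t^2) * t ^ k - exp (-1/t) * (k * t ^ (k-1))) / (t ^ k * t ^ k)
          = bump (k+2) t - k * bump (k+1) t"
        using 1 by (cases k) (auto simp: bump_def power2_eq_square field_simps)
      ultimately show ?thesis by simp
    qed
    then show ?thesis
      by (rule has_field_derivative_transform_within_open[where S = "{0<..}"])
        (use 1 in \<open>auto simp: bump_def\<close>)
  next
    case 2
    have "((\<lambda>t. 0) has_real_derivative 0) (at t)" by simp
    then have "(bump k has_real_derivative 0) (at t)"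
      by (rule has_field_derivative_transform_within_open[where S = "{..<0}"])
        (use 2 in \<open>auto simp: bump_def\<close>)
    then show ?thesis using 2 by (simp add: bump_def)
  next
    case 3
    \<comment> \<open>At 0 the difference quotient is squeezed by a multiple of |h|, since
      \<open>bump k\<close> is O(t^2). The claimed derivative is 0 as well, because every member of
      the family vanishes at 0 by its \<open>else\<close> branch.\<close>
    have "((\<lambda>h. (bump k (0+h) - bump k 0) / h) \<longlongrightarrow> 0) (at 0)"
    proof (rule Lim_null_comparison)
      show "\<forall>\<^sub>F h in at 0. norm ((bump k (0+h) - bump k 0) / h) \<le> fact (k+2) * \<bar>h\<bar>"
      proof (rule always_eventually, rule allI)
        fix h :: real
        define c :: real where "c = fact (k+2)"
        have "\<bar>bump k h\<bar> \<le> c * \<bar>h\<bar> * \<bar>h\<bar>"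
          using bump_le_power[of k h 2] bump_nonneg[of k h] by (simp add: power2_eq_square c_def)
        then have "norm ((bump k (0+h) - bump k 0) / h) \<le> c * \<bar>h\<bar>"
          by (cases "h = 0") (auto simp: bump_def[of k 0] pos_divide_le_eq)
        then show "norm ((bump k (0+h) - bump k 0) / h) \<le> fact (k+2) * \<bar>h\<bar>"
          unfolding c_def .
      qed
      show "((\<lambda>h. fact (k+2) * \<bar>h\<bar>) \<longlongrightarrow> 0) (at (0::real))"
        by (auto intro!: tendsto_eq_intros)
    qed
    then show ?thesis using 3 by (simp add: DERIV_def bump_def[of _ 0])
  qed
qed

lemmas bump_has_derivative' [derivative_intros] = bump_has_derivative[THEN DERIV_chain2]

text \<open>The test functions are radial, $\chi(s)/(s+\varepsilon)$ with $s = |x-y|^2$. Their smoothness is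
  proved by exhibiting an algebra of functions that is stable under partial derivatives.\<close>

inductive radial_algebra :: "R4 \<Rightarrow> real \<Rightarrow> (R4 \<Rightarrow> real) \<Rightarrow> bool" for y e where
  const: "radial_algebra y e (\<lambda>x. c)"
| coord: "radial_algebra y e (\<lambda>x. x $ i)"
| bump: "radial_algebra y e (\<lambda>x. bump k (1 - ((x-y) \<bullet> (x-y))^2))"
| inv: "radial_algebra y e (\<lambda>x. inverse ((x-y) \<bullet> (x-y) + e))"
| add: "radial_algebra y e f \<Longrightarrow> radial_algebra y e g \<Longrightarrow> radial_algebra y e (\<lambda>x. f x + g x)"
| mult: "radial_algebra y e f \<Longrightarrow> radial_algebra y e g \<Longrightarrow> radial_algebra y e (\<lambda>x. f x * g x)"

lemma radial_has_derivative:
  assumes "(F has_real_derivative F') (at ((x-y) \<bullet> (x-y)))"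
  shows "((\<lambda>x::R4. F ((x-y) \<bullet> (x-y))) has_derivative (\<lambda>h. F' * (2 * ((x-y) \<bullet> h)))) (at x)"
proof -
  have "((\<lambda>x::R4. (x-y) \<bullet> (x-y)) has_derivative (\<lambda>h. 2 * ((x-y) \<bullet> h))) (at x)"
    by (auto intro!: derivative_eq_intros simp: inner_commute)
  then show ?thesis
    using has_derivative_compose[of "\<lambda>x::R4. (x-y) \<bullet> (x-y)" _ x UNIV F "(*) F'"] assms
    by (simp add: has_field_derivative_def)
qed

lemma cpartial_radial:
  assumes "(F has_real_derivative F') (at ((x-y) \<bullet> (x-y)))"
  shows "cpartial i (\<lambda>x. F ((x-y) \<bullet> (x-y))) x = 2 * (x $ i - y $ i) * F'"
  using cpartial_eq[OF radial_has_derivative[OF assms], of i] by (simp add: inner_axis)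

lemma radial_algebra_deriv:
  assumes "radial_algebra y e f" "e > 0"
  shows "(\<forall>x. f differentiable (at x)) \<and> (\<forall>i. radial_algebra y e (cpartial i f))"
  using assms(1)
proof induction
  case (const c)
  have "cpartial i (\<lambda>x. c) = (\<lambda>x. 0)" for i
    by (rule ext, subst cpartial_eq[where D = "\<lambda>x. 0"]) auto
  then show ?case using radial_algebra.const by auto
next
  case (coord j)
  have d: "((\<lambda>x::R4. x $ j) has_derivative (\<lambda>x. x $ j)) (at x)" for x
    by (rule bounded_linear_imp_has_derivative) (rule bounded_linear_vec_nth)
  have "cpartial i (\<lambda>x. x $ j) = (\<lambda>x. axis i 1 $ j)" for i
    by (rule ext, subst cpartial_eq[OF d]) auto
  then show ?case using radial_algebra.const d differentiableI by metis
next
  case (bump k)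
  let ?D = "\<lambda>s. (bump (k+2) (1-s^2) - k * bump (k+1) (1-s^2)) * (- (2 * s))"
  have d: "((\<lambda>s. bump k (1 - s^2)) has_real_derivative ?D s) (at s)" for s
    by (auto intro!: derivative_eq_intros)
  have c: "cpartial i (\<lambda>x. bump k (1 - ((x-y) \<bullet> (x-y))^2))
     = (\<lambda>x. 2 * (x $ i + (-1) * y $ i) * ?D ((x-y) \<bullet> (x-y)))" for i
    by (rule ext, subst cpartial_radial[where F = "\<lambda>s. bump k (1 - s^2)", OF d]) auto
  \<comment> \<open>Differentiating the inner square produces the factor |x-y|^2, which is not a
    generator but a polynomial in the coordinates. Differences are written with (-1) because the
    algebra offers only sums and products.\<close>
  have s: "radial_algebra y e (\<lambda>x. (x-y) \<bullet> (x-y))"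
  proof -
    have "radial_algebra y e (\<lambda>x. (x $ j + (-1) * y $ j) * (x $ j + (-1) * y $ j))" for j
      by (intro radial_algebra.intros)
    then have "radial_algebra y e (\<lambda>x. (x$1 + (-1)*y$1)*(x$1 + (-1)*y$1) + ((x$2 + (-1)*y$2)*(x$2 + (-1)*y$2)
       + ((x$3 + (-1)*y$3)*(x$3 + (-1)*y$3) + (x$4 + (-1)*y$4)*(x$4 + (-1)*y$4))))"
      by (intro radial_algebra.add)
    moreover have "(x-y) \<bullet> (x-y) = (x$1 + (-1)*y$1)*(x$1 + (-1)*y$1) + ((x$2 + (-1)*y$2)*(x$2 + (-1)*y$2)
       + ((x$3 + (-1)*y$3)*(x$3 + (-1)*y$3) + (x$4 + (-1)*y$4)*(x$4 + (-1)*y$4)))" for x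
      by (simp add: inner_vec_def sum_4)
    ultimately show ?thesis by simp
  qed
  have "radial_algebra y e (\<lambda>x. 2 * (x $ i + (-1) * y $ i) * ((bump (k+2) (1-((x-y) \<bullet> (x-y))^2)
     + (- real k) * bump (k+1) (1-((x-y) \<bullet> (x-y))^2)) * ((-2) * ((x-y) \<bullet> (x-y)))))" for i
    by (intro radial_algebra.intros s)
  then have "radial_algebra y e (cpartial i (\<lambda>x. bump k (1 - ((x-y) \<bullet> (x-y))^2)))" for i
    unfolding c by simp
  moreover have "(\<lambda>x. bump k (1 - ((x-y) \<bullet> (x-y))^2)) differentiable at x" for x
    using radial_has_derivative[OF d] by (rule differentiableI)
  ultimately show ?case by blast
next
  case inv
  let ?D = "\<lambda>s. - (inverse (s+e) * inverse (s+e))"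
  have d: "((\<lambda>s. inverse (s+e)) has_real_derivative ?D s) (at s)" if "s \<ge> 0" for s
    using that assms(2) by (auto intro!: derivative_eq_intros)
  have d': "((\<lambda>s. inverse (s+e)) has_real_derivative ?D ((x-y)\<bullet>(x-y))) (at ((x-y)\<bullet>(x-y)))" for x
    by (rule d) simp
  have c: "cpartial i (\<lambda>x. inverse ((x-y) \<bullet> (x-y) + e))
     = (\<lambda>x. 2 * (x $ i + (-1) * y $ i) * ?D ((x-y) \<bullet> (x-y)))" for i
    by (rule ext, subst cpartial_radial[where F = "\<lambda>s. inverse (s+e)", OF d']) auto
  have "radial_algebra y e (\<lambda>x. 2 * (x $ i + (-1) * y $ i) * ((-1) * (inverse ((x-y) \<bullet> (x-y) + e) * inverse ((x-y) \<bullet> (x-y) + e))))" for i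
    by (intro radial_algebra.intros)
  then have "radial_algebra y e (cpartial i (\<lambda>x. inverse ((x-y) \<bullet> (x-y) + e)))" for i
    unfolding c by simp
  moreover have "(\<lambda>x. inverse ((x-y) \<bullet> (x-y) + e)) differentiable at x" for x
    using radial_has_derivative[OF d'] by (rule differentiableI)
  ultimately show ?case by blast
next
  case (add f g)
  have "cpartial i (\<lambda>x. f x + g x) = (\<lambda>x. cpartial i f x + cpartial i g x)" for i
  proof
    fix x
    have "(f has_derivative frechet_derivative f (at x)) (at x)" "(g has_derivative frechet_derivative g (at x)) (at x)"
      using add.IH by (simp_all add: frechet_derivative_works[symmetric])
    from cpartial_eq[OF has_derivative_add[OF this]]
    show "cpartial i (\<lambda>x. f x + g x) x = cpartial i f x + cpartial i g x"
      by (simp add: cpartial_def)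
  qed
  then show ?case using add.IH radial_algebra.add by (auto intro: differentiable_add)
next
  case (mult f g)
  have "cpartial i (\<lambda>x. f x * g x) = (\<lambda>x. f x * cpartial i g x + cpartial i f x * g x)" for i
  proof
    fix x
    have "(f has_derivative frechet_derivative f (at x)) (at x)" "(g has_derivative frechet_derivative g (at x)) (at x)"
      using mult.IH by (simp_all add: frechet_derivative_works[symmetric])
    from cpartial_eq[OF has_derivative_mult[OF this]]
    show "cpartial i (\<lambda>x. f x * g x) x = f x * cpartial i g x + cpartial i f x * g x"
      by (simp add: cpartial_def)
  qed
  moreover have "radial_algebra y e (\<lambda>x. f x * cpartial i g x + cpartial i f x * g x)" for i
    using mult by (intro radial_algebra.add radial_algebra.mult) auto
  ultimately show ?case using mult.IH by (auto intro: differentiable_mult)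
qed

section \<open>Laplacians of radial functions and of the truncated kernel\<close>

lemma laplacian_radial:
  assumes F: "\<And>s. s \<ge> 0 \<Longrightarrow> (F has_real_derivative F' s) (at s)"
    and F': "\<And>s. s \<ge> 0 \<Longrightarrow> (F' has_real_derivative F'' s) (at s)"
  shows "cpartial i (cpartial j (\<lambda>x. F ((x-y) \<bullet> (x-y)))) x
      = 4 * (x$i - y$i) * (x$j - y$j) * F'' ((x-y)\<bullet>(x-y)) + (if i = j then 2 * F' ((x-y)\<bullet>(x-y)) else 0)" (is ?A)
    and "(\<Sum>i\<in>UNIV. cpartial i (cpartial i (\<lambda>x. F ((x-y) \<bullet> (x-y)))) x)
      = 4 * ((x-y)\<bullet>(x-y)) * F'' ((x-y)\<bullet>(x-y)) + 8 * F' ((x-y)\<bullet>(x-y))"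
proof -
  have c: "cpartial j (\<lambda>x. F ((x-y) \<bullet> (x-y))) = (\<lambda>x. 2 * (x$j - y$j) * F' ((x-y)\<bullet>(x-y)))" for j
    by (rule ext, rule cpartial_radial, rule F) simp
  have "((\<lambda>x. 2 * (x$j - y$j)) has_derivative (\<lambda>h. 2 * h $ j)) (at x)" for j
    by (auto intro!: derivative_eq_intros bounded_linear_imp_has_derivative bounded_linear_vec_nth)
  from has_derivative_mult[OF this radial_has_derivative[where F = F', OF F']]
  have d: "((\<lambda>x. 2 * (x$j - y$j) * F' ((x-y)\<bullet>(x-y))) has_derivative
     (\<lambda>h. 2 * (x$j - y$j) * (F'' ((x-y)\<bullet>(x-y)) * (2 * ((x-y)\<bullet>h))) + 2 * h $ j * F' ((x-y)\<bullet>(x-y)))) (at x)" for j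
    by simp
  have A: "cpartial i (cpartial j (\<lambda>x. F ((x-y) \<bullet> (x-y)))) x
      = 4 * (x$i - y$i) * (x$j - y$j) * F'' ((x-y)\<bullet>(x-y)) + (if i = j then 2 * F' ((x-y)\<bullet>(x-y)) else 0)" for i j
    unfolding c cpartial_eq[OF d] by (simp add: inner_axis) (simp add: axis_def algebra_simps)
  show ?A by (rule A)
  have "(\<Sum>i\<in>UNIV. 4 * (x$i - y$i) * (x$i - y$i) * c) = 4 * ((x-y)\<bullet>(x-y)) * c" for c
    unfolding inner_vec_def sum_distrib_left sum_distrib_right
    by (rule sum.cong) (auto simp: algebra_simps)
  then show "(\<Sum>i\<in>UNIV. cpartial i (cpartial i (\<lambda>x. F ((x-y) \<bullet> (x-y)))) x)
      = 4 * ((x-y)\<bullet>(x-y)) * F'' ((x-y)\<bullet>(x-y)) + 8 * F' ((x-y)\<bullet>(x-y))"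
    by (simp add: A sum.distrib)
qed

text \<open>The factor exp 1 normalises the value at 0 to 1. The argument 1 - s^2, rather than 1 -
  s, makes the derivative vanish at s = 0; this keeps the terms with a differentiated cutoff bounded
  as \<open>e\<close> tends to 0.\<close>

definition cutoff :: "real \<Rightarrow> real" where
  "cutoff s = exp 1 * bump 0 (1 - s^2)"

definition green_test :: "real \<Rightarrow> R4 \<Rightarrow> R4 \<Rightarrow> real" where
  "green_test e y x = cutoff ((x-y)\<bullet>(x-y)) / ((x-y)\<bullet>(x-y) + e)"

lemma cutoff_bounds: "0 \<le> cutoff s" "cutoff s \<le> 1"
  by (auto simp: cutoff_def bump_def mult_exp_exp divide_simps)

lemma cutoff_eq_0: "\<bar>s\<bar> \<ge> 1 \<Longrightarrow> cutoff s = 0"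
  using power2_le_iff_abs_le[of 1 s] abs_square_less_1[of s] by (auto simp: cutoff_def bump_def)

lemma cutoff_mono: "0 \<le> s \<Longrightarrow> s \<le> t \<Longrightarrow> t < 1 \<Longrightarrow> cutoff t \<le> cutoff s"
proof -
  assume *: "0 \<le> s" "s \<le> t" "t < 1"
  then have "s^2 \<le> t^2" "t^2 < 1" by (auto intro: power_mono simp: power_less_one_iff abs_square_less_1)
  then show ?thesis by (auto simp: cutoff_def bump_def frac_le)
qed

lemma cutoff_tendsto: "(cutoff \<longlongrightarrow> 1) (at 0)"
proof -
  have "isCont cutoff 0"
    unfolding cutoff_def by (rule DERIV_isCont) (auto intro!: derivative_eq_intros)
  moreover have "cutoff 0 = 1" by (simp add: cutoff_def bump_def mult_exp_exp)
  ultimately show ?thesis by (simp add: isCont_def)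
qed

lemma test_fun_green_test:
  assumes "e > 0"
  shows "test_fun (green_test e y)"
proof -
  have "radial_algebra y e (green_test e y)"
    unfolding green_test_def[abs_def] cutoff_def divide_inverse
    by (intro radial_algebra.intros)
  then have "smooth (green_test e y)"
    by (rule smooth_coinduct) (use radial_algebra_deriv assms in blast)+
  moreover have "{x. green_test e y x \<noteq> 0} \<subseteq> cball y 1"
  proof (rule subsetI, unfold mem_Collect_eq)
    fix x assume "green_test e y x \<noteq> 0"
    then have "(x-y)\<bullet>(x-y) < 1"
      using cutoff_eq_0[of "(x-y)\<bullet>(x-y)"] by (force simp: green_test_def)
    then show "x \<in> cball y 1"
      by (simp add: dist_commute[of y x]) (simp add: dist_norm norm_eq_sqrt_inner)
  qed
  ultimately show ?thesis unfolding test_fun_def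
    using bounded_cball bounded_subset by blast
qed

text \<open>In dimension four F = 1/(s+e) satisfies 4 s F'' + 8 F' = -8 e/(s+e)^3, a concentrating
  bump. The function \<open>r\<close> collects the terms in which the cutoff is differentiated; it
  lives in the unit ball and is bounded independently of \<open>e\<close>.\<close>

lemma laplacian_green_test:
  assumes e: "e > 0"
  obtains r where "\<And>x. (\<Sum>i\<in>UNIV. cpartial i (cpartial i (green_test e y)) x)
      = r x - 8 * e * cutoff ((x-y)\<bullet>(x-y)) / ((x-y)\<bullet>(x-y) + e)^3"
    and "\<And>x. \<bar>r x\<bar> \<le> 624 * exp 1" "\<And>x. (x-y)\<bullet>(x-y) \<ge> 1 \<Longrightarrow> r x = 0"
proof
  define c1 where "c1 = (\<lambda>s. exp 1 * (bump 2 (1-s^2) * (- (2 * s))))"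
  define c2 where "c2 = (\<lambda>s. exp 1 * ((bump 4 (1-s^2) - 2 * bump 3 (1-s^2)) * (4 * s^2) - 2 * bump 2 (1-s^2)))"
  have d1: "(cutoff has_real_derivative c1 s) (at s)" for s
    unfolding cutoff_def[abs_def] c1_def by (auto intro!: derivative_eq_intros simp: numeral_eq_Suc)
  have d2: "(c1 has_real_derivative c2 s) (at s)" for s
    unfolding c1_def c2_def
    by (auto intro!: derivative_eq_intros simp: numeral_eq_Suc algebra_simps)
  define F1 where "F1 = (\<lambda>s. c1 s / (s+e) - cutoff s / (s+e)^2)"
  define F2 where "F2 = (\<lambda>s. c2 s / (s+e) - 2 * c1 s / (s+e)^2 + 2 * cutoff s / (s+e)^3)"
  have D1: "((\<lambda>s. cutoff s / (s+e)) has_real_derivative F1 s) (at s)" if "s \<ge> 0" for s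
  proof -
    have "s + e \<noteq> 0" using that e by simp
    then show ?thesis unfolding F1_def
      by (auto intro!: derivative_eq_intros d1 simp: divide_simps power2_eq_square)
  qed
  have D2: "(F1 has_real_derivative F2 s) (at s)" if "s \<ge> 0" for s
  proof -
    have ne: "s + e \<noteq> 0" using that e by simp
    have "((\<lambda>s. c1 s / (s+e)) has_real_derivative (c2 s / (s+e) - c1 s / (s+e)^2)) (at s)"
      using ne by (auto intro!: derivative_eq_intros d2 simp: divide_simps power2_eq_square)
    moreover have "((\<lambda>s. cutoff s / (s+e)^2) has_real_derivative (c1 s / (s+e)^2 - 2 * cutoff s / (s+e)^3)) (at s)"
      using ne by (auto intro!: derivative_eq_intros d1 simp: divide_simps power2_eq_square power3_eq_cube) (simp add: algebra_simps)
    ultimately have "(F1 has_real_derivative (c2 s / (s+e) - c1 s / (s+e)^2 - (c1 s / (s+e)^2 - 2 * cutoff s / (s+e)^3))) (at s)"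
      unfolding F1_def by (rule DERIV_diff)
    then show ?thesis by (simp add: F2_def algebra_simps)
  qed
  \<comment> \<open>In the coefficient of \<open>c1\<close> the summands 8/(s+e) and -8 s/(s+e)^2
    combine to 8 e/(s+e)^2. The factor \<open>e\<close> gained by this cancellation, together with
    c1 = O(s), compensates the denominator.\<close>
  define \<rho> where "\<rho> = (\<lambda>s. 8 * e * c1 s / (s+e)^2 + 4 * s * c2 s / (s+e))"
  have id: "4 * s * F2 s + 8 * F1 s = \<rho> s - 8 * e * cutoff s / (s+e)^3" if "s \<ge> 0" for s
  proof -
    have "s + e \<noteq> 0" using that e by simp
    then show ?thesis
      unfolding \<rho>_def F1_def F2_def
      by (simp add: divide_simps) algebra
  qed
  have z: "\<rho> s = 0" if "s \<ge> 1" for s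
  proof -
    have "1 - s^2 \<le> 0" using that by (simp add: one_le_power)
    then show ?thesis by (simp add: \<rho>_def c1_def c2_def bump_def)
  qed
  have bd: "\<bar>\<rho> s\<bar> \<le> 624 * exp 1" if "s \<ge> 0" for s
  proof (cases "s \<ge> 1")
    case True then show ?thesis by (simp add: z)
  next
    case False
    have b2: "bump 2 t \<le> 2" and b3: "bump 3 t \<le> 6" and b4: "bump 4 t \<le> 24" for t
      using bump_le[of 2 t] bump_le[of 3 t] bump_le[of 4 t] by (simp_all add: fact_numeral)
    have s2: "s^2 \<le> 1" "0 \<le> s^2" using that False by (auto simp: power_le_one)
    \<comment> \<open>The linear vanishing of \<open>c1\<close> at 0 is retained, so that e s \<le>
      (s+e)^2 suffices below.\<close>
    have c1: "\<bar>c1 s\<bar> \<le> 4 * exp 1 * s"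
      using mult_left_mono[OF b2[of "1-s^2"], of "2 * exp 1 * s"] bump_nonneg[of 2 "1-s^2"] that
      by (simp add: c1_def abs_mult mult_ac)
    have "\<bar>(bump 4 (1-s^2) - 2 * bump 3 (1-s^2)) * (4 * s^2) - 2 * bump 2 (1-s^2)\<bar> \<le> 148"
    proof -
      have "\<bar>bump 4 (1-s^2) - 2 * bump 3 (1-s^2)\<bar> \<le> 36"
        using b3[of "1-s^2"] b4[of "1-s^2"] bump_nonneg[of 3 "1-s^2"] bump_nonneg[of 4 "1-s^2"] by linarith
      then have "\<bar>(bump 4 (1-s^2) - 2 * bump 3 (1-s^2)) * (4 * s^2)\<bar> \<le> 36 * 4"
        unfolding abs_mult by (rule mult_mono) (use s2 in auto)
      then show ?thesis using b2[of "1-s^2"] bump_nonneg[of 2 "1-s^2"] by linarith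
    qed
    then have c2: "\<bar>c2 s\<bar> \<le> exp 1 * 148" by (simp add: c2_def abs_mult)
    have "\<bar>8 * e * c1 s / (s+e)^2\<bar> \<le> 32 * exp 1"
    proof -
      have "\<bar>8 * e * c1 s / (s+e)^2\<bar> = 8 * e * \<bar>c1 s\<bar> / (s+e)^2" using e by (simp add: abs_mult)
      also have "\<dots> \<le> 8 * e * (4 * exp 1 * s) / (s+e)^2"
        using c1 e by (intro divide_right_mono mult_left_mono) auto
      also have "\<dots> = 32 * exp 1 * (e * s / (s+e)^2)" by simp
      also have "e * s / (s+e)^2 \<le> 1"
      proof -
        have "e * s \<le> (s+e)^2" using e that by (simp add: power2_eq_square algebra_simps)
        then show ?thesis using e that by (simp add: divide_le_eq)
      qed
      finally show ?thesis by simp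
    qed
    moreover have "\<bar>4 * s * c2 s / (s+e)\<bar> \<le> 592 * exp 1"
    proof -
      have "\<bar>4 * s * c2 s / (s+e)\<bar> = 4 * (s / (s+e)) * \<bar>c2 s\<bar>" using e that by (simp add: abs_mult)
      also have "\<dots> \<le> (4 * 1) * (exp 1 * 148)"
        using c2 e that by (intro mult_mono) (auto simp: divide_le_eq)
      finally show ?thesis by simp
    qed
    ultimately have "\<bar>\<rho> s\<bar> \<le> 32 * exp 1 + 592 * exp 1"
      unfolding \<rho>_def by (rule order_trans[OF abs_triangle_ineq add_mono])
    then show ?thesis by simp
  qed
  show "(\<Sum>i\<in>UNIV. cpartial i (cpartial i (green_test e y)) x)
      = \<rho> ((x-y)\<bullet>(x-y)) - 8 * e * cutoff ((x-y)\<bullet>(x-y)) / ((x-y)\<bullet>(x-y) + e)^3" for x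
    using laplacian_radial(2)[of "\<lambda>s. cutoff s / (s+e)" F1 F2, OF D1 D2, of y x] id[of "(x-y)\<bullet>(x-y)"]
    unfolding green_test_def[abs_def] by simp
  show "\<bar>\<rho> ((x-y)\<bullet>(x-y))\<bar> \<le> 624 * exp 1" for x using bd by simp
  show "\<rho> ((x-y)\<bullet>(x-y)) = 0" if "(x-y)\<bullet>(x-y) \<ge> 1" for x using z that by simp
qed

subsection \<open>Radial integrals\<close>

lemma nn_integral_translate:
  fixes f :: "R4 \<Rightarrow> ennreal"
  assumes [measurable]: "f \<in> borel_measurable borel"
  shows "(\<integral>\<^sup>+x. f (x - c) \<partial>lborel) = (\<integral>\<^sup>+x. f x \<partial>lborel)"
proof -
  have "(\<integral>\<^sup>+x. f x \<partial>lborel) = (\<integral>\<^sup>+x. f x \<partial>distr lborel borel ((+) (- c)))"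
    by (simp add: lborel_distr_plus)
  also have "\<dots> = (\<integral>\<^sup>+x. f (- c + x) \<partial>lborel)"
    by (subst nn_integral_distr) auto
  finally show ?thesis by (simp add: algebra_simps)
qed

text \<open>The derivative is prescribed only in the open interval: at the endpoint 0 a quotient
  such as 1/s takes its default value 0, and a fractional power need not be differentiable. Two
  points do not affect the integral.\<close>

lemma nn_integral_FTC_interior:
  fixes f F :: "real \<Rightarrow> real"
  assumes [measurable]: "f \<in> borel_measurable borel" and "a \<le> b" "continuous_on {a..b} F"
    and "\<And>s. a < s \<Longrightarrow> s < b \<Longrightarrow> 0 \<le> f s \<and> (F has_real_derivative f s) (at s)"
  shows "(\<integral>\<^sup>+s. ennreal (f s) * indicator {a..b} s \<partial>lborel) = ennreal (F b - F a)"
proof -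
  let ?h = "\<lambda>s. f s * indicator {a<..<b} s"
  have "(f has_integral F b - F a) {a..b}"
    using assms by (intro fundamental_theorem_of_calculus_interior)
      (auto simp: has_real_derivative_iff_has_vector_derivative)
  then have "(f has_integral F b - F a) {a<..<b}"
    by (simp add: has_integral_Icc_iff_Ioo)
  then have "((\<lambda>s. if s \<in> {a<..<b} then f s else 0) has_integral F b - F a) UNIV"
    by (subst has_integral_restrict_UNIV)
  also have "(\<lambda>s. if s \<in> {a<..<b} then f s else 0) = ?h"
    by (auto simp: indicator_def)
  finally have "(\<integral>\<^sup>+s. ennreal (?h s) \<partial>lborel) = ennreal (F b - F a)"
    by (intro nn_integral_has_integral_lborel) (use assms(4) in \<open>auto simp: indicator_def\<close>)
  moreover have "(\<integral>\<^sup>+s. ennreal (?h s) \<partial>lborel) = (\<integral>\<^sup>+s. ennreal (f s) * indicator {a..b} s \<partial>lborel)"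
  proof (rule nn_integral_cong_AE)
    have "AE s in lborel. s \<noteq> a \<and> s \<noteq> b"
      using AE_lborel_singleton[of a] AE_lborel_singleton[of b] by eventually_elim auto
    then show "AE s in lborel. ennreal (?h s) = ennreal (f s) * indicator {a..b} s"
      by eventually_elim (auto simp: indicator_def)
  qed
  ultimately show ?thesis by simp
qed

text \<open>Polar coordinates in the variable s = |x|^2. Half-lines form an intersection-stable
  generator, and the preimage of the half-line up to r is a ball of volume (pi^2/2) r^2, whose
  derivative in r is the density.\<close>

lemma distr_norm_square:
  "distr lborel borel (\<lambda>x::R4. x \<bullet> x) = density lborel (\<lambda>s. ennreal (pi^2 * s) * indicator {0..} s)"
proof (rule measure_eqI_generator_eq[where E = "range atMost" and \<Omega> = UNIV and A = "\<lambda>n. {..real n}"])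
  have 1: "emeasure (distr lborel borel (\<lambda>x::R4. x \<bullet> x)) {..r} = ennreal (if r \<ge> 0 then pi^2 / 2 * r^2 else 0)" for r
  proof -
    have "emeasure (distr lborel borel (\<lambda>x::R4. x \<bullet> x)) {..r} = emeasure lborel {x::R4. x \<bullet> x \<le> r}"
      by (subst emeasure_distr) (auto intro!: arg_cong[where f = "emeasure lborel"])
    also have "\<dots> = ennreal (if r \<ge> 0 then pi^2 / 2 * r^2 else 0)"
    proof (cases "r \<ge> 0")
      case True
      have "x \<bullet> x \<le> r \<longleftrightarrow> norm x \<le> sqrt r" for x :: R4
        by (simp add: norm_eq_sqrt_inner)
      then have "{x::R4. x \<bullet> x \<le> r} = {x. norm x \<le> sqrt r}" by (rule Collect_cong)
      also have "\<dots> = cball 0 (sqrt r)" by (simp add: cball_def)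
      finally have "{x::R4. x \<bullet> x \<le> r} = cball 0 (sqrt r)" .
      moreover have "(sqrt r) ^ 4 = r^2"
        using True power_mult[of "sqrt r" 2 2] by simp
      ultimately show ?thesis using True by (simp add: emeasure_cball unit_ball_vol_4)
    next
      case False
      then have "{x::R4. x \<bullet> x \<le> r} = {}" using inner_ge_zero order_trans by blast
      then show ?thesis using False by simp
    qed
    finally show ?thesis .
  qed
  have 2: "emeasure (density lborel (\<lambda>s. ennreal (pi^2 * s) * indicator {0..} s)) {..r}
      = ennreal (if r \<ge> 0 then pi^2 / 2 * r^2 else 0)" for r
  proof -
    have "emeasure (density lborel (\<lambda>s. ennreal (pi^2 * s) * indicator {0..} s)) {..r}
       = (\<integral>\<^sup>+s. ennreal (pi^2 * s) * indicator {0..r} s \<partial>lborel)"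
      by (subst emeasure_density) (auto intro!: nn_integral_cong simp: indicator_def)
    also have "\<dots> = ennreal (if r \<ge> 0 then pi^2 / 2 * r^2 else 0)"
    proof (cases "r \<ge> 0")
      case True
      have "(\<integral>\<^sup>+s. ennreal (pi^2 * s) * indicator {0..r} s \<partial>lborel) = ennreal (pi^2 / 2 * r^2 - pi^2 / 2 * 0^2)"
        by (rule nn_integral_FTC_interior)
          (use True in \<open>auto intro!: derivative_eq_intros continuous_intros\<close>)
      then show ?thesis using True by simp
    qed simp
    finally show ?thesis .
  qed
  show "emeasure (distr lborel borel (\<lambda>x::R4. x \<bullet> x)) X
      = emeasure (density lborel (\<lambda>s. ennreal (pi^2 * s) * indicator {0..} s)) X" if "X \<in> range atMost" for X
    using that 1 2 by auto
  show "emeasure (distr lborel borel (\<lambda>x::R4. x \<bullet> x)) {..real n} \<noteq> \<infinity>" for n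
    by (simp add: 1)
  show "Int_stable (range (atMost :: real \<Rightarrow> _))"
    by (auto simp: Int_stable_def)
  show "(\<Union>i. {..real i}) = UNIV" by (auto simp: real_arch_simple)
qed (auto simp: borel_eq_atMost)

lemma nn_integral_radial:
  assumes [measurable]: "f \<in> borel_measurable borel"
  shows "(\<integral>\<^sup>+(x::R4). f ((x-y) \<bullet> (x-y)) \<partial>lborel) = (\<integral>\<^sup>+s. f s * (ennreal (pi^2 * s) * indicator {0..} s) \<partial>lborel)"
proof -
  have "(\<integral>\<^sup>+(x::R4). f ((x-y) \<bullet> (x-y)) \<partial>lborel) = (\<integral>\<^sup>+(x::R4). f (x \<bullet> x) \<partial>lborel)"
    by (rule nn_integral_translate) simp
  also have "\<dots> = (\<integral>\<^sup>+s. f s \<partial>distr lborel borel (\<lambda>x::R4. x \<bullet> x))"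
    by (subst nn_integral_distr) auto
  also have "\<dots> = (\<integral>\<^sup>+s. f s * (ennreal (pi^2 * s) * indicator {0..} s) \<partial>lborel)"
    unfolding distr_norm_square by (subst nn_integral_density) (auto simp: mult.commute)
  finally show ?thesis .
qed

lemma nn_integral_annulus:
  fixes g F :: "real \<Rightarrow> real"
  assumes [measurable]: "g \<in> borel_measurable borel" and ab: "0 \<le> a" "a \<le> b" "continuous_on {a..b} F"
    and F: "\<And>s. a < s \<Longrightarrow> s < b \<Longrightarrow> 0 \<le> g s \<and> (F has_real_derivative pi^2 * s * g s) (at s)"
  shows "(\<integral>\<^sup>+(x::R4). ennreal (g ((x-y) \<bullet> (x-y))) * indicator {a..b} ((x-y) \<bullet> (x-y)) \<partial>lborel) = ennreal (F b - F a)"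
proof -
  have "(\<integral>\<^sup>+(x::R4). ennreal (g ((x-y) \<bullet> (x-y))) * indicator {a..b} ((x-y) \<bullet> (x-y)) \<partial>lborel)
     = (\<integral>\<^sup>+s. ennreal (g s) * indicator {a..b} s * (ennreal (pi^2 * s) * indicator {0..} s) \<partial>lborel)"
    by (rule nn_integral_radial) simp
  also have "\<dots> = (\<integral>\<^sup>+s. ennreal (pi^2 * s * g s) * indicator {a..b} s \<partial>lborel)"
    by (rule nn_integral_cong) (use ab in \<open>auto simp: indicator_def ennreal_mult''[symmetric] mult_ac\<close>)
  also have "\<dots> = ennreal (F b - F a)"
    using F ab by (intro nn_integral_FTC_interior) auto
  finally show ?thesis .
qed

subsection \<open>The Newton kernel\<close>

text \<open>The normalising factor $1/4\pi^2$ is omitted; the value at the origin is $1/0 = 0$.\<close>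

definition kernel :: "R4 \<Rightarrow> real" where
  "kernel x = (if x \<bullet> x \<le> 1 then 1 / (x \<bullet> x) else 0)"

lemma kernel_nonneg: "kernel x \<ge> 0"
  by (simp add: kernel_def)

lemma measurable_kernel [measurable]: "kernel \<in> borel_measurable borel"
  unfolding kernel_def[abs_def] by measurable

lemma nn_integral_inverse_ball:
  assumes "0 \<le> b"
  shows "(\<integral>\<^sup>+(x::R4). ennreal (1 / ((x-y) \<bullet> (x-y))) * indicator {0..b} ((x-y) \<bullet> (x-y)) \<partial>lborel) = ennreal (pi^2 * b)"
proof -
  have "(\<integral>\<^sup>+(x::R4). ennreal (1 / ((x-y) \<bullet> (x-y))) * indicator {0..b} ((x-y) \<bullet> (x-y)) \<partial>lborel)
      = ennreal (pi^2 * b - pi^2 * 0)"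
    by (rule nn_integral_annulus)
      (use assms in \<open>auto intro!: derivative_eq_intros continuous_intros\<close>)
  then show ?thesis by simp
qed

lemma nn_integral_kernel: "(\<integral>\<^sup>+x. ennreal (kernel (x - y)) \<partial>lborel) = ennreal (pi^2)"
proof -
  have "ennreal (kernel (x-y)) = ennreal (1 / ((x-y) \<bullet> (x-y))) * indicator {0..1} ((x-y) \<bullet> (x-y))" for x
    by (auto simp: kernel_def indicator_def)
  then show ?thesis using nn_integral_inverse_ball[of 1 y] by simp
qed

text \<open>For |x| > M |z| the length of x - z is at least (1 - 1/M) |x|, so the product is almost
  1/|x|^4: the source of the logarithm. Otherwise one of |x|, |x-z| is at least |z|/2, its kernel is
  at most 4/|z|^2, and the other kernel is confined to a ball of radius proportional to |z|.\<close>

lemma kernel_convolution_pointwise: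
  fixes x z :: R4
  assumes z: "z \<noteq> 0" and M: "M > 1"
  shows "kernel x * kernel (x - z) \<le> 1 / (1 - 1/M)^2 / (x \<bullet> x)^2 * indicator {min 1 (M^2 * (z \<bullet> z))..1} (x \<bullet> x)
     + 4 / (z \<bullet> z) * (1 / (x \<bullet> x) * indicator {0..M^2 * (z \<bullet> z)} (x \<bullet> x)
        + 1 / ((x-z) \<bullet> (x-z)) * indicator {0..(M+1)^2 * (z \<bullet> z)} ((x-z) \<bullet> (x-z)))" (is "_ \<le> ?A + ?B")
proof -
  have A0: "?A \<ge> 0" by simp
  have B0: "?B \<ge> 0" by simp
  have n: "v \<bullet> v = (norm v)^2" for v :: R4 by (rule dot_square_norm)
  have zp: "norm z > 0" using z by simp
  show ?thesis
  proof (cases "x \<bullet> x \<le> 1 \<and> (x-z) \<bullet> (x-z) \<le> 1 \<and> x \<noteq> 0 \<and> x \<noteq> z")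
    case False
    then have "kernel x * kernel (x - z) = 0" by (auto simp: kernel_def)
    then show ?thesis using A0 B0 by linarith
  next
    case True
    then have xp: "norm x > 0" "norm (x - z) > 0" and k: "kernel x * kernel (x-z) = 1 / (norm x)^2 * (1 / (norm (x-z))^2)"
      by (auto simp: kernel_def n)
    show ?thesis
    proof (cases "norm x > M * norm z")
      case far: True
      then have "norm z \<le> norm x / M" using M by (simp add: field_simps)
      then have "norm (x - z) \<ge> (1 - 1/M) * norm x"
        using norm_triangle_ineq2[of x z] by (simp add: algebra_simps)
      moreover have "0 < (1 - 1/M) * norm x" using M xp by simp
      ultimately have "1 / (norm (x-z))^2 \<le> 1 / ((1 - 1/M) * norm x)^2"
        using xp by (intro divide_left_mono power_mono mult_pos_pos[OF zero_less_power zero_less_power]) auto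
      then have "1 / (norm x)^2 * (1 / (norm (x-z))^2) \<le> 1 / (norm x)^2 * (1 / ((1 - 1/M) * norm x)^2)"
        by (rule mult_left_mono) simp
      also have "\<dots> = 1 / (1 - 1/M)^2 / ((norm x)^2)^2"
        by (simp add: power2_eq_square)
      also have "\<dots> = ?A"
      proof -
        have "M^2 * (z \<bullet> z) \<le> x \<bullet> x"
          using power_mono[of "M * norm z" "norm x" 2] far M by (simp add: n power_mult_distrib)
        then show ?thesis using True by (simp add: n)
      qed
      finally show ?thesis using k B0 by linarith
    next
      case near: False
      then have i1: "x \<bullet> x \<le> M^2 * (z \<bullet> z)"
        using power_mono[of "norm x" "M * norm z" 2] by (simp add: n power_mult_distrib)
      have "norm (x - z) \<le> (M+1) * norm z"
        using norm_triangle_ineq4[of x z] near by (simp add: algebra_simps)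
      then have i2: "(x-z) \<bullet> (x-z) \<le> (M+1)^2 * (z \<bullet> z)"
        using power_mono[of "norm (x-z)" "(M+1) * norm z" 2] by (simp add: n power_mult_distrib)
      have B: "?B = 4 / (norm z)^2 * (1 / (norm x)^2 + 1 / (norm (x-z))^2)"
        using i1 i2 by (simp add: n)
      have inv: "1 / r^2 \<le> 4 / (norm z)^2" if "r \<ge> norm z / 2" for r
      proof -
        have "1 / r^2 \<le> 1 / (norm z / 2)^2"
          by (rule frac_le[OF _ _ _ power_mono]) (use that zp in auto)
        then show ?thesis by (simp add: power_divide)
      qed
      have "norm z \<le> norm x + norm (x - z)" using norm_triangle_ineq4[of x "x - z"] by simp
      then consider "norm x \<ge> norm z / 2" | "norm (x-z) \<ge> norm z / 2" by linarith
      then have "1 / (norm x)^2 * (1 / (norm (x-z))^2) \<le> ?B"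
      proof cases
        case 1
        have "1 / (norm x)^2 * (1 / (norm (x-z))^2) \<le> 4 / (norm z)^2 * (1 / (norm (x-z))^2)"
          by (rule mult_right_mono[OF inv[OF 1]]) simp
        also have "\<dots> \<le> 4 / (norm z)^2 * (1 / (norm x)^2 + 1 / (norm (x-z))^2)"
          by (rule mult_left_mono) simp_all
        finally show ?thesis unfolding B .
      next
        case 2
        have "1 / (norm x)^2 * (1 / (norm (x-z))^2) \<le> 1 / (norm x)^2 * (4 / (norm z)^2)"
          by (rule mult_left_mono[OF inv[OF 2]]) simp
        also have "\<dots> \<le> 4 / (norm z)^2 * (1 / (norm x)^2 + 1 / (norm (x-z))^2)"
          by (simp add: algebra_simps)
        finally show ?thesis unfolding B .
      qed
      then show ?thesis using k A0 by linarith
    qed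
  qed
qed

text \<open>In the variable s = |x|^2 the far part has density pi^2/s and gives pi^2 ln(1/a). Each
  near part integrates to a multiple of |z|^2, which the prefactor 4/|z|^2 turns into a constant.
  Only the coefficient of the logarithm has to be sharp.\<close>

lemma kernel_convolution_le:
  fixes z :: R4
  assumes z: "z \<noteq> 0" and M: "M > 1"
  shows "(\<integral>\<^sup>+x. ennreal (kernel x * kernel (x - z)) \<partial>lborel)
     \<le> ennreal (1 / (1 - 1/M)^2 * pi^2 * max 0 (ln (1 / (z \<bullet> z))) + 4 * pi^2 * (M^2 + (M+1)^2))"
proof -
  define q where "q = z \<bullet> z"
  define \<theta> where "\<theta> = 1 / (1 - 1/M)^2"
  \<comment> \<open>The cap at 1 keeps the annulus well formed when M |z| > 1; its integral is then
    0.\<close>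
  define a where "a = min 1 (M^2 * q)"
  have q: "q > 0" using z by (simp add: q_def)
  have \<theta>: "\<theta> \<ge> 0" by (simp add: \<theta>_def)
  have a: "0 < a" "a \<le> 1" using q M by (auto simp: a_def)
  have "(\<integral>\<^sup>+x. ennreal (kernel x * kernel (x - z)) \<partial>lborel)
     \<le> (\<integral>\<^sup>+x. ennreal \<theta> * (ennreal (1 / ((x-0) \<bullet> (x-0))^2) * indicator {a..1} ((x-0) \<bullet> (x-0)))
      + ennreal (4/q) * (ennreal (1 / ((x-0) \<bullet> (x-0))) * indicator {0..M^2 * q} ((x-0) \<bullet> (x-0))
        + ennreal (1 / ((x-z) \<bullet> (x-z))) * indicator {0..(M+1)^2 * q} ((x-z) \<bullet> (x-z))) \<partial>lborel)"
  proof (rule nn_integral_mono)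
    fix x
    have "ennreal (kernel x * kernel (x - z)) \<le> ennreal (\<theta> * (1 / (x \<bullet> x)^2 * indicator {a..1} (x \<bullet> x))
     + 4/q * (1 / (x \<bullet> x) * indicator {0..M^2 * q} (x \<bullet> x)
        + 1 / ((x-z) \<bullet> (x-z)) * indicator {0..(M+1)^2 * q} ((x-z) \<bullet> (x-z))))"
      using kernel_convolution_pointwise[OF z M, of x] unfolding \<theta>_def a_def q_def
      by (intro ennreal_leI) simp
    also have "\<dots> = ennreal \<theta> * (ennreal (1 / ((x-0) \<bullet> (x-0))^2) * indicator {a..1} ((x-0) \<bullet> (x-0)))
      + ennreal (4/q) * (ennreal (1 / ((x-0) \<bullet> (x-0))) * indicator {0..M^2 * q} ((x-0) \<bullet> (x-0))
        + ennreal (1 / ((x-z) \<bullet> (x-z))) * indicator {0..(M+1)^2 * q} ((x-z) \<bullet> (x-z)))"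
      using \<theta> q by (simp add: ennreal_plus ennreal_mult ennreal_indicator del: times_divide_eq_left times_divide_eq_right)
    finally show "ennreal (kernel x * kernel (x - z)) \<le> \<dots>" .
  qed
  also have "\<dots> = ennreal \<theta> * (\<integral>\<^sup>+(x::R4). ennreal (1 / ((x-0) \<bullet> (x-0))^2) * indicator {a..1} ((x-0) \<bullet> (x-0)) \<partial>lborel)
      + ennreal (4/q) * ((\<integral>\<^sup>+(x::R4). ennreal (1 / ((x-0) \<bullet> (x-0))) * indicator {0..M^2 * q} ((x-0) \<bullet> (x-0)) \<partial>lborel)
        + (\<integral>\<^sup>+x. ennreal (1 / ((x-z) \<bullet> (x-z))) * indicator {0..(M+1)^2 * q} ((x-z) \<bullet> (x-z)) \<partial>lborel))"
    by (subst nn_integral_add, measurable, subst nn_integral_cmult, measurable,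
        subst nn_integral_cmult, measurable, subst nn_integral_add, measurable)
  also have "(\<integral>\<^sup>+(x::R4). ennreal (1 / ((x-0) \<bullet> (x-0))^2) * indicator {a..1} ((x-0) \<bullet> (x-0)) \<partial>lborel)
      = ennreal (pi^2 * ln 1 - pi^2 * ln a)"
    by (rule nn_integral_annulus)
      (use a in \<open>auto intro!: derivative_eq_intros continuous_intros simp: power2_eq_square\<close>)
  also have "(\<integral>\<^sup>+(x::R4). ennreal (1 / ((x-0) \<bullet> (x-0))) * indicator {0..M^2 * q} ((x-0) \<bullet> (x-0)) \<partial>lborel)
      = ennreal (pi^2 * (M^2 * q))"
    by (rule nn_integral_inverse_ball) (use q in simp)
  also have "(\<integral>\<^sup>+x. ennreal (1 / ((x-z) \<bullet> (x-z))) * indicator {0..(M+1)^2 * q} ((x-z) \<bullet> (x-z)) \<partial>lborel)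
      = ennreal (pi^2 * ((M+1)^2 * q))"
    by (rule nn_integral_inverse_ball) (use q in simp)
  also have "ennreal \<theta> * ennreal (pi^2 * ln 1 - pi^2 * ln a) + ennreal (4/q) * (ennreal (pi^2 * (M^2 * q)) + ennreal (pi^2 * ((M+1)^2 * q)))
      = ennreal (\<theta> * pi^2 * (- ln a) + 4/q * (pi^2 * (M^2 * q) + pi^2 * ((M+1)^2 * q)))"
  proof -
    define L where "L = - ln a"
    have "L \<ge> 0" "pi^2 * ln 1 - pi^2 * ln a = pi^2 * L" using a by (simp_all add: L_def)
    then show ?thesis using \<theta> q unfolding L_def[symmetric]
      by (simp add: ennreal_plus[symmetric] ennreal_mult[symmetric] mult.assoc del: ennreal_plus)
  qed
  also have "\<dots> \<le> ennreal (\<theta> * pi^2 * max 0 (ln (1 / q)) + 4 * pi^2 * (M^2 + (M+1)^2))"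
  proof (rule ennreal_leI, rule add_mono)
    have "- ln a \<le> max 0 (ln (1/q))"
    proof (cases "M^2 * q \<le> 1")
      case True
      have "1 \<le> M^2" using M by (simp add: one_le_power)
      then have "q \<le> M^2 * q" using q by simp
      then have "ln q \<le> ln (M^2 * q)" using q M by (subst ln_le_cancel_iff) auto
      then show ?thesis using True q by (simp add: a_def ln_div)
    qed (simp add: a_def)
    then show "\<theta> * pi^2 * (- ln a) \<le> \<theta> * pi^2 * max 0 (ln (1 / q))"
      using \<theta> by (intro mult_left_mono) auto
    show "4/q * (pi^2 * (M^2 * q) + pi^2 * ((M+1)^2 * q)) \<le> 4 * pi^2 * (M^2 + (M+1)^2)"
      using q by (simp add: field_simps)
  qed
  finally show ?thesis by (simp add: q_def \<theta>_def)
qed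

text \<open>Split at |x-y|^2 = sqrt m. Beyond this level the logarithm is at most (1/2) ln(1/m);
  below it the excess ln(sqrt m/s) is at most sqrt m/s, whose contribution is bounded by pi^2 m
  whatever the shape of E. The factor 1/2 enters the leading coefficient of the potential
  estimate.\<close>

lemma nn_integral_log_le:
  fixes E :: "R4 set"
  assumes [measurable]: "E \<in> sets borel" and E: "emeasure lborel E = ennreal m" and m: "m > 0"
  shows "(\<integral>\<^sup>+x. ennreal (max 0 (ln (1 / ((x-y) \<bullet> (x-y))))) * indicator E x \<partial>lborel)
    \<le> ennreal (m * (1/2 * max 0 (ln (1/m)) + pi^2))"
proof -
  define \<rho> where "\<rho> = sqrt m"
  have \<rho>: "\<rho> > 0" "\<rho> * \<rho> = m" using m by (auto simp: \<rho>_def)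
  define L where "L = 1/2 * max 0 (ln (1/m))"
  have L: "L \<ge> 0" by (simp add: L_def)
  have "max 0 (ln (1/s)) \<le> L + \<rho> * (1 / s * indicator {0..\<rho>} s)" if "s \<ge> 0" for s
  proof (cases "s = 0")
    case True then show ?thesis using L by simp
  next
    case False
    then have s: "s > 0" using that by simp
    have "ln (1/\<rho>) = 1/2 * ln (1/m)" using m by (simp add: \<rho>_def ln_div ln_sqrt)
    then have 1: "ln (1/\<rho>) \<le> L" unfolding L_def by simp
    have 2: "ln (1/s) = ln (1/\<rho>) + ln (\<rho>/s)" using s \<rho> by (simp add: ln_div)
    have 3: "ln (\<rho>/s) \<le> \<rho> * (1 / s * indicator {0..\<rho>} s)"
    proof (cases "s \<le> \<rho>")
      case True then show ?thesis using ln_le_minus_one[of "\<rho>/s"] s \<rho> by simp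
    next
      case False then show ?thesis using s \<rho> by (simp add: ln_div)
    qed
    have 4: "0 \<le> \<rho> * (1 / s * indicator {0..\<rho>} s)" using s \<rho> by simp
    show ?thesis using 1 2 3 4 L by linarith
  qed
  then have "(\<integral>\<^sup>+x. ennreal (max 0 (ln (1 / ((x-y) \<bullet> (x-y))))) * indicator E x \<partial>lborel)
      \<le> (\<integral>\<^sup>+x. ennreal (L + \<rho> * (1 / ((x-y) \<bullet> (x-y)) * indicator {0..\<rho>} ((x-y) \<bullet> (x-y)))) * indicator E x \<partial>lborel)"
    by (intro nn_integral_mono mult_right_mono ennreal_leI) auto
  also have "\<dots> \<le> (\<integral>\<^sup>+x. ennreal L * indicator E x + ennreal \<rho> * (ennreal (1 / ((x-y) \<bullet> (x-y))) * indicator {0..\<rho>} ((x-y) \<bullet> (x-y))) \<partial>lborel)"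
    by (rule nn_integral_mono)
      (use \<rho> L in \<open>auto simp: indicator_def ennreal_plus ennreal_mult[symmetric] simp del: times_divide_eq_right\<close>)
  also have "\<dots> = ennreal L * ennreal m + ennreal \<rho> * ennreal (pi^2 * \<rho>)"
    using nn_integral_inverse_ball[of \<rho> y] \<rho>
    by (simp add: nn_integral_add nn_integral_cmult E)
  also have "\<dots> = ennreal (m * (L + pi^2))"
    using L \<rho> m by (simp add: ennreal_plus[symmetric] ennreal_mult[symmetric] algebra_simps del: ennreal_plus)
  finally show ?thesis by (simp add: L_def)
qed

text \<open>The same splitting at |x|^2 = sqrt m: inside, the weight is integrated over the whole
  ball; outside, it is at most m^(-\<beta>/4). Both contributions scale like m^(1 -
  \<beta>/4).\<close>

lemma nn_integral_weight_le:
  fixes E :: "R4 set"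
  assumes [measurable]: "E \<in> sets borel" and E: "emeasure lborel E = ennreal m" and m: "m > 0"
    and \<beta>: "0 \<le> \<beta>" "\<beta> < 4"
  shows "(\<integral>\<^sup>+x. ennreal (1 / norm x powr \<beta>) * indicator E x \<partial>lborel)
    \<le> ennreal ((pi^2 / (2 - \<beta>/2) + 1) * m powr (1 - \<beta>/4))"
proof -
  define \<rho> where "\<rho> = sqrt m"
  have \<rho>: "\<rho> > 0" "\<rho> = m powr (1/2)" using m by (auto simp: \<rho>_def powr_half_sqrt)
  have nx: "norm x powr \<beta> = ((x - 0) \<bullet> (x - 0)) powr (\<beta>/2)" for x :: R4
    by (simp add: norm_eq_sqrt_inner powr_half_sqrt[symmetric] powr_powr)
  let ?g = "\<lambda>s::real. 1 / s powr (\<beta>/2)"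
  have "(\<integral>\<^sup>+x. ennreal (1 / norm x powr \<beta>) * indicator E x \<partial>lborel)
      \<le> (\<integral>\<^sup>+x. ennreal (?g ((x-0) \<bullet> (x-0))) * indicator {0..\<rho>} ((x-0) \<bullet> (x-0)) + ennreal (?g \<rho>) * indicator E x \<partial>lborel)"
  proof (rule nn_integral_mono)
    fix x :: R4
    have "?g (x \<bullet> x) \<le> ?g \<rho>" if "\<not> x \<bullet> x \<le> \<rho>"
      using that \<rho> \<beta> by (intro divide_left_mono powr_mono2 mult_pos_pos) auto
    then show "ennreal (1 / norm x powr \<beta>) * indicator E x
      \<le> ennreal (?g ((x-0) \<bullet> (x-0))) * indicator {0..\<rho>} ((x-0) \<bullet> (x-0)) + ennreal (?g \<rho>) * indicator E x"
      unfolding nx by (auto simp: indicator_def intro: ennreal_leI)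
  qed
  also have "\<dots> = (\<integral>\<^sup>+(x::R4). ennreal (?g ((x-0) \<bullet> (x-0))) * indicator {0..\<rho>} ((x-0) \<bullet> (x-0)) \<partial>lborel) + ennreal (?g \<rho>) * ennreal m"
    by (subst nn_integral_add) (auto simp: nn_integral_cmult E)
  also have "(\<integral>\<^sup>+(x::R4). ennreal (?g ((x-0) \<bullet> (x-0))) * indicator {0..\<rho>} ((x-0) \<bullet> (x-0)) \<partial>lborel)
     = ennreal (pi^2 / (2 - \<beta>/2) * \<rho> powr (2 - \<beta>/2) - pi^2 / (2 - \<beta>/2) * 0 powr (2 - \<beta>/2))"
  proof (rule nn_integral_annulus)
    show "continuous_on {0..\<rho>} (\<lambda>s. pi^2 / (2 - \<beta>/2) * s powr (2 - \<beta>/2))"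
      using \<beta> by (intro continuous_on_mult continuous_on_const continuous_on_powr') (auto intro!: continuous_intros)
    show "0 \<le> ?g s \<and> ((\<lambda>s. pi^2 / (2 - \<beta>/2) * s powr (2 - \<beta>/2)) has_real_derivative pi^2 * s * ?g s) (at s)"
      if "0 < s" for s
    proof -
      have "((\<lambda>s. pi^2 / (2 - \<beta>/2) * s powr (2 - \<beta>/2)) has_real_derivative pi^2 / (2 - \<beta>/2) * ((2 - \<beta>/2) * s powr (2 - \<beta>/2 - 1))) (at s)"
        using that by (intro DERIV_cmult has_real_derivative_powr)
      moreover have "s powr (2 - \<beta>/2 - 1) = s * ?g s"
        using that powr_diff[of s 1 "\<beta>/2"] by simp
      ultimately show ?thesis using \<beta> by simp
    qed
  qed (use \<rho> in auto)
  also have "\<dots> + ennreal (?g \<rho>) * ennreal m = ennreal ((pi^2 / (2 - \<beta>/2) + 1) * m powr (1 - \<beta>/4))"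
  proof -
    have "\<rho> powr (2 - \<beta>/2) = m powr (1 - \<beta>/4)"
      by (simp add: \<rho>(2) powr_powr algebra_simps)
    moreover have "?g \<rho> * m = m powr (1 - \<beta>/4)"
      using m by (simp add: \<rho>(2) powr_powr powr_diff)
    ultimately show ?thesis using \<beta> m
      by (simp add: ennreal_plus[symmetric] ennreal_mult[symmetric] algebra_simps del: ennreal_plus times_divide_eq_left)
  qed
  finally show ?thesis .
qed

section \<open>L^1 and L^2 norms of the potential of a set\<close>

definition potential :: "R4 set \<Rightarrow> R4 \<Rightarrow> ennreal" where
  "potential E x = (\<integral>\<^sup>+y. ennreal (kernel (x - y)) * indicator E y \<partial>lborel)"

lemma measurable_potential [measurable (raw)]:
  assumes [measurable]: "E \<in> sets borel"
  shows "potential E \<in> borel_measurable borel"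
  unfolding potential_def[abs_def] by measurable

lemma nn_integral_potential:
  assumes [measurable]: "E \<in> sets borel"
  shows "(\<integral>\<^sup>+x. potential E x \<partial>lborel) = ennreal (pi^2) * emeasure lborel E"
proof -
  have "(\<integral>\<^sup>+x. potential E x \<partial>lborel) = (\<integral>\<^sup>+y. \<integral>\<^sup>+x. ennreal (kernel (x - y)) * indicator E y \<partial>lborel \<partial>lborel)"
    unfolding potential_def by (rule lborel_pair.Fubini') measurable
  also have "\<dots> = (\<integral>\<^sup>+y. ennreal (pi^2) * indicator E y \<partial>lborel)"
    by (subst nn_integral_multc) (auto simp: nn_integral_kernel)
  finally show ?thesis by (simp add: nn_integral_cmult)
qed

text \<open>The square is a double integral over E x E, and integration in x produces the
  self-convolution of the kernel at z - y. Its logarithmic bound is integrated over z in E uniformly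
  in y, so the remaining integration over y contributes just another factor m.\<close>

lemma nn_integral_potential_square_le:
  assumes [measurable]: "E \<in> sets borel" and E: "emeasure lborel E = ennreal m" and m: "m > 0" and M: "M > 1"
  shows "(\<integral>\<^sup>+x. (potential E x)^2 \<partial>lborel)
    \<le> ennreal (m^2 * (1 / (1 - 1/M)^2 * pi^2 * (1/2 * max 0 (ln (1/m)) + pi^2) + 4 * pi^2 * (M^2 + (M+1)^2)))"
proof -
  define c where "c = 1 / (1 - 1/M)^2 * pi^2"
  define d where "d = 4 * pi^2 * (M^2 + (M+1)^2)"
  define L where "L = 1/2 * max 0 (ln (1/m)) + pi^2"
  have nn: "c \<ge> 0" "d \<ge> 0" "L \<ge> 0" by (auto simp: c_def d_def L_def)
  have sq: "(potential E x)^2 = (\<integral>\<^sup>+y. \<integral>\<^sup>+z. ennreal (kernel (x-y)) * indicator E y * (ennreal (kernel (x-z)) * indicator E z) \<partial>lborel \<partial>lborel)" for x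
    unfolding potential_def power2_eq_square
    by (subst nn_integral_cmult, measurable, subst nn_integral_multc) auto
  have conv: "(\<integral>\<^sup>+x. ennreal (kernel (x-y)) * ennreal (kernel (x-z)) \<partial>lborel)
      \<le> ennreal c * ennreal (max 0 (ln (1 / ((z-y) \<bullet> (z-y))))) + ennreal d" if "z \<noteq> y" for y z
  proof -
    have "(\<integral>\<^sup>+x. ennreal (kernel (x-y)) * ennreal (kernel (x-z)) \<partial>lborel) = (\<integral>\<^sup>+x. ennreal (kernel (x-y) * kernel ((x-y)-(z-y))) \<partial>lborel)"
      by (simp add: ennreal_mult kernel_nonneg)
    also have "\<dots> = (\<integral>\<^sup>+x. ennreal (kernel x * kernel (x-(z-y))) \<partial>lborel)"
      by (rule nn_integral_translate) measurable
    also have "\<dots> \<le> ennreal (c * max 0 (ln (1 / ((z-y) \<bullet> (z-y)))) + d)"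
      unfolding c_def d_def by (rule kernel_convolution_le) (use that M in auto)
    finally show ?thesis using nn by (simp add: ennreal_plus ennreal_mult)
  qed
  have "(\<integral>\<^sup>+x. (potential E x)^2 \<partial>lborel)
     = (\<integral>\<^sup>+y. \<integral>\<^sup>+x. \<integral>\<^sup>+z. ennreal (kernel (x-y)) * indicator E y * (ennreal (kernel (x-z)) * indicator E z) \<partial>lborel \<partial>lborel \<partial>lborel)"
    unfolding sq by (rule lborel_pair.Fubini') measurable
  also have "\<dots> = (\<integral>\<^sup>+y. \<integral>\<^sup>+z. \<integral>\<^sup>+x. ennreal (kernel (x-y)) * indicator E y * (ennreal (kernel (x-z)) * indicator E z) \<partial>lborel \<partial>lborel \<partial>lborel)"
    by (rule nn_integral_cong, rule lborel_pair.Fubini') measurable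
  also have "\<dots> = (\<integral>\<^sup>+y. \<integral>\<^sup>+z. (\<integral>\<^sup>+x. ennreal (kernel (x-y)) * ennreal (kernel (x-z)) \<partial>lborel) * (indicator E y * indicator E z) \<partial>lborel \<partial>lborel)"
    by (subst nn_integral_multc[symmetric]) (auto simp: mult_ac)
  also have "\<dots> \<le> (\<integral>\<^sup>+y. \<integral>\<^sup>+z. (ennreal c * ennreal (max 0 (ln (1 / ((z-y) \<bullet> (z-y))))) + ennreal d) * (indicator E y * indicator E z) \<partial>lborel \<partial>lborel)"
  \<comment> \<open>The convolution estimate excludes z = y, a null set for every y.\<close>
  proof (rule nn_integral_mono, rule nn_integral_mono_AE)
    fix y :: R4
    show "AE z in lborel. (\<integral>\<^sup>+x. ennreal (kernel (x-y)) * ennreal (kernel (x-z)) \<partial>lborel) * (indicator E y * indicator E z)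
        \<le> (ennreal c * ennreal (max 0 (ln (1 / ((z-y) \<bullet> (z-y))))) + ennreal d) * (indicator E y * indicator E z)"
      using AE_lborel_singleton[of y] by eventually_elim (intro mult_right_mono conv, auto)
  qed
  also have "\<dots> = (\<integral>\<^sup>+y. (ennreal c * (\<integral>\<^sup>+z. ennreal (max 0 (ln (1 / ((z-y) \<bullet> (z-y))))) * indicator E z \<partial>lborel) + ennreal d * ennreal m) * indicator E y \<partial>lborel)"
  proof (rule nn_integral_cong)
    fix y :: R4
    have "(\<integral>\<^sup>+z. (ennreal c * ennreal (max 0 (ln (1 / ((z-y) \<bullet> (z-y))))) + ennreal d) * (indicator E y * indicator E z) \<partial>lborel)
      = (\<integral>\<^sup>+z. (ennreal c * (ennreal (max 0 (ln (1 / ((z-y) \<bullet> (z-y))))) * indicator E z) + ennreal d * indicator E z) * indicator E y \<partial>lborel)"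
      by (rule nn_integral_cong) (auto simp: algebra_simps)
    also have "\<dots> = (ennreal c * (\<integral>\<^sup>+z. ennreal (max 0 (ln (1 / ((z-y) \<bullet> (z-y))))) * indicator E z \<partial>lborel) + ennreal d * ennreal m) * indicator E y"
      by (subst nn_integral_multc, measurable, subst nn_integral_add, measurable, subst nn_integral_cmult, measurable) (simp add: nn_integral_cmult E)
    finally show "(\<integral>\<^sup>+z. (ennreal c * ennreal (max 0 (ln (1 / ((z-y) \<bullet> (z-y))))) + ennreal d) * (indicator E y * indicator E z) \<partial>lborel)
      = (ennreal c * (\<integral>\<^sup>+z. ennreal (max 0 (ln (1 / ((z-y) \<bullet> (z-y))))) * indicator E z \<partial>lborel) + ennreal d * ennreal m) * indicator E y" .
  qed
  also have "\<dots> \<le> (\<integral>\<^sup>+y. (ennreal c * ennreal (m * L) + ennreal d * ennreal m) * indicator E y \<partial>lborel)"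
    unfolding L_def using nn_integral_log_le[OF assms(1) E m]
    by (intro nn_integral_mono mult_right_mono add_mono mult_left_mono) auto
  also have "\<dots> = (ennreal c * ennreal (m * L) + ennreal d * ennreal m) * ennreal m"
    by (subst nn_integral_cmult) (auto simp: E)
  also have "\<dots> = ennreal (m^2 * (c * L + d))"
    using nn m by (simp add: ennreal_plus[symmetric] ennreal_mult[symmetric] algebra_simps power2_eq_square del: ennreal_plus)
  finally show ?thesis by (simp add: c_def d_def L_def)
qed

subsection \<open>Level sets of functions with a weak Laplacian\<close>

abbreviation nn_integral_sq :: "(R4 \<Rightarrow> real) \<Rightarrow> ennreal" where
  "nn_integral_sq u \<equiv> (\<integral>\<^sup>+x. ennreal ((u x)^2) \<partial>lborel)"

lemma test_fun_continuous_on: "test_fun f \<Longrightarrow> continuous_on S f"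
  by (simp add: test_fun_def smooth_continuous_on)

lemma test_fun_measurable: "test_fun f \<Longrightarrow> f \<in> borel_measurable borel"
  by (intro borel_measurable_continuous_onI test_fun_continuous_on)

lemma continuous_bounded_support:
  fixes f :: "R4 \<Rightarrow> real"
  assumes f: "continuous_on UNIV f" and R: "\<forall>x. norm x > R \<longrightarrow> f x = 0"
  obtains K where "K \<ge> 0" "\<And>x. \<bar>f x\<bar> \<le> K * indicator (cball 0 R) x"
proof -
  have "compact (f ` cball 0 R)"
    using continuous_on_subset[OF f] by (intro compact_continuous_image) auto
  then have "bounded (f ` cball 0 R)" by (rule compact_imp_bounded)
  then obtain K where "\<forall>y\<in>f ` cball 0 R. norm y \<le> K" unfolding bounded_iff by blast
  then have K: "\<bar>f x\<bar> \<le> K" if "x \<in> cball 0 R" for x using that by simp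
  show thesis
  proof (rule that)
    show "\<bar>f x\<bar> \<le> \<bar>K\<bar> * indicator (cball 0 R) x" for x
      using R[rule_format, of x] K[of x] by (cases "x \<in> cball 0 R") auto
  qed simp
qed

lemma integrable_bounded_support:
  fixes f :: "R4 \<Rightarrow> real"
  assumes "f \<in> borel_measurable borel" "\<And>x. \<bar>f x\<bar> \<le> K * indicator (cball y r) x"
  shows "integrable lborel f"
proof (rule Bochner_Integration.integrable_bound)
  show "integrable lborel (\<lambda>x. K * indicator (cball y r) x)"
    using emeasure_bounded_finite[OF bounded_cball, of y r]
    by (intro integrable_mult_right integrable_real_indicator) auto
  show "AE x in lborel. norm (f x) \<le> norm (K * indicator (cball y r) x)"
    using assms(2) by (intro AE_I2) (metis abs_ge_self order_trans real_norm_def)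
qed (use assms(1) in simp)

lemma test_fun_bounded:
  assumes "test_fun \<phi>"
  obtains K R where "\<And>x. \<bar>\<phi> x\<bar> \<le> K * indicator (cball 0 R) x"
proof -
  obtain R where "\<And>x. \<phi> x \<noteq> 0 \<Longrightarrow> norm x \<le> R"
    using assms by (auto simp: test_fun_def bounded_iff)
  then have "\<forall>x. norm x > R \<longrightarrow> \<phi> x = 0" by force
  from continuous_bounded_support[OF test_fun_continuous_on[OF assms] this] that show thesis by blast
qed

lemma abs_le_square_add_1: "\<bar>v\<bar> \<le> v^2 + 1" for v :: real
  using zero_le_power2[of "\<bar>v\<bar> - 1"] unfolding power2_diff by simp

text \<open>On the support of b the bound |u| \<le> u^2 + 1 does the work of Cauchy-Schwarz.\<close>

lemma integrable_mult_bounded_support: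
  fixes u b :: "R4 \<Rightarrow> real"
  assumes [measurable]: "u \<in> borel_measurable borel" "b \<in> borel_measurable borel"
    and u: "nn_integral_sq u < \<infinity>"
    and b: "\<And>x. \<bar>b x\<bar> \<le> K * indicator (cball y r) x"
  shows "integrable lborel (\<lambda>x. u x * b x)"
proof (rule integrableI_bounded)
  have [measurable]: "cball y r \<in> sets borel" by (rule borel_closed) simp
  have K: "K \<ge> 0 \<or> (\<forall>x. b x = 0)"
    by (metis abs_ge_zero abs_le_zero_iff b indicator_simps mult.right_neutral mult_zero_right order_trans)
  have "ennreal (norm (u x * b x)) \<le> ennreal \<bar>K\<bar> * (ennreal ((u x)^2) + indicator (cball y r) x)" for x
  proof -
    have "\<bar>u x * b x\<bar> \<le> \<bar>K\<bar> * ((u x)^2 + indicator (cball y r) x)"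
    proof (cases "x \<in> cball y r")
      case True
      have "\<bar>u x\<bar> \<le> (u x)^2 + 1" by (rule abs_le_square_add_1)
      then have "\<bar>u x\<bar> * \<bar>b x\<bar> \<le> ((u x)^2 + 1) * \<bar>K\<bar>"
        using b[of x] True by (intro mult_mono) auto
      then show ?thesis using True by (simp add: abs_mult mult.commute)
    next
      case False then show ?thesis using b[of x] by simp
    qed
    then have "ennreal (norm (u x * b x)) \<le> ennreal (\<bar>K\<bar> * ((u x)^2 + indicator (cball y r) x))"
      by (intro ennreal_leI) simp
    then show ?thesis by (simp add: ennreal_mult ennreal_plus ennreal_indicator)
  qed
  then have "(\<integral>\<^sup>+x. ennreal (norm (u x * b x)) \<partial>lborel)
     \<le> (\<integral>\<^sup>+x. ennreal \<bar>K\<bar> * (ennreal ((u x)^2) + indicator (cball y r) x) \<partial>lborel)"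
    by (rule nn_integral_mono)
  also have "\<dots> = ennreal \<bar>K\<bar> * (nn_integral_sq u + emeasure lborel (cball y r))"
    by (subst nn_integral_cmult, measurable, subst nn_integral_add) auto
  also have "\<dots> < \<infinity>"
    using u emeasure_bounded_finite[OF bounded_cball, of y r] by (auto simp: ennreal_mult_less_top)
  finally show "(\<integral>\<^sup>+x. ennreal (norm (u x * b x)) \<partial>lborel) < \<infinity>" .
qed measurable

text \<open>The singular part of minus the Laplacian of the test functions: an approximate identity of
  mass $4\pi^2$.\<close>

definition mollifier :: "real \<Rightarrow> R4 \<Rightarrow> real" where
  "mollifier e v = 8 * e * cutoff (v \<bullet> v) / (v \<bullet> v + e) ^ 3"

lemma measurable_cutoff [measurable]: "cutoff \<in> borel_measurable borel"
proof (rule borel_measurable_continuous_onI, rule continuous_at_imp_continuous_on, rule ballI)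
  fix s show "isCont cutoff s"
    unfolding cutoff_def by (rule DERIV_isCont) (auto intro!: derivative_eq_intros)
qed

lemma measurable_mollifier [measurable]: "mollifier e \<in> borel_measurable borel"
  unfolding mollifier_def[abs_def] by measurable

lemma mollifier_nonneg: "e > 0 \<Longrightarrow> mollifier e v \<ge> 0"
  unfolding mollifier_def using cutoff_bounds(1)[of "v \<bullet> v"] by (intro divide_nonneg_nonneg mult_nonneg_nonneg zero_le_power) auto

lemma mollifier_le:
  assumes "e > 0" "0 \<le> \<delta>" "\<delta> \<le> v \<bullet> v" shows "mollifier e v \<le> 8 * e / (\<delta> + e) ^ 3"
  unfolding mollifier_def
proof (rule frac_le)
  show "8 * e * cutoff (v \<bullet> v) \<le> 8 * e" using assms cutoff_bounds[of "v \<bullet> v"] by simp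
  show "(\<delta> + e) ^ 3 \<le> (v \<bullet> v + e) ^ 3" using assms by (intro power_mono) auto
qed (use assms in auto)

lemma inner_le_1_iff_norm: "(v::R4) \<bullet> v \<le> 1 \<longleftrightarrow> norm v \<le> 1"
  by (simp add: norm_eq_sqrt_inner)

lemma mollifier_eq_0: "norm v > 1 \<Longrightarrow> mollifier e v = 0"
  using inner_le_1_iff_norm[of v] cutoff_eq_0[of "v \<bullet> v"] by (force simp: mollifier_def)

text \<open>The density pi^2 s * 8 e/(s+e)^3 is the derivative of 4 pi^2 s^2/(s+e)^2, so nearly the
  full mass 4 pi^2 is caught once b is large compared with e. The constant \<open>c\<close> stands
  for a bound on the cutoff: 1 from above, its value at the edge from below.\<close>

lemma nn_integral_mollifier_core:
  assumes e: "e > 0" and b: "0 \<le> b" and c: "0 \<le> c"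
  shows "(\<integral>\<^sup>+x. ennreal (8 * e * c / (((x::R4)-y) \<bullet> (x-y) + e) ^ 3) * indicator {0..b} ((x-y) \<bullet> (x-y)) \<partial>lborel)
     = ennreal (4 * pi^2 * c * b^2 / (b+e)^2)"
proof -
  have "(\<integral>\<^sup>+x. ennreal (8 * e * c / (((x::R4)-y) \<bullet> (x-y) + e) ^ 3) * indicator {0..b} ((x-y) \<bullet> (x-y)) \<partial>lborel)
     = ennreal (4 * pi^2 * c * b^2 / (b+e)^2 - 4 * pi^2 * c * 0^2 / (0+e)^2)"
  proof (rule nn_integral_annulus)
    show "continuous_on {0..b} (\<lambda>b. 4 * pi^2 * c * b^2 / (b+e)^2)"
      using e by (intro continuous_intros) (auto simp: add_nonneg_eq_0_iff)
    show "0 \<le> 8 * e * c / (s + e) ^ 3 \<and>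
      ((\<lambda>b. 4 * pi^2 * c * b^2 / (b+e)^2) has_real_derivative pi^2 * s * (8 * e * c / (s + e) ^ 3)) (at s)" if "0 < s" for s
    proof
      have ne: "s + e \<noteq> 0" using that e by simp
      have "((\<lambda>b. 4 * pi^2 * c * b^2 / (b+e)^2) has_real_derivative
          (4 * pi^2 * c * (2 * s) * (s+e)^2 - 4 * pi^2 * c * s^2 * (2 * (s+e))) / ((s+e)^2 * (s+e)^2)) (at s)"
        using ne by (auto intro!: derivative_eq_intros)
      moreover have "(4 * pi^2 * c * (2 * s) * (s+e)^2 - 4 * pi^2 * c * s^2 * (2 * (s+e))) / ((s+e)^2 * (s+e)^2)
         = pi^2 * s * (8 * e * c / (s + e) ^ 3)"
      proof -
        have "4 * pi^2 * c * (2 * s) * (s+e)^2 - 4 * pi^2 * c * s^2 * (2 * (s+e)) = pi^2 * s * (8 * e * c) * (s+e)"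
          by (simp add: power2_eq_square algebra_simps)
        then show ?thesis using ne by (simp add: power2_eq_square power3_eq_cube) (simp add: mult_ac)
      qed
      ultimately show "((\<lambda>b. 4 * pi^2 * c * b^2 / (b+e)^2) has_real_derivative pi^2 * s * (8 * e * c / (s + e) ^ 3)) (at s)"
        by simp
    qed (use that e c in simp)
  qed (use b in auto)
  then show ?thesis by simp
qed

lemma nn_integral_mollifier_le:
  assumes e: "e > 0"
  shows "(\<integral>\<^sup>+x. ennreal (mollifier e (x - y)) \<partial>lborel) \<le> ennreal (4 * pi^2)"
proof -
  have "(\<integral>\<^sup>+x. ennreal (mollifier e (x - y)) \<partial>lborel)
    \<le> (\<integral>\<^sup>+x. ennreal (8 * e * 1 / ((x-y) \<bullet> (x-y) + e) ^ 3) * indicator {0..1} ((x-y) \<bullet> (x-y)) \<partial>lborel)"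
  proof (rule nn_integral_mono)
    fix x
    show "ennreal (mollifier e (x - y)) \<le> ennreal (8 * e * 1 / ((x-y) \<bullet> (x-y) + e) ^ 3) * indicator {0..1} ((x-y) \<bullet> (x-y))"
      using mollifier_le[OF e, of "(x-y) \<bullet> (x-y)" "x-y"] mollifier_eq_0[of "x-y" e] inner_le_1_iff_norm[of "x-y"]
      by (cases "norm (x-y) \<le> 1") (auto intro: ennreal_leI)
  qed
  also have "\<dots> = ennreal (4 * pi^2 * 1 * 1^2 / (1+e)^2)"
    by (rule nn_integral_mollifier_core) (use e in auto)
  also have "\<dots> \<le> ennreal (4 * pi^2)"
    using e by (intro ennreal_leI) (simp add: divide_le_eq mult_le_cancel_left1 one_le_power)
  finally show ?thesis .
qed

text \<open>The two scales are coupled: for e = r^2 the ball |x-y|^2 \<le> r is large on the scale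
  of the mollifier, which gives the factor 1/(1+r)^2, and yet it shrinks to a point, so that the
  cutoff is at least \<open>cutoff r\<close> on it. Both factors tend to 1 as r tends to 0.\<close>

lemma nn_integral_mollifier_ge:
  assumes r: "0 < r" "r < 1"
  shows "ennreal (4 * pi^2 * cutoff r / (1+r)^2) \<le> (\<integral>\<^sup>+x. ennreal (mollifier (r^2) (x - y)) \<partial>lborel)"
proof -
  have "4 * pi^2 * cutoff r / (1+r)^2 = 4 * pi^2 * cutoff r * r^2 / (r+r^2)^2"
  proof -
    have "(r + r^2)^2 = r^2 * (1+r)^2" by (simp add: power2_eq_square algebra_simps)
    then show ?thesis using r by simp
  qed
  also have "ennreal \<dots> = (\<integral>\<^sup>+x. ennreal (8 * r^2 * cutoff r / ((x-y) \<bullet> (x-y) + r^2) ^ 3) * indicator {0..r} ((x-y) \<bullet> (x-y)) \<partial>lborel)"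
    by (rule nn_integral_mollifier_core[symmetric]) (use r cutoff_bounds in auto)
  also have "\<dots> \<le> (\<integral>\<^sup>+x. ennreal (mollifier (r^2) (x - y)) \<partial>lborel)"
  proof (rule nn_integral_mono)
    fix x
    have "8 * r^2 * cutoff r / ((x-y) \<bullet> (x-y) + r^2) ^ 3 \<le> mollifier (r^2) (x - y)" if "(x-y) \<bullet> (x-y) \<le> r"
      unfolding mollifier_def using that r cutoff_mono[of "(x-y) \<bullet> (x-y)" r]
      by (intro divide_right_mono mult_left_mono zero_le_power) auto
    then show "ennreal (8 * r^2 * cutoff r / ((x-y) \<bullet> (x-y) + r^2) ^ 3) * indicator {0..r} ((x-y) \<bullet> (x-y))
      \<le> ennreal (mollifier (r^2) (x - y))"
      by (auto simp: indicator_def intro: ennreal_leI)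
  qed
  finally show ?thesis .
qed

lemma green_test_le_kernel:
  assumes "e > 0" "x \<noteq> y" shows "green_test e y x \<le> kernel (x - y)"
proof (cases "(x-y) \<bullet> (x-y) \<le> 1")
  case True
  have "cutoff ((x-y) \<bullet> (x-y)) / ((x-y) \<bullet> (x-y) + e) \<le> 1 / ((x-y) \<bullet> (x-y))"
    by (rule frac_le) (use assms cutoff_bounds in auto)
  then show ?thesis using True by (simp add: green_test_def kernel_def)
next
  case False
  then show ?thesis using cutoff_eq_0[of "(x-y) \<bullet> (x-y)"] by (simp add: green_test_def kernel_def)
qed

text \<open>Both derivatives sit on the test function, the form in which the level set argument uses
  the Laplacian. The measure is \<open>lborel\<close> because functions are replaced by Borel
  representatives, as the exchanges of integrals require.\<close>

definition weak_laplacian :: "(R4 \<Rightarrow> real) \<Rightarrow> (R4 \<Rightarrow> real) \<Rightarrow> bool" where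
  "weak_laplacian u w \<longleftrightarrow> (\<forall>\<psi>. test_fun \<psi> \<longrightarrow>
     (\<integral>x. u x * (\<Sum>i\<in>UNIV. cpartial i (cpartial i \<psi>) x) \<partial>lborel) = (\<integral>x. w x * \<psi> x \<partial>lborel))"

text \<open>Testing with \<open>green_test e y\<close> says that the integral of u B equals that of
  u r minus that of w \<psi>, where B is the mollifier centred at y. On E the function u is at least
  s; the last summand pays for the mass of B outside E. The other two bounds are free of
  \<open>e\<close>: \<open>r\<close> is uniformly bounded and \<psi> lies below the kernel.\<close>

lemma level_set_pointwise:
  fixes u w :: "R4 \<Rightarrow> real"
  assumes [measurable]: "u \<in> borel_measurable borel" "w \<in> borel_measurable borel" "E \<in> sets borel"
    and U: "nn_integral_sq u \<le> ennreal U" "U \<ge> 0"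
    and W: "nn_integral_sq w < \<infinity>"
    and uw: "weak_laplacian u w"
    and s: "s \<ge> 0" "\<And>x. x \<in> E \<Longrightarrow> u x \<ge> s" and e: "e > 0"
  shows "ennreal s * (\<integral>\<^sup>+x. ennreal (mollifier e (x - y)) \<partial>lborel)
    \<le> ennreal (624 * exp 1 * (pi^2 / 2 + U)) + (\<integral>\<^sup>+x. ennreal \<bar>w x\<bar> * ennreal (kernel (x - y)) \<partial>lborel)
      + (\<integral>\<^sup>+x. indicator (- E) x * ennreal (s + \<bar>u x\<bar>) * ennreal (mollifier e (x - y)) \<partial>lborel)"
proof -
  have U': "nn_integral_sq u < \<infinity>" using order_le_less_trans[OF U(1)] by simp
  obtain r where r: "\<And>x. (\<Sum>i\<in>UNIV. cpartial i (cpartial i (green_test e y)) x)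
      = r x - 8 * e * cutoff ((x-y)\<bullet>(x-y)) / ((x-y)\<bullet>(x-y) + e)^3"
    "\<And>x. \<bar>r x\<bar> \<le> 624 * exp 1" "\<And>x. (x-y)\<bullet>(x-y) \<ge> 1 \<Longrightarrow> r x = 0"
    by (rule laplacian_green_test[OF e, of y]) (rule that)
  have [measurable]: "cball y 1 \<in> sets borel" by (rule borel_closed) simp
  define B where "B = (\<lambda>x. mollifier e (x - y))"
  define \<psi> where "\<psi> = green_test e y"
  have lap: "(\<Sum>i\<in>UNIV. cpartial i (cpartial i \<psi>) x) = r x - B x" for x
    by (simp add: r(1) B_def mollifier_def \<psi>_def)
  have t: "test_fun \<psi>" unfolding \<psi>_def by (rule test_fun_green_test[OF e])
  have [measurable]: "\<psi> \<in> borel_measurable borel" "\<And>i. cpartial i (cpartial i \<psi>) \<in> borel_measurable borel"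
    by (intro test_fun_measurable test_fun_cpartial t)+
  have [measurable]: "B \<in> borel_measurable borel" unfolding B_def by measurable
  have "r = (\<lambda>x. (\<Sum>i\<in>UNIV. cpartial i (cpartial i \<psi>) x) + B x)" using lap by auto
  then have [measurable]: "r \<in> borel_measurable borel" by simp
  have out: "1 \<le> (x-y)\<bullet>(x-y)" if "x \<notin> cball y 1" for x
    using that inner_le_1_iff_norm[of "x-y"] by (simp add: dist_norm norm_minus_commute)
  have Bb: "\<bar>B x\<bar> \<le> 8 * e / e^3 * indicator (cball y 1) x" for x
  proof (cases "x \<in> cball y 1")
    case True then show ?thesis using mollifier_le[OF e, of 0 "x-y"] mollifier_nonneg[OF e, of "x-y"] by (simp add: B_def)
  next
    case False then show ?thesis using mollifier_eq_0[of "x-y" e] by (simp add: B_def dist_norm norm_minus_commute)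
  qed
  have B0: "B x \<ge> 0" for x unfolding B_def by (rule mollifier_nonneg[OF e])
  have rb: "\<bar>r x\<bar> \<le> 624 * exp 1 * indicator (cball y 1) x" for x
    using r(2,3)[of x] out[of x] by (cases "x \<in> cball y 1") auto
  have \<psi>0: "\<psi> x \<ge> 0" for x using cutoff_bounds(1) e by (simp add: \<psi>_def green_test_def)
  have \<psi>b: "\<bar>\<psi> x\<bar> \<le> 1/e * indicator (cball y 1) x" for x
  proof (cases "x \<in> cball y 1")
    case True
    have "\<psi> x \<le> 1 / e" unfolding \<psi>_def green_test_def by (rule frac_le) (use e cutoff_bounds in auto)
    then show ?thesis using True \<psi>0[of x] by simp
  next
    case False then show ?thesis using out[OF False] cutoff_eq_0 by (simp add: \<psi>_def green_test_def)
  qed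
  have iuB: "integrable lborel (\<lambda>x. u x * B x)"
    by (rule integrable_mult_bounded_support[OF _ _ U' Bb]) measurable
  have iur: "integrable lborel (\<lambda>x. u x * r x)"
    by (rule integrable_mult_bounded_support[OF _ _ U' rb]) measurable
  have iw: "integrable lborel (\<lambda>x. w x * \<psi> x)"
    by (rule integrable_mult_bounded_support[OF _ _ W \<psi>b]) measurable
  have iB: "integrable lborel B"
    by (rule integrable_bounded_support[OF _ Bb]) measurable
  have i3: "integrable lborel (\<lambda>x. indicator (- E) x * (s + \<bar>u x\<bar>) * B x)"
  proof -
    have "integrable lborel (\<lambda>x. (s * B x + \<bar>u x * B x\<bar>) * indicator (- E) x)"
      by (intro integrable_mult_indicator[of "- E", unfolded real_scaleR_def, folded mult.commute] integrable_real_mult_indicator)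
         (use iB iuB in auto)
    also have "(\<lambda>x. (s * B x + \<bar>u x * B x\<bar>) * indicator (- E) x) = (\<lambda>x. indicator (- E) x * (s + \<bar>u x\<bar>) * B x)"
      using B0 by (auto simp: abs_mult algebra_simps)
    finally show ?thesis .
  qed
  have "(\<integral>x. u x * (r x - B x) \<partial>lborel) = (\<integral>x. w x * \<psi> x \<partial>lborel)"
    using uw[unfolded weak_laplacian_def, rule_format, OF t] unfolding lap .
  then have eq: "(\<integral>x. u x * B x \<partial>lborel) = (\<integral>x. u x * r x \<partial>lborel) - (\<integral>x. w x * \<psi> x \<partial>lborel)"
    using iur iuB by (simp add: right_diff_distrib)
  have "s * (\<integral>x. B x \<partial>lborel) = (\<integral>x. s * B x \<partial>lborel)" by simp
  also have "\<dots> \<le> (\<integral>x. u x * B x + indicator (- E) x * (s + \<bar>u x\<bar>) * B x \<partial>lborel)"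
  proof (rule integral_mono)
    fix x
    \<comment> \<open>Outside E nothing is known about u, and s - u is at most s + |u|.\<close>
    have "s \<le> u x + indicator (- E) x * (s + \<bar>u x\<bar>)" using s(2)[of x] by (cases "x \<in> E") auto
    from mult_right_mono[OF this B0[of x]]
    show "s * B x \<le> u x * B x + indicator (- E) x * (s + \<bar>u x\<bar>) * B x" by (simp add: algebra_simps)
  qed (use iB iuB i3 in auto)
  also have "\<dots> = (\<integral>x. u x * r x \<partial>lborel) - (\<integral>x. w x * \<psi> x \<partial>lborel) + (\<integral>x. indicator (- E) x * (s + \<bar>u x\<bar>) * B x \<partial>lborel)"
    using iuB i3 eq by simp
  also have "(\<integral>x. u x * r x \<partial>lborel) - (\<integral>x. w x * \<psi> x \<partial>lborel) \<le> 
      (\<integral>x. \<bar>u x * r x\<bar> \<partial>lborel) + (\<integral>x. \<bar>w x * \<psi> x\<bar> \<partial>lborel)"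
    using integral_abs_bound[of lborel "\<lambda>x. u x * r x"] integral_abs_bound[of lborel "\<lambda>x. w x * \<psi> x"] by linarith
  finally have main: "s * (\<integral>x. B x \<partial>lborel) \<le> (\<integral>x. \<bar>u x * r x\<bar> \<partial>lborel) + (\<integral>x. \<bar>w x * \<psi> x\<bar> \<partial>lborel)
     + (\<integral>x. indicator (- E) x * (s + \<bar>u x\<bar>) * B x \<partial>lborel)" by simp
  have n0: "ennreal s * (\<integral>\<^sup>+x. ennreal (B x) \<partial>lborel) = ennreal (s * (\<integral>x. B x \<partial>lborel))"
    using s iB B0 by (simp add: nn_integral_eq_integral ennreal_mult)
  \<comment> \<open>The constant comes from |u| \<le> 1 + u^2 on the unit ball around y, whose
    volume is pi^2/2.\<close>
  have n1: "ennreal (\<integral>x. \<bar>u x * r x\<bar> \<partial>lborel) \<le> ennreal (624 * exp 1 * (pi^2 / 2 + U))"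
  proof -
    have "ennreal (\<integral>x. \<bar>u x * r x\<bar> \<partial>lborel) = (\<integral>\<^sup>+x. ennreal \<bar>u x * r x\<bar> \<partial>lborel)"
      by (rule nn_integral_eq_integral[symmetric]) (use iur in auto)
    also have "\<dots> \<le> (\<integral>\<^sup>+x. ennreal (624 * exp 1) * (indicator (cball y 1) x + ennreal ((u x)^2)) \<partial>lborel)"
    proof (rule nn_integral_mono)
      fix x
      have "\<bar>u x * r x\<bar> \<le> 624 * exp 1 * (indicator (cball y 1) x + (u x)^2)"
      proof (cases "x \<in> cball y 1")
        case True
        have "\<bar>u x\<bar> \<le> 1 + (u x)^2" using abs_le_square_add_1[of "u x"] by simp
        then have "\<bar>u x\<bar> * \<bar>r x\<bar> \<le> (1 + (u x)^2) * (624 * exp 1)"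
          using r(2)[of x] by (intro mult_mono) auto
        then show ?thesis using True by (simp add: abs_mult mult.commute)
      next
        case False then show ?thesis using rb[of x] by simp
      qed
      then have "ennreal \<bar>u x * r x\<bar> \<le> ennreal (624 * exp 1 * (indicator (cball y 1) x + (u x)^2))"
        by (rule ennreal_leI)
      then show "ennreal \<bar>u x * r x\<bar> \<le> ennreal (624 * exp 1) * (indicator (cball y 1) x + ennreal ((u x)^2))"
        by (simp add: ennreal_mult ennreal_plus ennreal_indicator)
    qed
    also have "\<dots> = ennreal (624 * exp 1) * (emeasure lborel (cball y 1) + nn_integral_sq u)"
      by (subst nn_integral_cmult, measurable, subst nn_integral_add) auto
    also have "\<dots> \<le> ennreal (624 * exp 1) * (ennreal (pi^2 / 2) + ennreal U)"
      using U by (intro mult_left_mono add_mono) (auto simp: emeasure_cball unit_ball_vol_4)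
    also have "\<dots> = ennreal (624 * exp 1 * (pi^2 / 2 + U))"
      using U by (simp add: ennreal_mult ennreal_plus)
    finally show ?thesis .
  qed
  have n2: "ennreal (\<integral>x. \<bar>w x * \<psi> x\<bar> \<partial>lborel) \<le> (\<integral>\<^sup>+x. ennreal \<bar>w x\<bar> * ennreal (kernel (x - y)) \<partial>lborel)"
  proof -
    have "ennreal (\<integral>x. \<bar>w x * \<psi> x\<bar> \<partial>lborel) = (\<integral>\<^sup>+x. ennreal \<bar>w x * \<psi> x\<bar> \<partial>lborel)"
      by (rule nn_integral_eq_integral[symmetric]) (use iw in auto)
    also have "\<dots> \<le> (\<integral>\<^sup>+x. ennreal \<bar>w x\<bar> * ennreal (kernel (x - y)) \<partial>lborel)"
    proof (rule nn_integral_mono_AE)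
      show "AE x in lborel. ennreal \<bar>w x * \<psi> x\<bar> \<le> ennreal \<bar>w x\<bar> * ennreal (kernel (x - y))"
        using AE_lborel_singleton[of y]
      proof eventually_elim
        case (elim x)
        have "ennreal \<bar>w x * \<psi> x\<bar> = ennreal \<bar>w x\<bar> * ennreal (\<psi> x)"
          using \<psi>0[of x] by (simp add: abs_mult ennreal_mult)
        also have "\<dots> \<le> ennreal \<bar>w x\<bar> * ennreal (kernel (x - y))"
          using green_test_le_kernel[OF e, of x y] elim by (intro mult_left_mono ennreal_leI) (auto simp: \<psi>_def)
        finally show ?case .
      qed
    qed
    finally show ?thesis .
  qed
  have n3: "ennreal (\<integral>x. indicator (- E) x * (s + \<bar>u x\<bar>) * B x \<partial>lborel)
     = (\<integral>\<^sup>+x. indicator (- E) x * ennreal (s + \<bar>u x\<bar>) * ennreal (B x) \<partial>lborel)"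
  proof -
    have "ennreal (\<integral>x. indicator (- E) x * (s + \<bar>u x\<bar>) * B x \<partial>lborel)
      = (\<integral>\<^sup>+x. ennreal (indicator (- E) x * (s + \<bar>u x\<bar>) * B x) \<partial>lborel)"
      by (rule nn_integral_eq_integral[symmetric]) (use i3 s B0 in auto)
    also have "\<dots> = (\<integral>\<^sup>+x. indicator (- E) x * ennreal (s + \<bar>u x\<bar>) * ennreal (B x) \<partial>lborel)"
      using s B0 by (intro nn_integral_cong) (auto simp: ennreal_mult indicator_def)
    finally show ?thesis .
  qed
  have "ennreal (s * (\<integral>x. B x \<partial>lborel)) \<le> ennreal (\<integral>x. \<bar>u x * r x\<bar> \<partial>lborel) + ennreal (\<integral>x. \<bar>w x * \<psi> x\<bar> \<partial>lborel)
     + ennreal (\<integral>x. indicator (- E) x * (s + \<bar>u x\<bar>) * B x \<partial>lborel)"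
    using ennreal_leI[OF main] s B0 by (simp add: ennreal_plus integral_nonneg)
  also have "\<dots> \<le> ennreal (624 * exp 1 * (pi^2 / 2 + U)) + (\<integral>\<^sup>+x. ennreal \<bar>w x\<bar> * ennreal (kernel (x - y)) \<partial>lborel)
      + (\<integral>\<^sup>+x. indicator (- E) x * ennreal (s + \<bar>u x\<bar>) * ennreal (B x) \<partial>lborel)"
    unfolding n3 by (intro add_mono n1 n2 order_refl)
  finally show ?thesis unfolding n0[symmetric] by (simp add: B_def)
qed

text \<open>Integration over y in E turns the kernel term into the potential of E and the spilled
  mass into the mollified indicator of E; all integrands are nonnegative, so the order of
  integration can be exchanged.\<close>

lemma level_set_integrated:
  fixes u w :: "R4 \<Rightarrow> real"
  assumes [measurable]: "u \<in> borel_measurable borel" "w \<in> borel_measurable borel" "E \<in> sets borel"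
    and U: "nn_integral_sq u \<le> ennreal U" "U \<ge> 0"
    and W: "nn_integral_sq w < \<infinity>"
    and uw: "weak_laplacian u w"
    and s: "s \<ge> 0" "\<And>x. x \<in> E \<Longrightarrow> u x \<ge> s" and r: "0 < r" "r < 1"
  shows "ennreal s * ennreal (4 * pi^2 * cutoff r / (1+r)^2) * emeasure lborel E
    \<le> ennreal (624 * exp 1 * (pi^2 / 2 + U)) * emeasure lborel E + (\<integral>\<^sup>+x. ennreal \<bar>w x\<bar> * potential E x \<partial>lborel)
      + (\<integral>\<^sup>+x. indicator (- E) x * ennreal (s + \<bar>u x\<bar>) * (\<integral>\<^sup>+y. ennreal (mollifier (r^2) (x - y)) * indicator E y \<partial>lborel) \<partial>lborel)"
    (is "?L \<le> ?A + ?B + ?C")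
proof -
  let ?c = "ennreal (624 * exp 1 * (pi^2 / 2 + U))"
  let ?b = "\<lambda>x y. ennreal \<bar>w x\<bar> * ennreal (kernel (x - y))"
  let ?d = "\<lambda>x y. indicator (- E) x * ennreal (s + \<bar>u x\<bar>) * ennreal (mollifier (r^2) (x - y))"
  have "?L = (\<integral>\<^sup>+y. ennreal s * ennreal (4 * pi^2 * cutoff r / (1+r)^2) * indicator E y \<partial>lborel)"
    by (simp add: nn_integral_cmult)
  also have "\<dots> \<le> (\<integral>\<^sup>+y. (?c + (\<integral>\<^sup>+x. ?b x y \<partial>lborel) + (\<integral>\<^sup>+x. ?d x y \<partial>lborel)) * indicator E y \<partial>lborel)"
  proof (intro nn_integral_mono mult_right_mono)
    fix y
    have "ennreal s * ennreal (4 * pi^2 * cutoff r / (1+r)^2) \<le> ennreal s * (\<integral>\<^sup>+x. ennreal (mollifier (r^2) (x - y)) \<partial>lborel)"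
      by (intro mult_left_mono nn_integral_mollifier_ge r) simp
    also have "\<dots> \<le> ?c + (\<integral>\<^sup>+x. ?b x y \<partial>lborel) + (\<integral>\<^sup>+x. ?d x y \<partial>lborel)"
      by (rule level_set_pointwise[OF assms(1-3) U W uw s]) (use r in auto)
    finally show "ennreal s * ennreal (4 * pi^2 * cutoff r / (1+r)^2) \<le> ?c + (\<integral>\<^sup>+x. ?b x y \<partial>lborel) + (\<integral>\<^sup>+x. ?d x y \<partial>lborel)" .
  qed simp
  also have "\<dots> = (\<integral>\<^sup>+y. ?c * indicator E y + (\<integral>\<^sup>+x. ?b x y * indicator E y \<partial>lborel) + (\<integral>\<^sup>+x. ?d x y * indicator E y \<partial>lborel) \<partial>lborel)"
    by (intro nn_integral_cong, subst nn_integral_multc, measurable, subst nn_integral_multc, measurable) (simp add: distrib_right)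
  also have "\<dots> = ?A + (\<integral>\<^sup>+y. \<integral>\<^sup>+x. ?b x y * indicator E y \<partial>lborel \<partial>lborel) + (\<integral>\<^sup>+y. \<integral>\<^sup>+x. ?d x y * indicator E y \<partial>lborel \<partial>lborel)"
  proof -
    have [measurable]: "(\<lambda>y. \<integral>\<^sup>+x. ?b x y * indicator E y \<partial>lborel) \<in> borel_measurable lborel"
      by measurable
    have [measurable]: "(\<lambda>y. \<integral>\<^sup>+x. ?d x y * indicator E y \<partial>lborel) \<in> borel_measurable lborel"
      by measurable
    have "(\<integral>\<^sup>+y. ?c * indicator E y \<partial>lborel) = ?A" by (simp add: nn_integral_cmult)
    moreover have "(\<integral>\<^sup>+y. f y + g y + h y \<partial>lborel) = (\<integral>\<^sup>+y. f y \<partial>lborel) + (\<integral>\<^sup>+y. g y \<partial>lborel) + (\<integral>\<^sup>+y. h y \<partial>lborel)"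
      if [measurable]: "f \<in> borel_measurable lborel" "g \<in> borel_measurable lborel" "h \<in> borel_measurable lborel"
      for f g h :: "R4 \<Rightarrow> ennreal"
      by (simp add: nn_integral_add)
    ultimately show ?thesis by simp
  qed
  also have "(\<integral>\<^sup>+y. \<integral>\<^sup>+x. ?b x y * indicator E y \<partial>lborel \<partial>lborel) = (\<integral>\<^sup>+x. \<integral>\<^sup>+y. ?b x y * indicator E y \<partial>lborel \<partial>lborel)"
    by (rule lborel_pair.Fubini') measurable
  also have "\<dots> = ?B"
    unfolding potential_def by (intro nn_integral_cong, subst nn_integral_cmult[symmetric]) (auto simp: mult.assoc)
  also have "(\<integral>\<^sup>+y. \<integral>\<^sup>+x. ?d x y * indicator E y \<partial>lborel \<partial>lborel) = (\<integral>\<^sup>+x. \<integral>\<^sup>+y. ?d x y * indicator E y \<partial>lborel \<partial>lborel)"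
    by (rule lborel_pair.Fubini') measurable
  also have "\<dots> = ?C"
    by (intro nn_integral_cong, subst nn_integral_cmult[symmetric]) (auto simp: mult.assoc)
  finally show ?thesis .
qed

text \<open>The mollifier is made to concentrate. The mollified indicators of E are bounded by 4
  pi^2, live in one fixed ball and tend to 0 at every point outside E, because E is closed.
  Dominated convergence with |u| \<le> u^2 + 1 removes the error, while the mass on the left tends
  to 4 pi^2.\<close>

lemma level_set_potential_bound:
  fixes u w :: "R4 \<Rightarrow> real"
  assumes [measurable]: "u \<in> borel_measurable borel" "w \<in> borel_measurable borel"
    and U: "nn_integral_sq u \<le> ennreal U" "U \<ge> 0"
    and W: "nn_integral_sq w < \<infinity>"
    and uw: "weak_laplacian u w"
    and s: "s \<ge> 0" "\<And>x. x \<in> E \<Longrightarrow> u x \<ge> s" and E: "compact E"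
  shows "ennreal (4 * pi^2 * s) * emeasure lborel E
    \<le> ennreal (624 * exp 1 * (pi^2 / 2 + U)) * emeasure lborel E + (\<integral>\<^sup>+x. ennreal \<bar>w x\<bar> * potential E x \<partial>lborel)"
    (is "_ \<le> ?A")
proof -
  have [measurable]: "E \<in> sets borel" using E by (simp add: borel_compact)
  \<comment> \<open>The shift by 2 keeps every term in the open unit interval, where the lower bound
    for the mass holds.\<close>
  define \<rho> where "\<rho> = (\<lambda>n::nat. 1 / (real n + 2))"
  have \<rho>: "0 < \<rho> n" "\<rho> n < 1" for n by (auto simp: \<rho>_def)
  have \<rho>0: "\<rho> \<longlonglongrightarrow> 0"
  proof -
    have "(\<lambda>n. 1 / real (n + 2)) \<longlonglongrightarrow> 0" by (rule LIMSEQ_ignore_initial_segment) (rule lim_const_over_n)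
    then show ?thesis by (simp add: \<rho>_def[abs_def] add.commute)
  qed
  obtain R where R: "R > 0" "\<And>x. x \<in> E \<Longrightarrow> norm x \<le> R"
    using compact_imp_bounded[OF E] bounded_pos by blast
  obtain m where m: "emeasure lborel E = ennreal m" "m \<ge> 0"
    using emeasure_compact_finite[OF E] by (cases "emeasure lborel E") auto
  define J where "J = (\<lambda>n x. \<integral>\<^sup>+y. ennreal (mollifier ((\<rho> n)^2) (x - y)) * indicator E y \<partial>lborel)"
  have [measurable]: "J n \<in> borel_measurable borel" for n unfolding J_def by measurable
  have J1: "J n x \<le> ennreal (4 * pi^2)" for n x
  proof -
    have "J n x \<le> (\<integral>\<^sup>+y. ennreal (mollifier ((\<rho> n)^2) (y - x)) \<partial>lborel)"
      unfolding J_def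
    proof (rule nn_integral_mono)
      fix y
      have "mollifier ((\<rho> n)^2) (x - y) = mollifier ((\<rho> n)^2) (y - x)"
        unfolding mollifier_def dot_square_norm norm_minus_commute[of x y] ..
      then show "ennreal (mollifier ((\<rho> n)^2) (x - y)) * indicator E y \<le> ennreal (mollifier ((\<rho> n)^2) (y - x))"
        by (simp add: indicator_def)
    qed
    also have "\<dots> \<le> ennreal (4 * pi^2)" by (rule nn_integral_mollifier_le) (use \<rho>[of n] in simp)
    finally show ?thesis .
  qed
  have J2: "J n x = 0" if "x \<notin> cball 0 (R + 1)" for n x
  proof -
    have z: "(\<lambda>y. ennreal (mollifier ((\<rho> n)^2) (x - y)) * indicator E y) = (\<lambda>y. 0)"
    proof
      fix y
      show "ennreal (mollifier ((\<rho> n)^2) (x - y)) * indicator E y = 0"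
      proof (cases "y \<in> E")
        case True
        then have "norm (x - y) > 1" using R(2)[of y] norm_triangle_ineq2[of x y] that by simp
        then show ?thesis by (simp add: mollifier_eq_0)
      qed simp
    qed
    show ?thesis unfolding J_def z by simp
  qed
  have J3: "(\<lambda>n. J n x) \<longlonglongrightarrow> 0" if "x \<notin> E" for x
  proof -
    \<comment> \<open>At distance \<delta> from E the mollifier is at most 8 \<rho>^2/\<delta>^6 on
      all of E, and E has finite measure.\<close>
    obtain \<delta> where \<delta>: "\<delta> > 0" "\<And>y. y \<in> E \<Longrightarrow> \<delta> \<le> dist x y"
      using separate_point_closed[OF compact_imp_closed[OF E] \<open>x \<notin> E\<close>] by blast
    have le: "J n x \<le> ennreal (8 * (\<rho> n)^2 / (\<delta>^2) ^ 3 * m)" for n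
    proof -
      have "J n x \<le> (\<integral>\<^sup>+y. ennreal (8 * (\<rho> n)^2 / (\<delta>^2) ^ 3) * indicator E y \<partial>lborel)"
        unfolding J_def
      proof (rule nn_integral_mono)
        fix y
        have "mollifier ((\<rho> n)^2) (x - y) \<le> 8 * (\<rho> n)^2 / (\<delta>^2) ^ 3" if "y \<in> E"
        proof -
          have "\<delta>^2 \<le> (x - y) \<bullet> (x - y)"
            unfolding dot_square_norm using \<delta>(1) \<delta>(2)[OF that] by (intro power_mono) (auto simp: dist_norm)
          then have "mollifier ((\<rho> n)^2) (x - y) \<le> 8 * (\<rho> n)^2 / (\<delta>^2 + (\<rho> n)^2) ^ 3"
            using \<rho>[of n] by (intro mollifier_le) auto
          also have "\<dots> \<le> 8 * (\<rho> n)^2 / (\<delta>^2) ^ 3"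
            using \<delta>(1) by (intro frac_le power_mono) auto
          finally show ?thesis .
        qed
        then show "ennreal (mollifier ((\<rho> n)^2) (x - y)) * indicator E y \<le> ennreal (8 * (\<rho> n)^2 / (\<delta>^2) ^ 3) * indicator E y"
          by (auto simp: indicator_def intro: ennreal_leI)
      qed
      also have "\<dots> = ennreal (8 * (\<rho> n)^2 / (\<delta>^2) ^ 3) * ennreal m"
        by (simp add: nn_integral_cmult m)
      also have "\<dots> = ennreal (8 * (\<rho> n)^2 / (\<delta>^2) ^ 3 * m)"
        by (rule ennreal_mult[symmetric]) (use m in auto)
      finally show ?thesis .
    qed
    have "(\<lambda>n. 8 * (\<rho> n)^2 / (\<delta>^2) ^ 3 * m) \<longlonglongrightarrow> 8 * 0^2 / (\<delta>^2) ^ 3 * m"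
      by (intro tendsto_intros \<rho>0) (use \<delta>(1) in auto)
    then have "(\<lambda>n. ennreal (8 * (\<rho> n)^2 / (\<delta>^2) ^ 3 * m)) \<longlonglongrightarrow> ennreal 0"
      by (intro tendsto_ennrealI) simp
    then have lim: "(\<lambda>n. ennreal (8 * (\<rho> n)^2 / (\<delta>^2) ^ 3 * m)) \<longlonglongrightarrow> 0"
      unfolding ennreal_0 .
    show ?thesis
    proof (rule tendsto_sandwich[OF _ _ tendsto_const lim])
      show "\<forall>\<^sub>F n in sequentially. 0 \<le> J n x"
        by (rule always_eventually, rule allI, rule zero_le)
      show "\<forall>\<^sub>F n in sequentially. J n x \<le> ennreal (8 * (\<rho> n)^2 / (\<delta>^2) ^ 3 * m)"
        by (rule always_eventually, rule allI, rule le)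
    qed
  qed
  define T where "T = (\<lambda>n. \<integral>\<^sup>+x. indicator (- E) x * ennreal (s + \<bar>u x\<bar>) * J n x \<partial>lborel)"
  have T: "T \<longlonglongrightarrow> 0"
  proof -
    let ?K = "cball (0::R4) (R+1)"
    have [measurable]: "?K \<in> sets borel" by (rule borel_closed) simp
    have "T \<longlonglongrightarrow> (\<integral>\<^sup>+(x::R4). 0 \<partial>lborel)"
      unfolding T_def
    proof (rule nn_integral_dominated_convergence)
      show "AE x in lborel. indicator (- E) x * ennreal (s + \<bar>u x\<bar>) * J n x
          \<le> ennreal (4 * pi^2) * (ennreal (s + 1) * indicator ?K x + ennreal ((u x)^2))" for n
      proof (rule AE_I2)
        fix x
        show "indicator (- E) x * ennreal (s + \<bar>u x\<bar>) * J n x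
          \<le> ennreal (4 * pi^2) * (ennreal (s + 1) * indicator ?K x + ennreal ((u x)^2))"
        proof (cases "x \<in> ?K")
          case True
          have "\<bar>u x\<bar> \<le> (u x)^2 + 1" by (rule abs_le_square_add_1)
          then have 1: "ennreal (s + \<bar>u x\<bar>) \<le> ennreal (s + 1) + ennreal ((u x)^2)"
            using s(1) by (subst ennreal_plus[symmetric]) (auto intro: ennreal_leI simp del: ennreal_plus)
          have "indicator (- E) x * ennreal (s + \<bar>u x\<bar>) * J n x \<le> 1 * (ennreal (s + 1) + ennreal ((u x)^2)) * ennreal (4 * pi^2)"
          proof (rule mult_mono[OF mult_mono[OF _ 1] J1])
            show "indicator (- E) x \<le> (1::ennreal)" by (simp add: indicator_def)
          qed simp_all
          also have "\<dots> = ennreal (4 * pi^2) * (ennreal (s + 1) * indicator ?K x + ennreal ((u x)^2))"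
            using True by (simp only: mult_1_left indicator_simps mult_1_right mult.commute)
          finally show ?thesis .
        next
          case False
          then have "J n x = 0" by (rule J2)
          then show ?thesis by simp
        qed
      qed
      show "(\<integral>\<^sup>+x. ennreal (4 * pi^2) * (ennreal (s + 1) * indicator ?K x + ennreal ((u x)^2)) \<partial>lborel) < \<infinity>"
      proof -
        have "(\<integral>\<^sup>+x. ennreal (4 * pi^2) * (ennreal (s + 1) * indicator ?K x + ennreal ((u x)^2)) \<partial>lborel)
          = ennreal (4 * pi^2) * (ennreal (s + 1) * emeasure lborel ?K + nn_integral_sq u)"
          by (subst nn_integral_cmult, measurable, subst nn_integral_add) (auto simp: nn_integral_cmult_indicator)
        also have "\<dots> < \<infinity>"
          using order_le_less_trans[OF U(1)] emeasure_bounded_finite[OF bounded_cball, of "0::R4" "R+1"]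
          by (auto simp: ennreal_mult_less_top)
        finally show ?thesis .
      qed
      show "AE x in lborel. (\<lambda>n. indicator (- E) x * ennreal (s + \<bar>u x\<bar>) * J n x) \<longlonglongrightarrow> 0"
      proof (rule AE_I2)
        fix x
        show "(\<lambda>n. indicator (- E) x * ennreal (s + \<bar>u x\<bar>) * J n x) \<longlonglongrightarrow> 0"
        proof (cases "x \<in> E")
          case False
          from ennreal_tendsto_cmult[OF _ J3[OF False], of "ennreal (s + \<bar>u x\<bar>)"] False
          show ?thesis by simp
        qed simp
      qed
    qed measurable
    then show ?thesis by simp
  qed
  have bd: "ennreal (s * (4 * pi^2 * cutoff (\<rho> n) / (1 + \<rho> n)^2) * m) \<le> ?A + T n" for n
  proof -
    have "ennreal (s * (4 * pi^2 * cutoff (\<rho> n) / (1 + \<rho> n)^2) * m)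
      = ennreal s * ennreal (4 * pi^2 * cutoff (\<rho> n) / (1 + \<rho> n)^2) * emeasure lborel E"
      using s(1) m cutoff_bounds(1)[of "\<rho> n"] by (simp add: ennreal_mult del: times_divide_eq_right)
    also have "\<dots> \<le> ?A + T n"
      unfolding T_def J_def
      by (rule level_set_integrated[OF assms(1,2) _ U W uw s \<rho>]) measurable
    finally show ?thesis .
  qed
  have "(\<lambda>n. s * (4 * pi^2 * cutoff (\<rho> n) / (1 + \<rho> n)^2) * m) \<longlonglongrightarrow> s * (4 * pi^2 * 1 / (1 + 0)^2) * m"
  proof (intro tendsto_intros \<rho>0)
    show "(\<lambda>n. cutoff (\<rho> n)) \<longlonglongrightarrow> 1"
      by (rule filterlim_compose[OF cutoff_tendsto]) (use \<rho>0 \<rho> in \<open>auto simp: filterlim_at less_imp_neq[symmetric]\<close>)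
  qed auto
  then have "(\<lambda>n. ennreal (s * (4 * pi^2 * cutoff (\<rho> n) / (1 + \<rho> n)^2) * m)) \<longlonglongrightarrow> ennreal (4 * pi^2 * s * m)"
    by (intro tendsto_ennrealI) (simp add: mult_ac)
  moreover have "(\<lambda>n. ?A + T n) \<longlonglongrightarrow> ?A + 0"
    by (intro tendsto_intros T)
  ultimately have "ennreal (4 * pi^2 * s * m) \<le> ?A + 0"
    using bd by (intro LIMSEQ_le) auto
  then show ?thesis using s(1) m by (simp add: ennreal_mult)
qed

text \<open>The parameter $M$ is the ratio $|x|/|z|$ beyond which $|x-z|$ is replaced by $|x|$ in the
  convolution of the kernel with itself; the loss in the leading coefficient tends to $1$ as $M$ grows.\<close>

definition potential_const :: "real \<Rightarrow> real \<Rightarrow> real" where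
  "potential_const M m = 1 / (1 - 1/M)^2 * pi^2 * (1/2 * max 0 (ln (1/m)) + pi^2) + 4 * pi^2 * (M^2 + (M+1)^2)"

lemma potential_const_nonneg: "potential_const M m \<ge> 0"
  by (simp add: potential_const_def)

lemma ennreal_square_le_imp_le:
  assumes "x^2 \<le> (ennreal a)^2" "a \<ge> 0" shows "x \<le> ennreal a"
proof (cases x)
  case (real r)
  then show ?thesis using assms power2_le_imp_le[of r a]
    by (auto simp: ennreal_power intro: ennreal_leI)
next
  case top
  then show ?thesis using assms by (simp add: ennreal_power top_unique)
qed

text \<open>The density |w| is at most N plus its excess over N. The bounded part pairs with the L^1
  norm pi^2 m of the potential, the excess by Cauchy-Schwarz with its L^2 norm. Every term then
  carries a factor m, which is divided out; the logarithm is multiplied by d alone.\<close>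

lemma level_set_bound:
  fixes u w :: "R4 \<Rightarrow> real"
  assumes [measurable]: "u \<in> borel_measurable borel" "w \<in> borel_measurable borel"
    and U: "nn_integral_sq u \<le> ennreal U" "U \<ge> 0"
    and W: "nn_integral_sq w < \<infinity>"
    and N: "(\<integral>\<^sup>+x. ennreal ((max 0 (\<bar>w x\<bar> - N))^2) \<partial>lborel) \<le> ennreal (d^2)" "N \<ge> 0" "d \<ge> 0"
    and uw: "weak_laplacian u w"
    and s: "s \<ge> 0" "\<And>x. x \<in> E \<Longrightarrow> u x \<ge> s" and E: "compact E" "emeasure lborel E = ennreal m" "m > 0" and M: "M > 1"
  shows "4 * pi^2 * s \<le> 624 * exp 1 * (pi^2 / 2 + U) + N * pi^2 + d * sqrt (potential_const M m)"
proof -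
  have [measurable]: "E \<in> sets borel" using E by (simp add: borel_compact)
  define Q where "Q = potential_const M m"
  have Q: "Q \<ge> 0" by (simp add: Q_def potential_const_nonneg)
  define w2 where "w2 = (\<lambda>x. max 0 (\<bar>w x\<bar> - N))"
  have [measurable]: "w2 \<in> borel_measurable borel" unfolding w2_def by measurable
  have w2: "w2 x \<ge> 0" for x by (simp add: w2_def)
  have P2: "(\<integral>\<^sup>+x. ennreal (w2 x) * potential E x \<partial>lborel) \<le> ennreal (d * m * sqrt Q)"
  proof -
    have "(\<integral>\<^sup>+x. ennreal (w2 x) * potential E x \<partial>lborel)^2 \<le> (\<integral>\<^sup>+x. (ennreal (w2 x))^2 \<partial>lborel) * (\<integral>\<^sup>+x. (potential E x)^2 \<partial>lborel)"
      by (rule Cauchy_Schwarz_nn_integral) measurable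
    also have "\<dots> \<le> ennreal (d^2) * ennreal (m^2 * Q)"
    proof (rule mult_mono)
      show "(\<integral>\<^sup>+x. (ennreal (w2 x))^2 \<partial>lborel) \<le> ennreal (d^2)"
        using N(1) w2 by (simp add: ennreal_power w2_def)
      show "(\<integral>\<^sup>+x. (potential E x)^2 \<partial>lborel) \<le> ennreal (m^2 * Q)"
        unfolding Q_def potential_const_def by (rule nn_integral_potential_square_le) (use E M in auto)
    qed auto
    also have "\<dots> = (ennreal (d * m * sqrt Q))^2"
      using Q N E by (simp add: ennreal_power ennreal_mult[symmetric] power_mult_distrib mult.assoc)
    finally show ?thesis using Q N E by (intro ennreal_square_le_imp_le) auto
  qed
  have "(\<integral>\<^sup>+x. ennreal \<bar>w x\<bar> * potential E x \<partial>lborel) \<le> (\<integral>\<^sup>+x. ennreal N * potential E x + ennreal (w2 x) * potential E x \<partial>lborel)"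
  proof (rule nn_integral_mono)
    fix x
    have "ennreal \<bar>w x\<bar> \<le> ennreal N + ennreal (w2 x)"
      using N w2 by (subst ennreal_plus[symmetric]) (auto simp: w2_def intro!: ennreal_leI simp del: ennreal_plus)
    from mult_right_mono[OF this, of "potential E x"]
    show "ennreal \<bar>w x\<bar> * potential E x \<le> ennreal N * potential E x + ennreal (w2 x) * potential E x"
      by (simp add: distrib_right)
  qed
  also have "\<dots> = ennreal N * (\<integral>\<^sup>+x. potential E x \<partial>lborel) + (\<integral>\<^sup>+x. ennreal (w2 x) * potential E x \<partial>lborel)"
    by (subst nn_integral_add, measurable, subst nn_integral_cmult, measurable)
  also have "\<dots> \<le> ennreal N * (ennreal (pi^2) * ennreal m) + ennreal (d * m * sqrt Q)"
    using P2 by (simp add: nn_integral_potential E add_left_mono)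
  finally have "ennreal (4 * pi^2 * s) * ennreal m
    \<le> ennreal (624 * exp 1 * (pi^2 / 2 + U)) * ennreal m + (ennreal N * (ennreal (pi^2) * ennreal m) + ennreal (d * m * sqrt Q))"
    using level_set_potential_bound[OF assms(1,2) U W uw s E(1)] unfolding E(2)
    by (meson add_left_mono order_trans)
  also have "\<dots> = ennreal ((624 * exp 1 * (pi^2 / 2 + U) + N * pi^2 + d * sqrt Q) * m)"
    using U N E Q by (simp add: ennreal_mult[symmetric] ennreal_plus[symmetric] algebra_simps del: ennreal_plus)
  also have "ennreal (4 * pi^2 * s) * ennreal m = ennreal (4 * pi^2 * s * m)"
    using s E by (intro ennreal_mult[symmetric]) auto
  finally have "4 * pi^2 * s * m \<le> (624 * exp 1 * (pi^2 / 2 + U) + N * pi^2 + d * sqrt Q) * m"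
    using U N E Q by (subst (asm) ennreal_le_iff) auto
  then show ?thesis using E by (simp add: Q_def)
qed

subsection \<open>Gaussian decay of the distribution function and exponential integrability\<close>

text \<open>The level set estimate is available for compact sets. Inner approximation by closed sets
  carries it over to Borel sets, and intersecting with balls makes the approximants compact.\<close>

lemma emeasure_le_of_compact_subsets:
  fixes S :: "R4 set"
  assumes S: "S \<in> sets borel" and b: "\<And>T. compact T \<Longrightarrow> T \<subseteq> S \<Longrightarrow> emeasure lborel T \<le> b"
  shows "emeasure lborel S \<le> b"
proof -
  have n: "emeasure lborel (S \<inter> cball 0 (real n)) \<le> b" for n
  proof (rule ennreal_le_epsilon)
    fix e :: real assume e: "e > 0"
    let ?S = "S \<inter> cball 0 (real n)"
    have Sb: "?S \<in> sets borel" using S by (intro sets.Int) auto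
    then have "?S \<in> sets lebesgue" by auto
    then obtain T where T: "closed T" "T \<subseteq> ?S" "?S - T \<in> lmeasurable" "emeasure lebesgue (?S - T) < ennreal e"
      using e by (rule sets_lebesgue_inner_closed)
    have c: "compact T"
      using T by (meson bounded_cball bounded_subset compact_eq_bounded_closed le_inf_iff)
    have Tb: "T \<in> sets borel" using T by auto
    have "emeasure lborel ?S \<le> emeasure lborel T + emeasure lborel (?S - T)"
      using emeasure_subadditive[of T lborel "?S - T"] T(2) Sb Tb by (simp add: Un_absorb1)
    also have "emeasure lborel (?S - T) = emeasure lebesgue (?S - T)"
      using sets.Diff[of ?S lborel T] Sb Tb by simp
    also have "emeasure lborel T + \<dots> \<le> b + ennreal e"
      using T c by (intro add_mono b) auto
    finally show "emeasure lborel ?S \<le> b + ennreal e" .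
  qed
  have "(SUP n. emeasure lborel (S \<inter> cball 0 (real n))) = emeasure lborel (\<Union>n. S \<inter> cball 0 (real n))"
    using S by (intro SUP_emeasure_incseq) (auto simp: incseq_def intro!: sets.Int)
  also have "(\<Union>n. S \<inter> cball 0 (real n)) = S" by (auto simp: real_arch_simple)
  finally show ?thesis using n by (metis SUP_least)
qed

text \<open>Squaring the hypothesis gives 16 pi^4 s^2 - O(s) \<le> (d^2 \<theta> pi^2/2) ln(1/m) +
  O(1). The strict inequality on a d^2 leaves room for some \<theta> > 1 and, when s is large, for
  the lower-order terms. \<open>M\<close> and \<open>s0\<close> depend on the constants only, not on
  any function.\<close>

lemma decay_constants:
  fixes a d C :: real
  assumes a: "a > 0" and d: "d \<ge> 0" and C: "C \<ge> 0" and ad: "a * d^2 < 32 * pi^2"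
  obtains s0 M where "s0 > 0" "M > 1"
    "\<And>s m. s \<ge> s0 \<Longrightarrow> m > 0 \<Longrightarrow> 4 * pi^2 * s \<le> C + d * sqrt (potential_const M m) \<Longrightarrow> m \<le> exp (- a * s^2)"
proof -
  define \<rho> where "\<rho> = a * d^2 / (32 * pi^2)"
  have \<rho>: "0 \<le> \<rho>" "\<rho> < 1" using a ad by (auto simp: \<rho>_def)
  \<comment> \<open>With this M the number 1 - 1/M is the mean of 1 and \<rho>, whose square exceeds
    \<rho>; hence \<rho> \<theta> < 1.\<close>
  define M where "M = 2 / (1 - \<rho>)"
  have M: "M > 1" "1 - 1/M = (1+\<rho>)/2" using \<rho> by (auto simp: M_def field_simps)
  define \<theta> where "\<theta> = 1 / ((1+\<rho>)/2)^2"
  have \<theta>: "\<theta> > 0" using \<rho> by (simp add: \<theta>_def)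
  have "\<rho> < ((1+\<rho>)/2)^2"
  proof -
    have "0 < (1-\<rho>)^2" using \<rho> by simp
    then show ?thesis by (simp add: power2_eq_square field_simps)
  qed
  then have "\<rho> * \<theta> < 1" using \<rho> by (simp add: \<theta>_def)
  define \<gamma> where "\<gamma> = d^2 * \<theta> * pi^2 / 2"
  have \<gamma>: "\<gamma> \<ge> 0" using \<theta> by (simp add: \<gamma>_def)
  have "a * \<gamma> = 16 * (pi^2 * pi^2) * (\<rho> * \<theta>)" by (simp add: \<gamma>_def \<rho>_def power2_eq_square)
  also have "\<dots> < 16 * (pi^2 * pi^2)" using \<open>\<rho> * \<theta> < 1\<close> by simp
  finally have a\<gamma>: "a * \<gamma> < 16 * (pi^2 * pi^2)" .
  define K where "K = \<theta> * pi^2 * pi^2 + 4 * pi^2 * (M^2 + (M+1)^2)"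
  have K: "K \<ge> 0" using \<theta> by (simp add: K_def)
  define \<eta> where "\<eta> = 16 * (pi^2 * pi^2) - a * \<gamma>"
  have \<eta>: "\<eta> > 0" using a\<gamma> by (simp add: \<eta>_def)
  \<comment> \<open>The summand 1 lets constants be absorbed into multiples of s, the second makes 4
    pi^2 s - C nonnegative before squaring, the third lets \<eta> s^2 dominate the lower-order
    terms.\<close>
  define s0 where "s0 = 1 + C / (4 * pi^2) + (8 * pi^2 * C + d^2 * K) / \<eta>"
  have s01: "s0 \<ge> 1" using C K \<eta> by (simp add: s0_def)
  have s0C: "s0 \<ge> C / (4 * pi^2)" using C K \<eta> by (simp add: s0_def)
  have s0\<eta>: "\<eta> * s0 > 8 * pi^2 * C + d^2 * K"
  proof -
    have "s0 > (8 * pi^2 * C + d^2 * K) / \<eta>" using C by (simp add: s0_def add_pos_nonneg)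
    then show ?thesis using \<eta> by (simp add: divide_less_eq mult.commute)
  qed
  show thesis
  proof (rule that[of s0 M])
    show "s0 > 0" "M > 1" using s01 M by auto
    fix s m assume s: "s \<ge> s0" and m: "m > 0" and le: "4 * pi^2 * s \<le> C + d * sqrt (potential_const M m)"
    define L where "L = max 0 (ln (1/m))"
    have Q: "potential_const M m = \<theta> * pi^2 / 2 * L + K"
    proof -
      have "1 / (1 - 1/M)^2 = \<theta>" by (simp add: M(2) \<theta>_def)
      then show ?thesis by (simp only: potential_const_def L_def[symmetric] K_def) (simp add: algebra_simps)
    qed
    have "C / (4 * pi^2) \<le> s" using s s0C by linarith
    then have "0 \<le> 4 * pi^2 * s - C" by (simp add: divide_le_eq mult.commute)
    moreover have "4 * pi^2 * s - C \<le> d * sqrt (potential_const M m)" using le by simp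
    ultimately have "(4 * pi^2 * s - C)^2 \<le> (d * sqrt (potential_const M m))^2" by (intro power_mono)
    also have "\<dots> = \<gamma> * L + d^2 * K"
      using potential_const_nonneg[of M m] by (simp add: power_mult_distrib) (simp add: Q \<gamma>_def algebra_simps)
    finally have "16 * (pi^2 * pi^2) * s^2 - 8 * pi^2 * C * s + C^2 \<le> \<gamma> * L + d^2 * K"
      by (simp add: power2_eq_square algebra_simps)
    moreover have "\<eta> * s^2 > 8 * pi^2 * C * s + d^2 * K"
    proof -
      have sp: "s \<ge> 1" using s s01 by simp
      have "8 * pi^2 * C * s + d^2 * K \<le> (8 * pi^2 * C + d^2 * K) * s"
        using K sp mult_left_mono[OF sp, of "d^2 * K"] by (simp add: distrib_right)
      also have "\<dots> < (\<eta> * s0) * s" using s0\<eta> sp by simp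
      also have "\<dots> \<le> (\<eta> * s) * s" using s \<eta> sp by (intro mult_right_mono mult_left_mono) auto
      finally show ?thesis by (simp add: power2_eq_square mult.assoc)
    qed
    moreover have "C^2 \<ge> 0" by simp
    moreover have "\<eta> * s^2 = 16 * (pi^2 * pi^2) * s^2 - a * \<gamma> * s^2" by (simp add: \<eta>_def algebra_simps)
    ultimately have "a * \<gamma> * s^2 < \<gamma> * L" by linarith
    then have "\<gamma> * (a * s^2) < \<gamma> * L" by (simp add: mult_ac)
    then have "a * s^2 < L" using \<gamma> by (rule mult_left_less_imp_less)
    moreover have "0 \<le> a * s^2" using a by simp
    \<comment> \<open>L exceeds a nonnegative number, so the maximum in its definition is the
      logarithm.\<close>
    ultimately have "a * s^2 < ln (1/m)" by (simp add: L_def max_def split: if_splits)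
    then have "ln m < - a * s^2" using m by (simp add: ln_div)
    then show "m \<le> exp (- a * s^2)" using m by (metis exp_less_mono exp_ln less_imp_le)
  qed
qed

lemma weak_laplacian_minus:
  "weak_laplacian u w \<Longrightarrow> weak_laplacian (\<lambda>x. - u x) (\<lambda>x. - w x)"
  by (simp add: weak_laplacian_def)

text \<open>The one-sided estimate is applied to u and to -u, hence the factor 2. The threshold
  \<open>s0\<close> is fixed before the functions are, and this uniformity is what the supremum
  needs.\<close>

lemma level_set_decay:
  fixes a d N U :: real
  assumes a: "a > 0" and d: "d \<ge> 0" and N: "N \<ge> 0" and U: "U \<ge> 0" and ad: "a * d^2 < 32 * pi^2"
  obtains s0 where "s0 > 0"
    "\<And>u w s. u \<in> borel_measurable borel \<Longrightarrow> w \<in> borel_measurable borel \<Longrightarrow> weak_laplacian u w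
       \<Longrightarrow> nn_integral_sq u \<le> ennreal U \<Longrightarrow> nn_integral_sq w < \<infinity>
       \<Longrightarrow> (\<integral>\<^sup>+x. ennreal ((max 0 (\<bar>w x\<bar> - N))^2) \<partial>lborel) \<le> ennreal (d^2) \<Longrightarrow> s \<ge> s0
       \<Longrightarrow> emeasure lborel {x. s \<le> \<bar>u x\<bar>} \<le> ennreal (2 * exp (- a * s^2))"
proof -
  define C where "C = 624 * exp 1 * (pi^2 / 2 + U) + N * pi^2"
  have C: "C \<ge> 0" using U N by (simp add: C_def)
  obtain s0 M where s0: "s0 > 0" "M > 1"
    "\<And>s m. s \<ge> s0 \<Longrightarrow> m > 0 \<Longrightarrow> 4 * pi^2 * s \<le> C + d * sqrt (potential_const M m) \<Longrightarrow> m \<le> exp (- a * s^2)"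
    using decay_constants[OF a d C ad] by metis
  have half: "emeasure lborel {x. s \<le> u x} \<le> ennreal (exp (- a * s^2))"
    if [measurable]: "u \<in> borel_measurable borel" "w \<in> borel_measurable borel" and uw: "weak_laplacian u w"
      and u: "nn_integral_sq u \<le> ennreal U" and w: "nn_integral_sq w < \<infinity>"
      and wd: "(\<integral>\<^sup>+x. ennreal ((max 0 (\<bar>w x\<bar> - N))^2) \<partial>lborel) \<le> ennreal (d^2)" and s: "s \<ge> s0" for u w s
  proof (rule emeasure_le_of_compact_subsets)
    show "{x. s \<le> u x} \<in> sets borel" by measurable
    fix T assume T: "compact T" "T \<subseteq> {x. s \<le> u x}"
    obtain m where m: "emeasure lborel T = ennreal m" "m \<ge> 0"
      using emeasure_compact_finite[OF T(1)] by (cases "emeasure lborel T") auto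
    have "m \<le> exp (- a * s^2)"
    proof (cases "m = 0")
      case False
      then have mp: "m > 0" using m by simp
      have "4 * pi^2 * s \<le> C + d * sqrt (potential_const M m)"
        unfolding C_def
        by (rule level_set_bound[OF that(1,2) u U w wd N d uw _ _ T(1) m(1) mp s0(2)]) (use s s0 T in auto)
      then show ?thesis by (rule s0(3)[OF s mp])
    qed simp
    then show "emeasure lborel T \<le> ennreal (exp (- a * s^2))" using m by (simp add: ennreal_leI)
  qed
  show thesis
  proof (rule that[OF s0(1)])
    fix u w :: "R4 \<Rightarrow> real" and s :: real
    assume [measurable]: "u \<in> borel_measurable borel" "w \<in> borel_measurable borel" and uw: "weak_laplacian u w"
      and u: "nn_integral_sq u \<le> ennreal U" and w: "nn_integral_sq w < \<infinity>"
      and wd: "(\<integral>\<^sup>+x. ennreal ((max 0 (\<bar>w x\<bar> - N))^2) \<partial>lborel) \<le> ennreal (d^2)" and s: "s \<ge> s0"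
    have "{x. s \<le> \<bar>u x\<bar>} = {x. s \<le> u x} \<union> {x. s \<le> - u x}" by auto
    then have "emeasure lborel {x. s \<le> \<bar>u x\<bar>} \<le> emeasure lborel {x. s \<le> u x} + emeasure lborel {x. s \<le> - u x}"
      by (simp add: emeasure_subadditive)
    also have "\<dots> \<le> ennreal (exp (- a * s^2)) + ennreal (exp (- a * s^2))"
    proof (rule add_mono)
      show "emeasure lborel {x. s \<le> u x} \<le> ennreal (exp (- a * s^2))"
        by (rule half[OF _ _ uw u w wd s]) measurable
      show "emeasure lborel {x. s \<le> - u x} \<le> ennreal (exp (- a * s^2))"
        by (rule half[OF _ _ weak_laplacian_minus[OF uw]]) (use u w wd s in auto)
    qed
    also have "\<dots> = ennreal (2 * exp (- a * s^2))" by (simp flip: ennreal_plus)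
    finally show "emeasure lborel {x. s \<le> \<bar>u x\<bar>} \<le> ennreal (2 * exp (- a * s^2))" .
  qed
qed

text \<open>Monotonicity in m holds since 1 - \<beta>/4 is positive; a null set is treated apart
  because the sharp form divides by powers of the measure.\<close>

lemma nn_integral_weight_le':
  fixes E :: "R4 set"
  assumes [measurable]: "E \<in> sets borel" and E: "emeasure lborel E \<le> ennreal m" and m: "m > 0"
    and \<beta>: "0 \<le> \<beta>" "\<beta> < 4"
  shows "(\<integral>\<^sup>+x. ennreal (1 / norm x powr \<beta>) * indicator E x \<partial>lborel)
    \<le> ennreal ((pi^2 / (2 - \<beta>/2) + 1) * m powr (1 - \<beta>/4))"
proof -
  obtain m' where m': "emeasure lborel E = ennreal m'" "m' \<ge> 0" "m' \<le> m"
    using E m by (cases "emeasure lborel E") (auto simp: top_unique)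
  show ?thesis
  proof (cases "m' = 0")
    case True
    then have "AE x in lborel. x \<notin> E" using m'(1) by (intro AE_not_in) (auto simp: null_sets_def)
    then have "(\<integral>\<^sup>+x. ennreal (1 / norm x powr \<beta>) * indicator E x \<partial>lborel) = (\<integral>\<^sup>+(x::R4). 0 \<partial>lborel)"
      by (intro nn_integral_cong_AE) auto
    then show ?thesis by simp
  next
    case False
    have "(\<integral>\<^sup>+x. ennreal (1 / norm x powr \<beta>) * indicator E x \<partial>lborel)
      \<le> ennreal ((pi^2 / (2 - \<beta>/2) + 1) * m' powr (1 - \<beta>/4))"
      by (rule nn_integral_weight_le) (use m' False \<beta> in auto)
    also have "\<dots> \<le> ennreal ((pi^2 / (2 - \<beta>/2) + 1) * m powr (1 - \<beta>/4))"
      using m' \<beta> by (intro ennreal_leI mult_left_mono powr_mono2) auto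
    finally show ?thesis .
  qed
qed

section \<open>From Gaussian decay of level sets to exponential integrals\<close>

lemma exp_minus_1_le: "(exp y - 1 :: real) \<le> y * exp y"
  using exp_ge_add_one_self[of "- y"] mult_right_mono[of "1 - y" "exp (- y)" "exp y"]
  by (simp add: mult_exp_exp algebra_simps)

lemma summable_gaussian_ratio:
  fixes \<alpha> a t0 :: real
  assumes "a > \<alpha>" "t0 \<ge> 0"
  shows "summable (\<lambda>k. exp (\<alpha> * (t0 + real k + 1)^2) * exp (- a * (t0 + real k)^2))"
proof (rule summable_comparison_test'[where N = 0])
  define \<delta> where "\<delta> = a - \<alpha>"
  \<comment> \<open>Completing the square in \<delta> t^2 - (2 \<alpha> + 1) t yields \<alpha>
    (t+1)^2 - a t^2 \<le> c - t, so a geometric series of ratio exp(-1) dominates.\<close>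
  define c where "c = \<alpha> + (2 * \<alpha> + 1)^2 / (4 * \<delta>)"
  have \<delta>: "\<delta> > 0" using assms by (simp add: \<delta>_def)
  show "summable (\<lambda>k. exp c * exp (-1) ^ k)"
    by (intro summable_mult summable_geometric) simp
  fix k :: nat
  define t where "t = t0 + real k"
  have "0 \<le> \<delta> * (t - (2 * \<alpha> + 1) / (2 * \<delta>))^2" using \<delta> by simp
  also have "\<dots> = \<delta> * t^2 - (2 * \<alpha> + 1) * t + (2 * \<alpha> + 1)^2 / (4 * \<delta>)"
    using \<delta> by (simp add: power2_eq_square field_simps)
  finally have "\<alpha> * (t + 1)^2 + - a * t^2 \<le> c - t"
    by (simp add: c_def \<delta>_def power2_eq_square algebra_simps)
  also have "\<dots> \<le> c - k" using assms by (simp add: t_def)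
  finally have "exp (\<alpha> * (t + 1)^2 + - a * t^2) \<le> exp (c - k)" by simp
  also have "exp (c - k) = exp c * exp (-1) ^ k"
    by (simp add: exp_of_nat_mult[symmetric] mult_exp_exp)
  finally show "norm (exp (\<alpha> * (t0 + real k + 1)^2) * exp (- a * (t0 + real k)^2)) \<le> exp c * exp (-1) ^ k"
    by (simp add: t_def mult_exp_exp)
qed

text \<open>Below the threshold n the integrand is at most a constant times v^2/|x|^\<beta>: near
  the origin v^2 \<le> n^2 and the weight is integrable, away from it the weight is at most 1 and
  v^2 is kept. Above n, the unit slice that contains |v| supplies one sufficient term of the
  series.\<close>

lemma TM_integrand_le:
  fixes x :: R4 and v \<alpha> \<beta> :: real and n :: nat
  assumes \<alpha>: "\<alpha> > 0" and \<beta>: "\<beta> \<ge> 0"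
  shows "ennreal ((exp (\<alpha> * v^2) - 1) / (norm x powr \<beta>))
     \<le> ennreal (\<alpha> * exp (\<alpha> * (real n)^2)) * (ennreal ((real n)^2) * (ennreal (1 / norm x powr \<beta>) * indicator (cball 0 1) x) + ennreal (v^2))
      + (\<Sum>k. ennreal (exp (\<alpha> * (real n + real k + 1)^2)) * (ennreal (1 / norm x powr \<beta>) * (if real n + real k \<le> \<bar>v\<bar> then 1 else 0)))"
    (is "_ \<le> ?A + (\<Sum>k. ?B k)")
proof (cases "\<bar>v\<bar> < real n")
  case True
  have v2: "v^2 \<le> (real n)^2" using True by (simp add: abs_le_square_iff[symmetric])
  have "exp (\<alpha> * v^2) - 1 \<le> \<alpha> * v^2 * exp (\<alpha> * v^2)" by (rule exp_minus_1_le)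
  also have "\<dots> \<le> \<alpha> * v^2 * exp (\<alpha> * (real n)^2)" using \<alpha> v2 by (intro mult_left_mono) auto
  finally have e: "exp (\<alpha> * v^2) - 1 \<le> \<alpha> * exp (\<alpha> * (real n)^2) * v^2" by (simp add: mult_ac)
  have "(exp (\<alpha> * v^2) - 1) / (norm x powr \<beta>) \<le> \<alpha> * exp (\<alpha> * (real n)^2) * ((real n)^2 * (1 / norm x powr \<beta> * indicator (cball 0 1) x) + v^2)"
  proof -
    have "(exp (\<alpha> * v^2) - 1) / (norm x powr \<beta>) \<le> (\<alpha> * exp (\<alpha> * (real n)^2) * v^2) / (norm x powr \<beta>)"
      using e by (intro divide_right_mono) auto
    also have "\<dots> = \<alpha> * exp (\<alpha> * (real n)^2) * (v^2 * (1 / norm x powr \<beta>))" by simp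
    also have "\<dots> \<le> \<alpha> * exp (\<alpha> * (real n)^2) * ((real n)^2 * (1 / norm x powr \<beta> * indicator (cball 0 1) x) + v^2)"
    proof (rule mult_left_mono)
      show "v^2 * (1 / norm x powr \<beta>) \<le> (real n)^2 * (1 / norm x powr \<beta> * indicator (cball 0 1) x) + v^2"
      proof (cases "norm x \<le> 1")
        case True
        have "v^2 * (1 / norm x powr \<beta>) \<le> (real n)^2 * (1 / norm x powr \<beta>)"
          using v2 by (intro mult_right_mono) auto
        then show ?thesis using True by (simp add: add_increasing2)
      next
        case False
        then have "1 \<le> norm x powr \<beta>" using \<beta> by (simp add: ge_one_powr_ge_zero)
        then have "1 / norm x powr \<beta> \<le> 1" by (subst divide_le_eq_1_pos) linarith+
        then have "v^2 * (1 / norm x powr \<beta>) \<le> v^2 * 1" by (rule mult_left_mono) simp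
        then show ?thesis using False by simp
      qed
    qed (use \<alpha> in simp)
    finally show ?thesis .
  qed
  from ennreal_leI[OF this] \<alpha>
  have "ennreal ((exp (\<alpha> * v^2) - 1) / (norm x powr \<beta>)) \<le> ?A"
    by (simp add: ennreal_mult ennreal_plus ennreal_indicator del: times_divide_eq_left)
  then show ?thesis by (rule add_increasing2[OF zero_le])
next
  case False
  define k where "k = nat \<lfloor>\<bar>v\<bar> - real n\<rfloor>"
  have k: "real n + real k \<le> \<bar>v\<bar>" "\<bar>v\<bar> \<le> real n + real k + 1"
    using False by (auto simp: k_def) linarith+
  have "exp (\<alpha> * v^2) - 1 \<le> exp (\<alpha> * (real n + real k + 1)^2)"
  proof -
    have "v^2 \<le> (real n + real k + 1)^2" using k by (simp add: abs_le_square_iff[symmetric])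
    then have "exp (\<alpha> * v^2) \<le> exp (\<alpha> * (real n + real k + 1)^2)" using \<alpha> by simp
    then show ?thesis by linarith
  qed
  then have "(exp (\<alpha> * v^2) - 1) / (norm x powr \<beta>) \<le> exp (\<alpha> * (real n + real k + 1)^2) * (1 / (norm x powr \<beta>))"
    by (simp add: divide_right_mono)
  from ennreal_leI[OF this] have "ennreal ((exp (\<alpha> * v^2) - 1) / (norm x powr \<beta>)) \<le> ?B k"
    using k by (simp add: ennreal_mult del: times_divide_eq_right)
  also have "\<dots> = (\<Sum>j\<in>{k}. ?B j)" by simp
  also have "\<dots> \<le> (\<Sum>k. ?B k)" by (rule sum_le_suminf) auto
  finally show ?thesis by (rule add_increasing[OF zero_le])
qed

text \<open>For t beyond the threshold the weighted measure of the set where |u| \<ge> t is at most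
  c (2 exp(-a t^2))^(1 - \<beta>/4). The Gaussian rate thus becomes a (1 - \<beta>/4), which beats
  \<alpha>. The bound B is fixed before u.\<close>

lemma TM_le_of_decay:
  fixes \<alpha> a \<beta> s0 U :: real
  assumes \<alpha>: "\<alpha> > 0" and \<beta>: "0 \<le> \<beta>" "\<beta> < 4" and a: "a * (1 - \<beta>/4) > \<alpha>" and U: "U \<ge> 0"
  obtains B where "B < \<infinity>"
    "\<And>u. u \<in> borel_measurable borel \<Longrightarrow> nn_integral_sq u \<le> ennreal U
      \<Longrightarrow> (\<forall>s\<ge>s0. emeasure lborel {x. s \<le> \<bar>u x\<bar>} \<le> ennreal (2 * exp (- a * s^2))) \<Longrightarrow> TM \<alpha> \<beta> u \<le> B"
proof -
  \<comment> \<open>Rounding \<open>s0\<close> up puts all levels n + k into the range where the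
    decay is known.\<close>
  define n where "n = nat \<lceil>s0\<rceil>"
  have n: "real n \<ge> s0" unfolding n_def by linarith
  define c where "c = pi^2 / (2 - \<beta>/2) + 1"
  have c: "c \<ge> 0" using \<beta> by (simp add: c_def)
  define W where "W = c * (pi^2/2) powr (1 - \<beta>/4)"
  have W: "W \<ge> 0" using c by (simp add: W_def)
  define f where "f = (\<lambda>k. exp (\<alpha> * (real n + real k + 1)^2) * (c * (2 * exp (- a * (real n + real k)^2)) powr (1 - \<beta>/4)))"
  have f0: "f k \<ge> 0" for k using c by (simp add: f_def)
  have sf: "summable f"
  proof -
    have "summable (\<lambda>k. c * 2 powr (1 - \<beta>/4) * (exp (\<alpha> * (real n + real k + 1)^2) * exp (- (a * (1 - \<beta>/4)) * (real n + real k)^2)))"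
      by (intro summable_mult summable_gaussian_ratio a) simp
    moreover have "f = (\<lambda>k. c * 2 powr (1 - \<beta>/4) * (exp (\<alpha> * (real n + real k + 1)^2) * exp (- (a * (1 - \<beta>/4)) * (real n + real k)^2)))"
      by (simp add: f_def powr_mult exp_powr_real fun_eq_iff mult_ac)
    ultimately show ?thesis by simp
  qed
  define B where "B = ennreal (\<alpha> * exp (\<alpha> * (real n)^2)) * (ennreal ((real n)^2) * ennreal W + ennreal U) + ennreal (suminf f)"
  show thesis
  proof (rule that[of B])
    show "B < \<infinity>" by (simp add: B_def ennreal_mult_less_top)
    fix u :: "R4 \<Rightarrow> real"
    assume [measurable]: "u \<in> borel_measurable borel" and u: "nn_integral_sq u \<le> ennreal U"
      and dec: "\<forall>s\<ge>s0. emeasure lborel {x. s \<le> \<bar>u x\<bar>} \<le> ennreal (2 * exp (- a * s^2))"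
    let ?w = "\<lambda>x::R4. ennreal (1 / norm x powr \<beta>)"
    let ?E = "\<lambda>k. {x. real n + real k \<le> \<bar>u x\<bar>}"
    have [measurable]: "cball (0::R4) 1 \<in> sets borel" by (rule borel_closed) simp
    have [measurable]: "?E k \<in> sets borel" for k by measurable
    have "TM \<alpha> \<beta> u = (\<integral>\<^sup>+x. ennreal ((exp (\<alpha> * (u x)^2) - 1) / (norm x powr \<beta>)) \<partial>lborel)"
      by (simp add: TM_def nn_integral_completion)
    also have "\<dots> \<le> (\<integral>\<^sup>+x. ennreal (\<alpha> * exp (\<alpha> * (real n)^2)) * (ennreal ((real n)^2) * (?w x * indicator (cball 0 1) x) + ennreal ((u x)^2))
      + (\<Sum>k. ennreal (exp (\<alpha> * (real n + real k + 1)^2)) * (?w x * indicator (?E k) x)) \<partial>lborel)"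
    proof (rule nn_integral_mono)
      fix x
      have i: "indicator (?E k) x = (if real n + real k \<le> \<bar>u x\<bar> then 1 else (0::ennreal))" for k by simp
      show "ennreal ((exp (\<alpha> * (u x)^2) - 1) / (norm x powr \<beta>))
        \<le> ennreal (\<alpha> * exp (\<alpha> * (real n)^2)) * (ennreal ((real n)^2) * (?w x * indicator (cball 0 1) x) + ennreal ((u x)^2))
         + (\<Sum>k. ennreal (exp (\<alpha> * (real n + real k + 1)^2)) * (?w x * indicator (?E k) x))"
        unfolding i by (rule TM_integrand_le[OF \<alpha> \<beta>(1)])
    qed
    also have "\<dots> = ennreal (\<alpha> * exp (\<alpha> * (real n)^2)) * (ennreal ((real n)^2) * (\<integral>\<^sup>+x. ?w x * indicator (cball 0 1) x \<partial>lborel) + nn_integral_sq u)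
      + (\<Sum>k. ennreal (exp (\<alpha> * (real n + real k + 1)^2)) * (\<integral>\<^sup>+x. ?w x * indicator (?E k) x \<partial>lborel))"
      by (simp add: nn_integral_add nn_integral_cmult nn_integral_suminf)
    also have "\<dots> \<le> B"
      unfolding B_def
    proof (intro add_mono mult_left_mono)
      show "(\<integral>\<^sup>+x. ?w x * indicator (cball 0 1) x \<partial>lborel) \<le> ennreal W"
        unfolding W_def c_def
        by (rule nn_integral_weight_le') (use \<beta> in \<open>auto simp: emeasure_cball unit_ball_vol_4\<close>)
      have "(\<Sum>k. ennreal (exp (\<alpha> * (real n + real k + 1)^2)) * (\<integral>\<^sup>+x. ?w x * indicator (?E k) x \<partial>lborel)) \<le> (\<Sum>k. ennreal (f k))"
      proof (rule suminf_le)
        fix k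
        have "(\<integral>\<^sup>+x. ?w x * indicator (?E k) x \<partial>lborel) \<le> ennreal (c * (2 * exp (- a * (real n + real k)^2)) powr (1 - \<beta>/4))"
          unfolding c_def by (rule nn_integral_weight_le') (use \<beta> n dec[rule_format, of "real n + real k"] in auto)
        then have "ennreal (exp (\<alpha> * (real n + real k + 1)^2)) * (\<integral>\<^sup>+x. ?w x * indicator (?E k) x \<partial>lborel)
          \<le> ennreal (exp (\<alpha> * (real n + real k + 1)^2)) * ennreal (c * (2 * exp (- a * (real n + real k)^2)) powr (1 - \<beta>/4))"
          by (rule mult_left_mono) simp
        also have "\<dots> = ennreal (f k)" unfolding f_def using c by (intro ennreal_mult[symmetric]) auto
        finally show "ennreal (exp (\<alpha> * (real n + real k + 1)^2)) * (\<integral>\<^sup>+x. ?w x * indicator (?E k) x \<partial>lborel) \<le> ennreal (f k)" .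
      qed auto
      also have "\<dots> = ennreal (suminf f)" by (rule suminf_ennreal2[OF f0 sf])
      finally show "(\<Sum>k. ennreal (exp (\<alpha> * (real n + real k + 1)^2)) * (\<integral>\<^sup>+x. ?w x * indicator (?E k) x \<partial>lborel)) \<le> ennreal (suminf f)" .
    qed (use u in auto)
    finally show "TM \<alpha> \<beta> u \<le> B" .
  qed
qed

subsection \<open>Boundedness below the critical exponent\<close>

lemma L2_borel_version:
  assumes "L2 f"
  obtains f' where "f' \<in> borel_measurable borel" "AE x in lborel. f x = f' x"
    "nn_integral_sq f' < \<infinity>"
proof -
  obtain f' where f': "f' \<in> borel_measurable lborel" "AE x in lborel. f x = f' x"
    using completion_ex_borel_measurable_real[of f lborel] assms by (auto simp: L2_def)
  have "nn_integral_sq f' = nn_integral_sq f"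
    using f'(2) by (intro nn_integral_cong_AE) auto
  also have "\<dots> = (\<integral>\<^sup>+x. ennreal ((f x)^2) \<partial>lebesgue)"
    by (simp add: nn_integral_completion)
  also have "\<dots> < \<infinity>"
    using assms by (auto simp: L2_def integrable_iff_bounded)
  finally show thesis using f' by (intro that[of f']) auto
qed

lemma integral_borel_version:
  assumes f: "f' \<in> borel_measurable borel" "AE x in lborel. f x = f' x" "f \<in> borel_measurable lebesgue"
    and \<phi>: "test_fun \<phi>"
  shows "(\<integral>x. f x * \<phi> x \<partial>lebesgue) = (\<integral>x. f' x * \<phi> x \<partial>lborel)"
proof -
  have [measurable]: "f' \<in> borel_measurable lborel" "\<phi> \<in> borel_measurable lborel"
    using f test_fun_measurable[OF \<phi>] by auto
  have "(\<integral>x. f' x * \<phi> x \<partial>lborel) = (\<integral>x. f' x * \<phi> x \<partial>lebesgue)"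
    by (rule integral_completion[symmetric]) measurable
  also have "\<dots> = (\<integral>x. f x * \<phi> x \<partial>lebesgue)"
  proof -
    have \<phi>m: "\<phi> \<in> borel_measurable lebesgue" by (rule measurable_completion) measurable
    have "(\<lambda>x. f' x * \<phi> x) \<in> borel_measurable lebesgue"
      by (rule measurable_completion) measurable
    moreover have "(\<lambda>x. f x * \<phi> x) \<in> borel_measurable lebesgue"
      using f(3) \<phi>m by (rule borel_measurable_times)
    moreover have "AE x in lebesgue. f' x * \<phi> x = f x * \<phi> x"
      using AE_completion[OF f(2)] by eventually_elim simp
    ultimately show ?thesis by (rule integral_cong_AE)
  qed
  finally show ?thesis by simp
qed

text \<open>The definition of the weak derivative is applied twice in each direction, with
  \<open>cpartial i \<psi>\<close> as intermediate test function. Keeping w' almost everywhere equal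
  to the trace of h lets the energy constraint pass to w'.\<close>

lemma W22_weak_laplacian:
  assumes "W22_derivs u g h"
  obtains u' w' where "u' \<in> borel_measurable borel" "w' \<in> borel_measurable borel"
    "AE x in lborel. u x = u' x" "AE x in lborel. (\<Sum>i\<in>UNIV. h i i x) = w' x"
    "nn_integral_sq u' < \<infinity>" "nn_integral_sq w' < \<infinity>"
    "weak_laplacian u' w'"
proof -
  have L2u: "L2 u" and wu: "\<And>i. weak_partial u i (g i)" and L2h: "\<And>i. L2 (h i i)"
    and wg: "\<And>i. weak_partial (g i) i (h i i)"
    using assms by (auto simp: W22_derivs_def)
  have um: "u \<in> borel_measurable lebesgue" and hm: "h i i \<in> borel_measurable lebesgue" for i
    using L2u L2h by (auto simp: L2_def)
  obtain u' where u': "u' \<in> borel_measurable borel" "AE x in lborel. u x = u' x"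
    "nn_integral_sq u' < \<infinity>"
    by (rule L2_borel_version[OF L2u]) (rule that)
  have "\<exists>h'. h' \<in> borel_measurable borel \<and> (AE x in lborel. h i i x = h' x) \<and> nn_integral_sq h' < \<infinity>" for i
    by (rule L2_borel_version[OF L2h[of i]]) blast
  then have "\<forall>i. \<exists>h'. h' \<in> borel_measurable borel \<and> (AE x in lborel. h i i x = h' x) \<and> nn_integral_sq h' < \<infinity>"
    by blast
  from choice[OF this] obtain h' where h': "\<And>i. h' i \<in> borel_measurable borel" "\<And>i. AE x in lborel. h i i x = h' i x"
    "\<And>i. (\<integral>\<^sup>+x. ennreal ((h' i x)^2) \<partial>lborel) < \<infinity>"
    by blast
  note [measurable] = u'(1) h'(1)
  define w' where "w' = (\<lambda>x. \<Sum>i\<in>UNIV. h' i x)"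
  have 1: "AE x in lborel. (\<Sum>i\<in>UNIV. h i i x) = w' x"
  proof -
    have "AE x in lborel. \<forall>i\<in>UNIV. h i i x = h' i x"
      using h'(2) by (subst AE_finite_all) auto
    then show ?thesis by eventually_elim (simp add: w'_def)
  qed
  have 2: "nn_integral_sq w' < \<infinity>"
  proof -
    have "(w' x)^2 \<le> 4 * (\<Sum>i\<in>UNIV. (h' i x)^2)" for x
      using sum_squared_le_sum_of_squares[of "\<lambda>i::4. h' i x" UNIV] by (simp add: w'_def)
    then have "nn_integral_sq w' \<le> (\<integral>\<^sup>+x. ennreal (4 * (\<Sum>i\<in>UNIV. (h' i x)^2)) \<partial>lborel)"
      by (intro nn_integral_mono ennreal_leI)
    also have "\<dots> = (\<integral>\<^sup>+x. 4 * (\<Sum>i\<in>UNIV. ennreal ((h' i x)^2)) \<partial>lborel)"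
      by (simp add: ennreal_mult sum_nonneg)
    also have "\<dots> = 4 * (\<Sum>i\<in>UNIV. (\<integral>\<^sup>+x. ennreal ((h' i x)^2) \<partial>lborel))"
      by (subst nn_integral_cmult, measurable, subst nn_integral_sum) auto
    also have "\<dots> < \<infinity>"
      using h'(3) by (auto simp: ennreal_mult_less_top)
    finally show ?thesis .
  qed
  have 3: "weak_laplacian u' w'"
    unfolding weak_laplacian_def
  proof (intro allI impI)
    fix \<psi> assume t: "test_fun \<psi>"
    have t2: "test_fun (cpartial i (cpartial i \<psi>))" for i
      by (intro test_fun_cpartial t)
    have e: "(\<integral>x. u' x * cpartial i (cpartial i \<psi>) x \<partial>lborel) = (\<integral>x. h' i x * \<psi> x \<partial>lborel)" for i
    proof -
      have "(\<integral>x. u' x * cpartial i (cpartial i \<psi>) x \<partial>lborel) = (\<integral>x. u x * cpartial i (cpartial i \<psi>) x \<partial>lebesgue)"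
        by (rule integral_borel_version[OF u'(1,2) um t2, symmetric])
      also have "\<dots> = - (\<integral>x. g i x * cpartial i \<psi> x \<partial>lebesgue)"
        using wu[of i] test_fun_cpartial[OF t, of i] by (simp add: weak_partial_def)
      also have "\<dots> = (\<integral>x. h i i x * \<psi> x \<partial>lebesgue)"
        using wg[of i] t by (simp add: weak_partial_def)
      also have "\<dots> = (\<integral>x. h' i x * \<psi> x \<partial>lborel)"
        by (rule integral_borel_version[OF h'(1,2) hm t])
      finally show ?thesis .
    qed
    have int: "integrable lborel (\<lambda>x. f x * \<phi> x)"
      if f: "f \<in> borel_measurable borel" "nn_integral_sq f < \<infinity>" and \<phi>: "test_fun \<phi>" for f \<phi>
    proof -
      obtain K R where K: "\<And>x. \<bar>\<phi> x\<bar> \<le> K * indicator (cball 0 R) x"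
        by (rule test_fun_bounded[OF \<phi>]) blast
      show ?thesis
        by (rule integrable_mult_bounded_support[OF f(1) test_fun_measurable[OF \<phi>] f(2) K])
    qed
    have "(\<integral>x. u' x * (\<Sum>i\<in>UNIV. cpartial i (cpartial i \<psi>) x) \<partial>lborel)
      = (\<Sum>i\<in>UNIV. \<integral>x. u' x * cpartial i (cpartial i \<psi>) x \<partial>lborel)"
      unfolding sum_distrib_left by (rule Bochner_Integration.integral_sum) (use u' t2 in \<open>auto intro!: int\<close>)
    also have "\<dots> = (\<Sum>i\<in>UNIV. \<integral>x. h' i x * \<psi> x \<partial>lborel)" by (simp add: e)
    also have "\<dots> = (\<integral>x. w' x * \<psi> x \<partial>lborel)"
      unfolding w'_def sum_distrib_right
      by (rule Bochner_Integration.integral_sum[symmetric]) (use h' t in \<open>auto intro!: int\<close>)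
    finally show "(\<integral>x. u' x * (\<Sum>i\<in>UNIV. cpartial i (cpartial i \<psi>) x) \<partial>lborel) = (\<integral>x. w' x * \<psi> x \<partial>lborel)" .
  qed
  show thesis
    by (rule that[OF u'(1) _ u'(2) 1 u'(3) 2 3]) (simp add: w'_def)
qed

lemma TM_cong_AE: "AE x in lborel. u x = v x \<Longrightarrow> TM \<alpha> \<beta> u = TM \<alpha> \<beta> v"
  unfolding TM_def nn_integral_completion by (rule nn_integral_cong_AE) auto

text \<open>The truncated squares are dominated by w^2 and vanish at each point for large n. For a
  single function the singular part can therefore be made as small as desired, at the price of an N
  that depends on the function.\<close>

lemma tail_square_small:
  fixes w :: "R4 \<Rightarrow> real"
  assumes [measurable]: "w \<in> borel_measurable borel" and w: "nn_integral_sq w < \<infinity>" and d: "d > 0"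
  obtains N where "N \<ge> 0" "(\<integral>\<^sup>+x. ennreal ((max 0 (\<bar>w x\<bar> - N))^2) \<partial>lborel) \<le> ennreal d"
proof -
  have "(\<lambda>n. \<integral>\<^sup>+x. ennreal ((max 0 (\<bar>w x\<bar> - real n))^2) \<partial>lborel) \<longlonglongrightarrow> (\<integral>\<^sup>+(x::R4). 0 \<partial>lborel)"
  proof (rule nn_integral_dominated_convergence[OF _ _ _ _ w])
    show "AE x in lborel. ennreal ((max 0 (\<bar>w x\<bar> - real n))^2) \<le> ennreal ((w x)^2)" for n
    proof (rule AE_I2, rule ennreal_leI)
      fix x show "(max 0 (\<bar>w x\<bar> - real n))^2 \<le> (w x)^2"
        using power_mono[of "max 0 (\<bar>w x\<bar> - real n)" "\<bar>w x\<bar>" 2] by simp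
    qed
    show "AE x in lborel. (\<lambda>n. ennreal ((max 0 (\<bar>w x\<bar> - real n))^2)) \<longlonglongrightarrow> 0"
    proof (rule AE_I2, rule tendsto_eventually)
      fix x
      show "\<forall>\<^sub>F n in sequentially. ennreal ((max 0 (\<bar>w x\<bar> - real n))^2) = 0"
        using eventually_ge_at_top[of "nat \<lceil>\<bar>w x\<bar>\<rceil>"]
      proof eventually_elim
        case (elim n)
        then have "\<bar>w x\<bar> - real n \<le> 0" by linarith
        then show ?case by simp
      qed
    qed
  qed measurable
  then have "(\<lambda>n. \<integral>\<^sup>+x. ennreal ((max 0 (\<bar>w x\<bar> - real n))^2) \<partial>lborel) \<longlonglongrightarrow> 0" by simp
  from order_tendstoD(2)[OF this, of "ennreal d"] d
  obtain n where "(\<integral>\<^sup>+x. ennreal ((max 0 (\<bar>w x\<bar> - real n))^2) \<partial>lborel) < ennreal d"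
    by (auto simp: eventually_sequentially)
  then show thesis by (intro that[of "real n"]) auto
qed

text \<open>The rate a is placed strictly between \<alpha>/(1 - \<beta>/4) and 32 pi^2/d^2, for
  which the hypothesis leaves room; if d = 0 only the lower constraint remains.\<close>

lemma TM_uniform_bound:
  assumes \<alpha>: "\<alpha> > 0" and \<beta>: "0 \<le> \<beta>" "\<beta> < 4" and N: "N \<ge> 0" and d: "d \<ge> 0" and U: "U \<ge> 0"
    and \<alpha>d: "\<alpha> * d^2 < 32 * pi^2 * (1 - \<beta>/4)"
  obtains B where "B < \<infinity>"
    "\<And>u w. u \<in> borel_measurable borel \<Longrightarrow> w \<in> borel_measurable borel \<Longrightarrow> weak_laplacian u w
       \<Longrightarrow> nn_integral_sq u \<le> ennreal U \<Longrightarrow> nn_integral_sq w < \<infinity>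
       \<Longrightarrow> (\<integral>\<^sup>+x. ennreal ((max 0 (\<bar>w x\<bar> - N))^2) \<partial>lborel) \<le> ennreal (d^2) \<Longrightarrow> TM \<alpha> \<beta> u \<le> B"
proof -
  define b where "b = 1 - \<beta>/4"
  have b: "b > 0" using \<beta> by (simp add: b_def)
  obtain a where a: "a > 0" "a * b > \<alpha>" "a * d^2 < 32 * pi^2"
  proof (cases "d = 0")
    case True
    show thesis
      by (rule that[of "(\<alpha> + 1) / b"]) (use True \<alpha> b in \<open>auto simp: field_simps add_pos_pos\<close>)
  next
    case False
    then have dp: "d^2 > 0" by simp
    have "\<alpha> / b < 32 * pi^2 / d^2"
      using \<alpha>d b dp by (simp add: b_def[symmetric] field_simps)
    then obtain a where "\<alpha> / b < a" "a < 32 * pi^2 / d^2" using dense by blast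
    then show thesis
      using \<alpha> b dp by (intro that[of a]) (auto simp: field_simps intro: less_trans[OF divide_pos_pos])
  qed
  obtain s0 where s0: "s0 > 0"
    "\<And>u w s. u \<in> borel_measurable borel \<Longrightarrow> w \<in> borel_measurable borel \<Longrightarrow> weak_laplacian u w
       \<Longrightarrow> nn_integral_sq u \<le> ennreal U \<Longrightarrow> nn_integral_sq w < \<infinity>
       \<Longrightarrow> (\<integral>\<^sup>+x. ennreal ((max 0 (\<bar>w x\<bar> - N))^2) \<partial>lborel) \<le> ennreal (d^2) \<Longrightarrow> s \<ge> s0
       \<Longrightarrow> emeasure lborel {x. s \<le> \<bar>u x\<bar>} \<le> ennreal (2 * exp (- a * s^2))"
    by (rule level_set_decay[OF a(1) d N U a(3)]) (rule that)
  obtain B where B: "B < \<infinity>"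
    "\<And>u. u \<in> borel_measurable borel \<Longrightarrow> nn_integral_sq u \<le> ennreal U
      \<Longrightarrow> (\<forall>s\<ge>s0. emeasure lborel {x. s \<le> \<bar>u x\<bar>} \<le> ennreal (2 * exp (- a * s^2))) \<Longrightarrow> TM \<alpha> \<beta> u \<le> B"
    by (rule TM_le_of_decay[where ?s0.0 = s0, OF \<alpha> \<beta> a(2)[unfolded b_def] U]) (rule that)
  show thesis
    by (rule that[OF B(1)], rule B(2), assumption, assumption, intro allI impI, rule s0(2))
qed

lemma TM_finite:
  assumes \<alpha>: "\<alpha> > 0" and \<beta>: "0 \<le> \<beta>" "\<beta> < 4" and u: "u \<in> W22"
  shows "TM \<alpha> \<beta> u < \<infinity>"
proof -
  obtain g h where gh: "W22_derivs u g h" using u by (auto simp: W22_def)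
  obtain u' w' where uw: "u' \<in> borel_measurable borel" "w' \<in> borel_measurable borel"
    "AE x in lborel. u x = u' x" "nn_integral_sq u' < \<infinity>"
    "nn_integral_sq w' < \<infinity>" "weak_laplacian u' w'"
    by (rule W22_weak_laplacian[OF gh]) (rule that)
  \<comment> \<open>Chosen so that \<alpha> d^2 = 1 - \<beta>/4, which lies below the threshold
    because pi^2 > 1.\<close>
  define d where "d = sqrt ((1 - \<beta>/4) / \<alpha>)"
  have d: "d > 0" "\<alpha> * d^2 < 32 * pi^2 * (1 - \<beta>/4)"
  proof -
    have "1 < pi^2" using pi_gt3 by (simp add: one_less_power)
    then show "d > 0" "\<alpha> * d^2 < 32 * pi^2 * (1 - \<beta>/4)" using \<alpha> \<beta> by (auto simp: d_def)
  qed
  obtain N where N: "N \<ge> 0" "(\<integral>\<^sup>+x. ennreal ((max 0 (\<bar>w' x\<bar> - N))^2) \<partial>lborel) \<le> ennreal (d^2)"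
    using tail_square_small[OF uw(2,5), of "d^2"] d by auto
  obtain U where U: "nn_integral_sq u' = ennreal U" "U \<ge> 0"
    using uw(4) by (auto simp: less_top_ennreal)
  have "TM \<alpha> \<beta> u' < \<infinity>"
    by (rule TM_uniform_bound[OF \<alpha> \<beta> N(1) less_imp_le[OF d(1)] U(2) d(2)])
      (use uw N U in \<open>blast intro: order_le_less_trans eq_refl\<close>)
  then show ?thesis using TM_cong_AE[OF uw(3)] by simp
qed

text \<open>\<open>ennreal\<close> sends the nonpositive integrand to 0; this covers the exponents
  \<alpha> \<le> 0, which part (ii) includes.\<close>

lemma TM_nonpos: "\<alpha> \<le> 0 \<Longrightarrow> TM \<alpha> \<beta> u = 0"
proof -
  assume "\<alpha> \<le> 0"
  then have "(exp (\<alpha> * (u x)^2) - 1) / (norm x powr \<beta>) \<le> 0" for x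
    by (intro divide_nonpos_nonneg) (auto simp: mult_nonpos_nonneg)
  then show ?thesis by (simp add: TM_def ennreal_neg)
qed

lemma TM_subcritical:
  assumes \<beta>: "0 \<le> \<beta>" "\<beta> < 4" and \<tau>: "\<tau> > 0" and \<sigma>: "\<sigma> > 0" and \<alpha>: "\<alpha> < 32 * pi^2 * (1 - \<beta>/4)"
  shows "(SUP u\<in>admissible \<tau> \<sigma>. TM \<alpha> \<beta> u) < \<infinity>"
proof (cases "\<alpha> > 0")
  case False
  then have "(SUP u\<in>admissible \<tau> \<sigma>. TM \<alpha> \<beta> u) \<le> 0" by (intro SUP_least) (simp add: TM_nonpos)
  then show ?thesis by simp
next
  case \<alpha>0: True
  \<comment> \<open>The energy density is at least \<sigma> u^2, so the constraint bounds the
    integral of u^2 by 1/\<sigma>.\<close>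
  define U where "U = 1 / \<sigma>"
  have U: "U \<ge> 0" using \<sigma> by (simp add: U_def)
  \<comment> \<open>The constraint bounds the L^2 norm of the Laplacian by 1, so N = 0 and d = 1
    serve all admissible functions at once.\<close>
  have "\<alpha> * 1^2 < 32 * pi^2 * (1 - \<beta>/4)" using \<alpha> by simp
  then obtain B where B: "B < \<infinity>"
    "\<And>u w. u \<in> borel_measurable borel \<Longrightarrow> w \<in> borel_measurable borel \<Longrightarrow> weak_laplacian u w
       \<Longrightarrow> nn_integral_sq u \<le> ennreal U \<Longrightarrow> nn_integral_sq w < \<infinity>
       \<Longrightarrow> (\<integral>\<^sup>+x. ennreal ((max 0 (\<bar>w x\<bar> - 0))^2) \<partial>lborel) \<le> ennreal (1^2) \<Longrightarrow> TM \<alpha> \<beta> u \<le> B"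
    by (rule TM_uniform_bound[OF \<alpha>0 \<beta> order_refl zero_le_one U]) (rule that)
  have "TM \<alpha> \<beta> u \<le> B" if "u \<in> admissible \<tau> \<sigma>" for u
  proof -
    obtain g h where gh: "W22_derivs u g h"
      "(\<integral>\<^sup>+ x. ennreal ((\<Sum>i\<in>UNIV. h i i x)^2 + \<tau> * (\<Sum>i\<in>UNIV. (g i x)^2) + \<sigma> * (u x)^2) \<partial>lebesgue) \<le> 1"
      using \<open>u \<in> admissible \<tau> \<sigma>\<close> unfolding admissible_def by blast
    obtain u' w' where uw: "u' \<in> borel_measurable borel" "w' \<in> borel_measurable borel"
      "AE x in lborel. u x = u' x" "AE x in lborel. (\<Sum>i\<in>UNIV. h i i x) = w' x" 
      "nn_integral_sq u' < \<infinity>"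
      "nn_integral_sq w' < \<infinity>" "weak_laplacian u' w'"
      by (rule W22_weak_laplacian[OF gh(1)]) (rule that)
    note [measurable] = uw(1,2)
    have "nn_integral_sq u' \<le> (\<integral>\<^sup>+ x. ennreal U * ennreal ((\<Sum>i\<in>UNIV. h i i x)^2 + \<tau> * (\<Sum>i\<in>UNIV. (g i x)^2) + \<sigma> * (u x)^2) \<partial>lborel)"
    proof (rule nn_integral_mono_AE)
      show "AE x in lborel. ennreal ((u' x)^2) \<le> ennreal U * ennreal ((\<Sum>i\<in>UNIV. h i i x)^2 + \<tau> * (\<Sum>i\<in>UNIV. (g i x)^2) + \<sigma> * (u x)^2)"
        using uw(3)
      proof eventually_elim
        case (elim x)
        have "0 \<le> (\<Sum>i\<in>UNIV. h i i x)^2 + \<tau> * (\<Sum>i\<in>UNIV. (g i x)^2)" using \<tau> by (simp add: sum_nonneg)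
        then have "(u' x)^2 \<le> U * ((\<Sum>i\<in>UNIV. h i i x)^2 + \<tau> * (\<Sum>i\<in>UNIV. (g i x)^2) + \<sigma> * (u x)^2)"
          using elim \<sigma> by (simp add: U_def field_simps)
        from ennreal_leI[OF this] show ?case by (simp only: ennreal_mult'[OF U])
      qed
    qed
    also have "\<dots> = (\<integral>\<^sup>+ x. ennreal U * ennreal ((\<Sum>i\<in>UNIV. h i i x)^2 + \<tau> * (\<Sum>i\<in>UNIV. (g i x)^2) + \<sigma> * (u x)^2) \<partial>lebesgue)"
      by (simp add: nn_integral_completion)
    also have "\<dots> = ennreal U * (\<integral>\<^sup>+ x. ennreal ((\<Sum>i\<in>UNIV. h i i x)^2 + \<tau> * (\<Sum>i\<in>UNIV. (g i x)^2) + \<sigma> * (u x)^2) \<partial>lebesgue)"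
    proof (rule nn_integral_cmult)
      have [measurable]: "u \<in> borel_measurable lebesgue" "\<And>i. g i \<in> borel_measurable lebesgue" "\<And>i j. h i j \<in> borel_measurable lebesgue"
        using gh(1) by (auto simp: W22_derivs_def L2_def)
      show "(\<lambda>x. ennreal ((\<Sum>i\<in>UNIV. h i i x)^2 + \<tau> * (\<Sum>i\<in>UNIV. (g i x)^2) + \<sigma> * (u x)^2)) \<in> borel_measurable lebesgue"
        by measurable
    qed
    also have "\<dots> \<le> ennreal U * 1" by (rule mult_left_mono[OF gh(2)]) simp
    finally have u2: "nn_integral_sq u' \<le> ennreal U" by simp
    have "(\<integral>\<^sup>+x. ennreal ((max 0 (\<bar>w' x\<bar> - 0))^2) \<partial>lborel) \<le> (\<integral>\<^sup>+ x. ennreal ((\<Sum>i\<in>UNIV. h i i x)^2 + \<tau> * (\<Sum>i\<in>UNIV. (g i x)^2) + \<sigma> * (u x)^2) \<partial>lborel)"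
    proof (rule nn_integral_mono_AE)
      show "AE x in lborel. ennreal ((max 0 (\<bar>w' x\<bar> - 0))^2) \<le> ennreal ((\<Sum>i\<in>UNIV. h i i x)^2 + \<tau> * (\<Sum>i\<in>UNIV. (g i x)^2) + \<sigma> * (u x)^2)"
        using uw(4)
      proof eventually_elim
        case (elim x)
        have "0 \<le> \<tau> * (\<Sum>i\<in>UNIV. (g i x)^2) + \<sigma> * (u x)^2" using \<tau> \<sigma> by (simp add: sum_nonneg)
        then show ?case using elim by (intro ennreal_leI) simp
      qed
    qed
    also have "\<dots> \<le> ennreal (1^2)" using gh(2) by (simp add: nn_integral_completion)
    finally have w2: "(\<integral>\<^sup>+x. ennreal ((max 0 (\<bar>w' x\<bar> - 0))^2) \<partial>lborel) \<le> ennreal (1^2)" .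
    have "TM \<alpha> \<beta> u = TM \<alpha> \<beta> u'" by (rule TM_cong_AE[OF uw(3)])
    also have "\<dots> \<le> B"
      by (rule B(2)[OF uw(1,2,7) u2 uw(6) w2])
    finally show ?thesis .
  qed
  then have "(SUP u\<in>admissible \<tau> \<sigma>. TM \<alpha> \<beta> u) \<le> B" by (rule SUP_least)
  then show ?thesis using B(1) by (rule order_le_less_trans)
qed

subsection \<open>Integration by parts for continuously differentiable functions\<close>

lemma integral_translate:
  fixes f :: "R4 \<Rightarrow> real"
  assumes [measurable]: "f \<in> borel_measurable borel"
  shows "(\<integral>x. f (c + x) \<partial>lborel) = (\<integral>x. f x \<partial>lborel)"
proof -
  have "(\<integral>x. f x \<partial>lborel) = (\<integral>x. f x \<partial>distr lborel borel ((+) c))"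
    by (simp add: lborel_distr_plus)
  also have "\<dots> = (\<integral>x. f (c + x) \<partial>lborel)"
    by (subst integral_distr) auto
  finally show ?thesis by simp
qed

lemma cpartial_line_derivative:
  assumes "\<And>x. f differentiable (at x)"
  shows "((\<lambda>t. f (t *\<^sub>R axis i 1 + x)) has_real_derivative cpartial i f (t *\<^sub>R axis i 1 + x)) (at t)"
proof -
  let ?D = "frechet_derivative f (at (t *\<^sub>R axis i 1 + x))"
  have D: "(f has_derivative ?D) (at (t *\<^sub>R axis i 1 + x))"
    using assms frechet_derivative_works by blast
  have "((\<lambda>t. t *\<^sub>R axis i 1 + x) has_derivative (\<lambda>h. h *\<^sub>R axis i 1)) (at t)"
    by (auto intro!: derivative_eq_intros)
  from has_derivative_compose[OF this D]
  have "((\<lambda>t. f (t *\<^sub>R axis i 1 + x)) has_derivative (\<lambda>h. ?D (h *\<^sub>R axis i 1))) (at t)" .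
  moreover have "?D (h *\<^sub>R axis i 1) = cpartial i f (t *\<^sub>R axis i 1 + x) * h" for h
    using linear_cmul[OF has_derivative_linear[OF D]] by (simp add: cpartial_def mult.commute)
  ultimately show ?thesis by (simp add: has_field_derivative_def)
qed

text \<open>Translation invariance makes every difference quotient integrate to 0, and the quotients
  converge to the partial derivative. By the mean value theorem they are values of that derivative
  at nearby points, hence dominated by a constant on one fixed ball.\<close>

lemma integral_cpartial_eq_0:
  fixes f :: "R4 \<Rightarrow> real"
  assumes d: "\<And>x. f differentiable (at x)" and c: "continuous_on UNIV (cpartial i f)"
    and R: "\<And>x. norm x > R \<Longrightarrow> f x = 0" "\<And>x. norm x > R \<Longrightarrow> cpartial i f x = 0"
  shows "(\<integral>x. cpartial i f x \<partial>lborel) = 0"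
proof -
  have cf: "continuous_on UNIV f"
    using d by (meson continuous_at_imp_continuous_on differentiable_imp_continuous_within)
  have [measurable]: "f \<in> borel_measurable borel" "cpartial i f \<in> borel_measurable borel"
    using cf c by (auto intro: borel_measurable_continuous_onI)
  obtain K where K: "K \<ge> 0" "\<And>x. \<bar>cpartial i f x\<bar> \<le> K * indicator (cball 0 R) x"
    using continuous_bounded_support[where R = R, OF c] R(2) by blast
  obtain K' where K': "\<And>x. \<bar>f x\<bar> \<le> K' * indicator (cball 0 R) x"
    using continuous_bounded_support[where R = R, OF cf] R(1) by blast
  have intf: "integrable lborel f" by (rule integrable_bounded_support[OF _ K']) simp
  \<comment> \<open>Steps of size at most 1 keep all difference quotients supported in the ball of
    radius R + 1.\<close>
  define h where "h = (\<lambda>n::nat. inverse (real (Suc n)))"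
  have h: "0 < h n" "h n \<le> 1" for n by (auto simp: h_def inverse_eq_divide)
  have h0: "filterlim h (at 0) sequentially"
    unfolding h_def filterlim_at using LIMSEQ_inverse_real_of_nat by (auto simp: eventually_sequentially)
  define q where "q = (\<lambda>n x. (f (h n *\<^sub>R axis i 1 + x) - f x) / h n)"
  have [measurable]: "q n \<in> borel_measurable borel" for n unfolding q_def by measurable
  have lim: "(\<lambda>n. q n x) \<longlonglongrightarrow> cpartial i f x" for x
  proof -
    have "((\<lambda>t. (f (t *\<^sub>R axis i 1 + x) - f x) / t) \<longlongrightarrow> cpartial i f x) (at 0)"
      using cpartial_line_derivative[OF d, of i x 0] by (simp add: DERIV_def)
    from filterlim_compose[OF this h0] show ?thesis by (simp add: q_def)
  qed
  have bd: "\<bar>q n x\<bar> \<le> K * indicator (cball 0 (R+1)) x" for n x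
  proof -
    obtain z where z: "0 < z" "z < h n"
      "f (h n *\<^sub>R axis i 1 + x) - f (0 *\<^sub>R axis i 1 + x) = (h n - 0) * cpartial i f (z *\<^sub>R axis i 1 + x)"
      using MVT2[OF h(1)[of n], of "\<lambda>t. f (t *\<^sub>R axis i 1 + x)" "\<lambda>t. cpartial i f (t *\<^sub>R axis i 1 + x)"]
        cpartial_line_derivative[OF d] by blast
    then have qz: "q n x = cpartial i f (z *\<^sub>R axis i 1 + x)" using h(1)[of n] by (simp add: q_def)
    show ?thesis
    proof (cases "norm x \<le> R + 1")
      case True
      have "\<bar>q n x\<bar> \<le> K" unfolding qz
        using K(2)[of "z *\<^sub>R axis i 1 + x"] K(1)
        by (cases "z *\<^sub>R axis i 1 + x \<in> cball 0 R") auto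
      then show ?thesis using True by simp
    next
      case False
      have "norm x \<le> norm (z *\<^sub>R axis i 1 + x) + norm (z *\<^sub>R axis i (1::real))"
        using norm_triangle_ineq4[of "z *\<^sub>R axis i 1 + x" "z *\<^sub>R axis i (1::real)"] by simp
      moreover have "norm (z *\<^sub>R axis i (1::real) :: R4) \<le> 1" using z(1,2) h(2)[of n] by simp
      ultimately have "norm (z *\<^sub>R axis i 1 + x) > R" using False by linarith
      then show ?thesis unfolding qz using R(2) K(1) by simp
    qed
  qed
  have "(\<lambda>n. \<integral>x. q n x \<partial>lborel) \<longlonglongrightarrow> (\<integral>x. cpartial i f x \<partial>lborel)"
  proof (rule integral_dominated_convergence)
    show "integrable lborel (\<lambda>x::R4. K * indicator (cball 0 (R+1)) x)"
      using emeasure_bounded_finite[OF bounded_cball, of "0::R4" "R+1"]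
      by (intro integrable_mult_right integrable_real_indicator) auto
    show "AE x in lborel. (\<lambda>n. q n x) \<longlonglongrightarrow> cpartial i f x" by (intro AE_I2 lim)
    show "AE x in lborel. norm (q n x) \<le> K * indicator (cball 0 (R+1)) x" for n
      using bd by (intro AE_I2) simp
  qed measurable
  moreover have "(\<integral>x. q n x \<partial>lborel) = 0" for n
  proof -
    have i2: "integrable lborel (\<lambda>x. f (h n *\<^sub>R axis i 1 + x))"
    proof (rule integrable_bounded_support)
      let ?v = "h n *\<^sub>R axis i (1::real)"
      fix x
      have v: "dist (- ?v) x = norm (?v + x)"
        using norm_minus_cancel[of "?v + x"] by (simp add: dist_norm)
      show "\<bar>f (?v + x)\<bar> \<le> \<bar>K'\<bar> * indicator (cball (- ?v) R) x"
        using K'[of "?v + x"] by (cases "norm (?v + x) \<le> R") (auto simp: v)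
    qed measurable
    have "(\<integral>x. q n x \<partial>lborel) = ((\<integral>x. f (h n *\<^sub>R axis i 1 + x) \<partial>lborel) - (\<integral>x. f x \<partial>lborel)) / h n"
      unfolding q_def using intf i2 by simp
    then show ?thesis using integral_translate[of f "h n *\<^sub>R axis i 1"] by simp
  qed
  ultimately show ?thesis using LIMSEQ_unique[OF _ tendsto_const] by simp
qed

text \<open>The product with a test function has bounded support and a continuous i-th partial
  derivative of integral 0; by the product rule this is integration by parts.\<close>

lemma weak_partial_C1:
  assumes d: "\<And>x. f differentiable (at x)" and c: "continuous_on UNIV (cpartial i f)"
  shows "weak_partial f i (cpartial i f)"
  unfolding weak_partial_def
proof (intro allI impI)
  fix \<phi> assume t: "test_fun \<phi>"
  have td: "\<phi> differentiable (at x)" for x using t by (simp add: test_fun_def smooth_differentiable)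
  have c\<phi>: "continuous_on UNIV \<phi>" "continuous_on UNIV (cpartial i \<phi>)"
    using t by (auto intro: test_fun_continuous_on test_fun_cpartial)
  have cf: "continuous_on UNIV f"
    using d by (meson continuous_at_imp_continuous_on differentiable_imp_continuous_within)
  obtain R1 where R1: "\<And>x. norm x > R1 \<Longrightarrow> \<phi> x = 0"
    using t unfolding test_fun_def bounded_iff by (metis (mono_tags, lifting) mem_Collect_eq not_le)
  obtain R2 where R2: "\<And>x. norm x > R2 \<Longrightarrow> cpartial i \<phi> x = 0"
    using test_fun_cpartial[OF t, of i] unfolding test_fun_def bounded_iff by (metis (mono_tags, lifting) mem_Collect_eq not_le)
  define R where "R = max R1 R2"
  have R: "\<phi> x = 0" "cpartial i \<phi> x = 0" if "norm x > R" for x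
    using that R1 R2 by (auto simp: R_def)
  have p: "cpartial i (\<lambda>x. f x * \<phi> x) = (\<lambda>x. f x * cpartial i \<phi> x + cpartial i f x * \<phi> x)"
  proof
    fix x
    have "(f has_derivative frechet_derivative f (at x)) (at x)" "(\<phi> has_derivative frechet_derivative \<phi> (at x)) (at x)"
      using d td by (simp_all add: frechet_derivative_works[symmetric])
    from cpartial_eq[OF has_derivative_mult[OF this]]
    show "cpartial i (\<lambda>x. f x * \<phi> x) x = f x * cpartial i \<phi> x + cpartial i f x * \<phi> x"
      by (simp add: cpartial_def)
  qed
  have int: "integrable lborel k" and meas: "k \<in> borel_measurable lborel"
    if k: "continuous_on UNIV k" "\<And>x. norm x > R \<Longrightarrow> k x = 0" for k :: "R4 \<Rightarrow> real"
  proof -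
    obtain K where "\<And>x. \<bar>k x\<bar> \<le> K * indicator (cball 0 R) x"
      using continuous_bounded_support[where R = R, OF k(1)] k(2) by blast
    then show "integrable lborel k"
      by (intro integrable_bounded_support[of k K 0 R] borel_measurable_continuous_onI k)
    show "k \<in> borel_measurable lborel" using borel_measurable_continuous_onI[OF k(1)] by simp
  qed
  have 1: "continuous_on UNIV (\<lambda>x. f x * cpartial i \<phi> x)" "\<And>x. norm x > R \<Longrightarrow> f x * cpartial i \<phi> x = 0"
    using cf c\<phi> R by (auto intro: continuous_on_mult)
  have 2: "continuous_on UNIV (\<lambda>x. cpartial i f x * \<phi> x)" "\<And>x. norm x > R \<Longrightarrow> cpartial i f x * \<phi> x = 0"
    using c c\<phi> R by (auto intro: continuous_on_mult)
  have "(\<integral>x. cpartial i (\<lambda>x. f x * \<phi> x) x \<partial>lborel) = 0"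
  proof (rule integral_cpartial_eq_0)
    show "(\<lambda>x. f x * \<phi> x) differentiable (at x)" for x using d td by (intro differentiable_mult)
    show "continuous_on UNIV (cpartial i (\<lambda>x. f x * \<phi> x))"
      unfolding p by (intro continuous_on_add 1 2)
    show "f x * \<phi> x = 0" "cpartial i (\<lambda>x. f x * \<phi> x) x = 0" if "norm x > R" for x
      unfolding p using R[OF that] by simp_all
  qed
  then have "(\<integral>x. f x * cpartial i \<phi> x \<partial>lborel) = - (\<integral>x. cpartial i f x * \<phi> x \<partial>lborel)"
    unfolding p using int[OF 1] int[OF 2] by simp
  then show "(\<integral>x. f x * cpartial i \<phi> x \<partial>lebesgue) = - (\<integral>x. cpartial i f x * \<phi> x \<partial>lebesgue)"
    using meas[OF 1] meas[OF 2] by (simp add: integral_completion)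
qed

subsection \<open>Unboundedness above the critical exponent\<close>

text \<open>Exact evaluation is replaced by a majorant: it is enough that the radial density pi^2 s
  g lies below some H with a known primitive, whose values at 0 and at infinity give the
  bound.\<close>

lemma nn_integral_radial_le:
  fixes g :: "real \<Rightarrow> real"
  assumes [measurable]: "g \<in> borel_measurable borel"
    and F: "\<And>s. s \<ge> 0 \<Longrightarrow> (F has_real_derivative H s) (at s)" "(F \<longlongrightarrow> T) at_top"
    and [measurable]: "H \<in> borel_measurable borel"
    and H: "\<And>s. s \<ge> 0 \<Longrightarrow> 0 \<le> H s" "\<And>s. s > 0 \<Longrightarrow> pi^2 * s * g s \<le> H s"
  shows "(\<integral>\<^sup>+x. ennreal (g ((x::R4) \<bullet> x)) \<partial>lborel) \<le> ennreal (T - F 0)"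
proof -
  have "(\<integral>\<^sup>+x. ennreal (g ((x::R4) \<bullet> x)) \<partial>lborel) = (\<integral>\<^sup>+x. ennreal (g ((x-(0::R4)) \<bullet> (x-0))) \<partial>lborel)" by simp
  also have "\<dots> = (\<integral>\<^sup>+s. ennreal (g s) * (ennreal (pi^2 * s) * indicator {0..} s) \<partial>lborel)"
    by (rule nn_integral_radial) simp
  also have "\<dots> \<le> (\<integral>\<^sup>+s. ennreal (H s) * indicator {0..} s \<partial>lborel)"
  proof (rule nn_integral_mono)
    fix s :: real
    show "ennreal (g s) * (ennreal (pi^2 * s) * indicator {0..} s) \<le> ennreal (H s) * indicator {0..} s"
    proof (cases "s > 0")
      case True
      have "ennreal (g s) * ennreal (pi^2 * s) = ennreal (pi^2 * s * g s)"
        using True by (simp add: ennreal_mult''[symmetric] mult.commute)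
      also have "\<dots> \<le> ennreal (H s)" using H(2)[OF True] by (rule ennreal_leI)
      finally show ?thesis using True by simp
    next
      case False then show ?thesis by (cases "s = 0") auto
    qed
  qed
  also have "\<dots> = ennreal (T - F 0)"
    by (rule nn_integral_FTC_atLeast) (use F H in auto)
  finally show ?thesis .
qed

lemma nn_integral_radial_le_rational:
  fixes g :: "real \<Rightarrow> real"
  assumes [measurable]: "g \<in> borel_measurable borel" and c: "c \<ge> 0"
    and g: "\<And>s. s > 0 \<Longrightarrow> s * g s \<le> c / (1+s)^2"
  shows "(\<integral>\<^sup>+x. ennreal (g ((x::R4) \<bullet> x)) \<partial>lborel) \<le> ennreal (pi^2 * c)"
proof -
  have "(\<integral>\<^sup>+x. ennreal (g ((x::R4) \<bullet> x)) \<partial>lborel) \<le> ennreal (0 - (- (pi^2 * c) / (1+0)))"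
  proof (rule nn_integral_radial_le)
    show "((\<lambda>s. - (pi^2 * c) / (1+s)) has_real_derivative pi^2 * (c / (1+s)^2)) (at s)" if "s \<ge> 0" for s
      using that by (auto intro!: derivative_eq_intros simp: power2_eq_square)
    show "((\<lambda>s. - (pi^2 * c) / (1+s)) \<longlongrightarrow> 0) at_top"
      by (intro tendsto_divide_0[OF tendsto_const] filterlim_at_top_imp_at_infinity filterlim_tendsto_add_at_top[OF tendsto_const] filterlim_ident)
    show "pi^2 * s * g s \<le> pi^2 * (c / (1+s)^2)" if "s > 0" for s
      using g[OF that] by (simp only: mult.assoc) (rule mult_left_mono, auto)
  qed (use c in auto)
  then show ?thesis by simp
qed

lemma L2_continuous_decay:
  fixes f :: "R4 \<Rightarrow> real"
  assumes f: "continuous_on UNIV f" and C: "\<And>x. \<bar>f x\<bar> \<le> C / (1 + x \<bullet> x)^2"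
  shows "L2 f"
proof -
  have [measurable]: "f \<in> borel_measurable borel" by (rule borel_measurable_continuous_onI[OF f])
  have "nn_integral_sq f \<le> (\<integral>\<^sup>+x. ennreal ((C / (1 + (x::R4) \<bullet> x)^2)^2) \<partial>lborel)"
  proof (rule nn_integral_mono, rule ennreal_leI)
    fix x show "(f x)^2 \<le> (C / (1 + x \<bullet> x)^2)^2"
      using power_mono[OF C[of x], of 2] by simp
  qed
  also have "\<dots> \<le> ennreal (pi^2 * C^2)"
  proof (rule nn_integral_radial_le_rational[where g = "\<lambda>s. (C / (1 + s)^2)^2"])
    fix s :: real assume s: "s > 0"
    have "s * (C / (1 + s)^2)^2 = C^2 / (1+s)^2 * (s / (1+s)^2)"
      by (simp add: power2_eq_square)
    also have "s / (1+s)^2 \<le> 1"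
      using s by (simp add: power2_eq_square algebra_simps add_pos_pos)
    then have "C^2 / (1+s)^2 * (s / (1+s)^2) \<le> C^2 / (1+s)^2 * 1"
      by (rule mult_left_mono) simp
    finally show "s * (C / (1 + s)^2)^2 \<le> C^2 / (1 + s)^2" by simp
  qed auto
  finally have "nn_integral_sq f < \<infinity>" by (rule order_le_less_trans) simp
  then have "integrable lborel (\<lambda>x. (f x)^2)" by (intro integrableI_bounded) auto
  then show ?thesis unfolding L2_def
    by (auto intro: integrable_completion[THEN iffD2] measurable_completion)
qed

lemma L2_cmult: "L2 f \<Longrightarrow> L2 (\<lambda>x. c * f x)"
  by (auto simp: L2_def power_mult_distrib)

lemma weak_partial_cmult: "weak_partial u i g \<Longrightarrow> weak_partial (\<lambda>x. c * u x) i (\<lambda>x. c * g x)"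
  by (simp add: weak_partial_def mult.assoc)

lemma W22_derivs_cmult:
  "W22_derivs u g h \<Longrightarrow> W22_derivs (\<lambda>x. c * u x) (\<lambda>i x. c * g i x) (\<lambda>i j x. c * h i j x)"
  by (auto simp: W22_derivs_def intro: L2_cmult weak_partial_cmult)

text \<open>A regularisation of $4\ln(1/|x|)$, the fundamental solution of the bilaplacian up to a factor,
  in terms of $s = |x|^2$. No cutoff is needed since it decays at infinity.\<close>

definition log_profile :: "real \<Rightarrow> real \<Rightarrow> real" where
  "log_profile e s = ln (1 + 1 / (s+e)^2)"

definition log_profile1 :: "real \<Rightarrow> real \<Rightarrow> real" where
  "log_profile1 e s = - 2 / ((s+e) * ((s+e)^2 + 1))"

definition log_profile2 :: "real \<Rightarrow> real \<Rightarrow> real" where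
  "log_profile2 e s = 2 * (3 * (s+e)^2 + 1) / ((s+e)^2 * ((s+e)^2 + 1)^2)"

lemma log_profile_deriv:
  assumes "e > 0" "s \<ge> 0"
  shows "(log_profile e has_real_derivative log_profile1 e s) (at s)"
proof -
  define t where "t = s + e"
  have t: "t > 0" using assms by (simp add: t_def)
  have "((\<lambda>s. ln (1 + 1 / (s+e)^2)) has_real_derivative (- (2 * t) / (t^2)^2) / (1 + 1 / t^2)) (at s)"
    using t unfolding t_def by (auto intro!: derivative_eq_intros simp: add_pos_pos power2_eq_square)
  also have "(- (2 * t) / (t^2)^2) / (1 + 1 / t^2) = - 2 / (t * (t^2 + 1))"
  proof -
    have "1 + 1 / t^2 = (t^2 + 1) / t^2" using t by (simp add: field_simps)
    then show ?thesis using t by (simp add: power2_eq_square)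
  qed
  finally show ?thesis by (simp add: log_profile_def[abs_def] log_profile1_def t_def)
qed

lemma log_profile1_deriv:
  assumes "e > 0" "s \<ge> 0"
  shows "(log_profile1 e has_real_derivative log_profile2 e s) (at s)"
proof -
  define t where "t = s + e"
  have t: "t > 0" using assms by (simp add: t_def)
  then have ne: "t * (t^2 + 1) \<noteq> 0" by (simp add: add_nonneg_eq_0_iff)
  have "((\<lambda>s. (s+e) * ((s+e)^2 + 1)) has_real_derivative 3 * t^2 + 1) (at s)"
    by (auto intro!: derivative_eq_intros simp: t_def power2_eq_square algebra_simps)
  from DERIV_cmult[OF DERIV_inverse'[OF this], of "-2"] ne
  have "((\<lambda>s. - 2 * inverse ((s+e) * ((s+e)^2 + 1))) has_real_derivative
      - 2 * - (inverse (t * (t^2 + 1)) * (3 * t^2 + 1) * inverse (t * (t^2 + 1)))) (at s)"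
    by (simp add: t_def)
  also have "- 2 * - (inverse (t * (t^2 + 1)) * (3 * t^2 + 1) * inverse (t * (t^2 + 1))) = log_profile2 e s"
    unfolding log_profile2_def t_def[symmetric] by (simp add: divide_inverse power2_eq_square mult_ac)
  finally show ?thesis by (simp add: log_profile1_def[abs_def] divide_inverse)
qed

text \<open>Everything follows from s + e \<ge> e (1 + s), valid since e < 1. The constants blow up
  as e tends to 0, which is harmless: these bounds serve membership in L^2, while the energies are
  estimated separately.\<close>

lemma log_profile_bounds:
  assumes e: "0 < e" "e < 1" and s: "s \<ge> 0"
  shows "\<bar>log_profile e s\<bar> \<le> (1 / e^2) / (1+s)^2"
    and "\<bar>log_profile1 e s\<bar> \<le> (2 / e^3) / (1+s)^3"
    and "\<bar>log_profile2 e s\<bar> \<le> (6 / e^4) / (1+s)^4"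
proof -
  define t where "t = s + e"
  have t: "t > 0" using e s by (simp add: t_def)
  have te: "e * (1+s) \<le> t" using e s mult_right_mono[of e 1 s] by (simp add: t_def algebra_simps)
  have es: "0 < e * (1+s)" using e s by simp
  have p: "c / t ^ n \<le> c / e ^ n / (1+s) ^ n" if "c \<ge> 0" for c n
  proof -
    have "c / t ^ n \<le> c / (e * (1+s)) ^ n"
      by (rule frac_le[OF _ _ _ power_mono]) (use that te es t e s in auto)
    then show ?thesis by (simp add: power_mult_distrib)
  qed
  have "log_profile e s \<le> 1 / t^2"
    using ln_add_one_self_le_self[of "1/t^2"] by (simp add: log_profile_def t_def)
  moreover have "log_profile e s \<ge> 0" using t by (simp add: log_profile_def)
  ultimately show "\<bar>log_profile e s\<bar> \<le> (1 / e^2) / (1+s)^2" using p[of 1 2] by simp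
  have "\<bar>log_profile1 e s\<bar> = 2 / (t * (t^2 + 1))"
    using t by (simp add: log_profile1_def t_def[symmetric] abs_mult)
  also have "\<dots> \<le> 2 / t ^ 3"
    using t by (intro divide_left_mono mult_pos_pos) (auto simp: power3_eq_cube power2_eq_square algebra_simps add_pos_pos)
  also have "\<dots> \<le> (2 / e^3) / (1+s)^3" using p[of 2 3] by simp
  finally show "\<bar>log_profile1 e s\<bar> \<le> (2 / e^3) / (1+s)^3" .
  have "\<bar>log_profile2 e s\<bar> = 2 * (3 * t^2 + 1) / (t^2 * (t^2 + 1)^2)"
    by (simp add: log_profile2_def t_def[symmetric] abs_mult)
  also have "\<dots> \<le> 6 * (t^2 + 1) / (t^2 * (t^2 + 1)^2)"
    by (intro divide_right_mono) auto
  also have "\<dots> = 6 / (t^2 * (t^2 + 1))"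
  proof -
    have "t^2 + 1 \<noteq> 0" using t by (simp add: add_nonneg_eq_0_iff)
    moreover have "6 * r / (q * r^2) = 6 / (q * r)" if "r \<noteq> 0" for q r :: real
      using that by (simp add: power2_eq_square)
    ultimately show ?thesis by blast
  qed
  also have "\<dots> \<le> 6 / t ^ 4"
  proof (rule divide_left_mono)
    have "t ^ 4 = t^2 * t^2" by (simp add: power4_eq_xxxx power2_eq_square)
    then show "t ^ 4 \<le> t^2 * (t^2 + 1)" by (simp add: algebra_simps)
    show "0 < t^2 * (t^2 + 1) * t ^ 4" using t by (intro mult_pos_pos) (auto simp: add_pos_pos)
  qed simp
  also have "\<dots> \<le> (6 / e^4) / (1+s)^4" using p[of 6 4] by simp
  finally show "\<bar>log_profile2 e s\<bar> \<le> (6 / e^4) / (1+s)^4" .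
qed

section \<open>The regularised logarithms as Sobolev functions\<close>

lemma vec_nth_mult_le: "\<bar>(x::R4) $ i * x $ j\<bar> \<le> x \<bullet> x"
proof -
  have "\<bar>x $ i\<bar> * \<bar>x $ j\<bar> \<le> norm x * norm x"
    by (intro mult_mono component_le_norm_cart) auto
  then show ?thesis by (simp add: abs_mult dot_square_norm power2_eq_square)
qed

definition log_fun :: "real \<Rightarrow> R4 \<Rightarrow> real" where
  "log_fun e x = log_profile e (x \<bullet> x)"

lemma log_fun_derivs:
  assumes e: "0 < e" "e < 1"
  shows "cpartial i (log_fun e) x = 2 * x $ i * log_profile1 e (x \<bullet> x)"
    and "cpartial j (cpartial i (log_fun e)) x = 4 * x $ j * x $ i * log_profile2 e (x \<bullet> x)
      + (if j = i then 2 * log_profile1 e (x \<bullet> x) else 0)"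
    and "(\<Sum>i\<in>UNIV. cpartial i (cpartial i (log_fun e)) x) = 4 * (x \<bullet> x) * log_profile2 e (x \<bullet> x) + 8 * log_profile1 e (x \<bullet> x)"
proof -
  have F: "s \<ge> 0 \<Longrightarrow> (log_profile e has_real_derivative log_profile1 e s) (at s)"
    and F': "s \<ge> 0 \<Longrightarrow> (log_profile1 e has_real_derivative log_profile2 e s) (at s)" for s
    using log_profile_deriv log_profile1_deriv e by auto
  show "cpartial i (log_fun e) x = 2 * x $ i * log_profile1 e (x \<bullet> x)"
    using cpartial_radial[of "log_profile e" "log_profile1 e (x \<bullet> x)" x 0 i] F
    by (simp add: log_fun_def[abs_def])
  show "cpartial j (cpartial i (log_fun e)) x = 4 * x $ j * x $ i * log_profile2 e (x \<bullet> x)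
      + (if j = i then 2 * log_profile1 e (x \<bullet> x) else 0)"
    using laplacian_radial(1)[of "log_profile e" "log_profile1 e" "log_profile2 e", OF F F', of j i 0 x]
    by (simp add: log_fun_def[abs_def])
  show "(\<Sum>i\<in>UNIV. cpartial i (cpartial i (log_fun e)) x) = 4 * (x \<bullet> x) * log_profile2 e (x \<bullet> x) + 8 * log_profile1 e (x \<bullet> x)"
    using laplacian_radial(2)[of "log_profile e" "log_profile1 e" "log_profile2 e", OF F F', of 0 x]
    by (simp add: log_fun_def[abs_def])
qed

lemma log_fun_differentiable:
  assumes e: "0 < e" "e < 1"
  shows "log_fun e differentiable (at x)" "cpartial i (log_fun e) differentiable (at x)"
proof -
  show "log_fun e differentiable (at x)"
    using radial_has_derivative[of "log_profile e" "log_profile1 e (x \<bullet> x)" x 0] log_profile_deriv[OF e(1), of "x \<bullet> x"]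
    by (auto simp: log_fun_def[abs_def] intro: differentiableI)
  have "(\<lambda>x::R4. 2 * x $ i) differentiable (at x)"
    by (intro differentiable_mult differentiable_const bounded_linear_imp_differentiable bounded_linear_vec_nth)
  moreover have "(\<lambda>x::R4. log_profile1 e (x \<bullet> x)) differentiable (at x)"
    using radial_has_derivative[of "log_profile1 e" "log_profile2 e (x \<bullet> x)" x 0] log_profile1_deriv[OF e(1), of "x \<bullet> x"]
    by (auto intro: differentiableI)
  ultimately have "(\<lambda>x. 2 * x $ i * log_profile1 e (x \<bullet> x)) differentiable (at x)"
    by (rule differentiable_mult)
  moreover have "cpartial i (log_fun e) = (\<lambda>x. 2 * x $ i * log_profile1 e (x \<bullet> x))"
    using log_fun_derivs(1)[OF e] by auto
  ultimately show "cpartial i (log_fun e) differentiable (at x)" by simp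
qed

text \<open>The function is twice continuously differentiable, so classical derivatives are weak
  ones. All of them decay at least like (1+s)^(-2), as a factor x_i or x_i x_j costs at most one
  power of 1 + s.\<close>

lemma log_fun_W22:
  assumes e: "0 < e" "e < 1"
  shows "W22_derivs (log_fun e) (\<lambda>i. cpartial i (log_fun e)) (\<lambda>i j. cpartial j (cpartial i (log_fun e)))"
proof -
  have c0: "continuous_on UNIV (log_fun e)" and c1: "continuous_on UNIV (cpartial i (log_fun e))" for i
    using log_fun_differentiable[OF e]
    by (meson continuous_at_imp_continuous_on differentiable_imp_continuous_within)+
  have c2: "continuous_on UNIV (cpartial j (cpartial i (log_fun e)))" for i j
  proof -
    have [continuous_intros]: "continuous_on UNIV (\<lambda>x::R4. log_profile1 e (x \<bullet> x))" "continuous_on UNIV (\<lambda>x::R4. log_profile2 e (x \<bullet> x))"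
      unfolding log_profile1_def log_profile2_def using e
      by (auto intro!: continuous_intros simp: add_nonneg_eq_0_iff power2_eq_square[symmetric])
    have "cpartial j (cpartial i (log_fun e)) = (\<lambda>x. 4 * x $ j * x $ i * log_profile2 e (x \<bullet> x)
      + (if j = i then 2 * log_profile1 e (x \<bullet> x) else 0))"
      using log_fun_derivs(2)[OF e] by (intro ext)
    then show ?thesis by (cases "j = i") (auto intro!: continuous_intros)
  qed
  have "L2 (log_fun e)"
    by (rule L2_continuous_decay[OF c0, of "1 / e^2"]) (use log_profile_bounds(1)[OF e] in \<open>simp add: log_fun_def\<close>)
  moreover have "L2 (cpartial i (log_fun e))" for i
  proof (rule L2_continuous_decay[OF c1, of _ "4 / e^3"])
    fix x :: R4
    define s where "s = x \<bullet> x"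
    have s: "s \<ge> 0" by (simp add: s_def)
    have "\<bar>x $ i\<bar> \<le> norm x" by (rule component_le_norm_cart)
    also have "norm x \<le> 1 + s"
      using zero_le_power2[of "norm x - 1/2"] by (simp add: s_def dot_square_norm power2_diff) (simp add: power2_eq_square)
    finally have "\<bar>cpartial i (log_fun e) x\<bar> \<le> (2 * (1+s)) * ((2 / e^3) / (1+s)^3)"
      unfolding log_fun_derivs(1)[OF e] abs_mult s_def[symmetric]
      by (intro mult_mono log_profile_bounds e s) (use s in auto)
    also have "(2 * (1+s)) * ((2 / e^3) / (1+s)^3) = (4 / e^3) / (1+s)^2"
    proof -
      have eq: "(2 * r) * ((2 / e^3) / r^3) = (4 / e^3) / r^2" if "r \<noteq> 0" for r
        using that by (simp add: power3_eq_cube power2_eq_square)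
      show ?thesis by (rule eq) (use s in simp)
    qed
    finally show "\<bar>cpartial i (log_fun e) x\<bar> \<le> (4 / e^3) / (1 + x \<bullet> x)^2" by (simp add: s_def)
  qed
  moreover have "L2 (cpartial j (cpartial i (log_fun e)))" for i j
  proof (rule L2_continuous_decay[OF c2, of _ _ "24 / e^4 + 4 / e^3"])
    fix x :: R4
    define s where "s = x \<bullet> x"
    have s: "s \<ge> 0" by (simp add: s_def)
    have "\<bar>4 * x $ j * x $ i * log_profile2 e s\<bar> \<le> (4 * (1+s)) * ((6 / e^4) / (1+s)^4)"
      unfolding abs_mult[of _ "log_profile2 e s"]
    proof (rule mult_mono[OF _ log_profile_bounds(3)[OF e s]])
      show "\<bar>4 * x $ j * x $ i\<bar> \<le> 4 * (1 + s)"
        using vec_nth_mult_le[of x j i] by (simp add: s_def abs_mult)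
    qed (use s in auto)
    also have "(4 * (1+s)) * ((6 / e^4) / (1+s)^4) = (24 / e^4) / (1+s)^3"
    proof -
      have eq: "(4 * r) * ((6 / e^4) / r^4) = (24 / e^4) / r^3" if "r \<noteq> 0" for r
        using that by (simp add: power4_eq_xxxx power3_eq_cube)
      show ?thesis by (rule eq) (use s in simp)
    qed
    also have "\<dots> \<le> (24 / e^4) / (1+s)^2"
      using s e by (intro divide_left_mono power_increasing mult_pos_pos) auto
    finally have 1: "\<bar>4 * x $ j * x $ i * log_profile2 e s\<bar> \<le> (24 / e^4) / (1+s)^2" .
    have "\<bar>if j = i then 2 * log_profile1 e s else 0\<bar> \<le> 2 * ((2 / e^3) / (1+s)^3)"
    proof -
      define B where "B = (2 / e^3) / (1+s)^3"
      have "\<bar>log_profile1 e s\<bar> \<le> B" unfolding B_def by (rule log_profile_bounds(2)[OF e s])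
      then show ?thesis unfolding B_def[symmetric] by auto
    qed
    also have "\<dots> = (4 / e^3) / (1+s)^3" by simp
    also have "\<dots> \<le> (4 / e^3) / (1+s)^2"
      using s e by (intro divide_left_mono power_increasing mult_pos_pos) auto
    finally have 2: "\<bar>if j = i then 2 * log_profile1 e s else 0\<bar> \<le> (4 / e^3) / (1+s)^2" .
    show "\<bar>cpartial j (cpartial i (log_fun e)) x\<bar> \<le> (24 / e^4 + 4 / e^3) / (1 + x \<bullet> x)^2"
      unfolding log_fun_derivs(2)[OF e] s_def[symmetric] add_divide_distrib
      using 1 2 abs_triangle_ineq by (meson add_mono order_trans)
  qed
  ultimately show ?thesis
    unfolding W22_derivs_def by (auto intro!: weak_partial_C1 log_fun_differentiable[OF e] c1 c2)
qed

text \<open>For s well between e and 1 the Laplacian is close to -8/s, and 64 pi^2/s integrated over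
  e < s < 1 gives 32 pi^2 ln(1/e^2). The point is that this coefficient is exact and the remainder
  does not depend on e.\<close>

lemma nn_integral_laplacian_log_fun_le:
  assumes e: "0 < e" "e < 1"
  shows "(\<integral>\<^sup>+x. ennreal ((4 * ((x::R4) \<bullet> x) * log_profile2 e (x \<bullet> x) + 8 * log_profile1 e (x \<bullet> x))^2) \<partial>lborel)
    \<le> ennreal (32 * pi^2 * ln (1 + 1 / e^2) + 672 * pi^2)"
proof -
  \<comment> \<open>With t = s + e the function \<open>log_profile1\<close> is -2/(t (t^2+1)), so
    the majorant 64/(t (t^2+1)) is the derivative of -32 times \<open>log_profile\<close>. The other
    two terms integrate to 384 and 288 for every e, with sum 672.\<close>
  define F where "F = (\<lambda>s. pi^2 * (- 32 * log_profile e s - 384 * e * (1 / (s+e)) - 288 * e^2 * (1 / (s+e))^2))"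
  define H where "H = (\<lambda>s. pi^2 * (64 / ((s+e) * ((s+e)^2 + 1)) + 384 * e / (s+e)^2 + 576 * e^2 / (s+e)^3))"
  have "(\<integral>\<^sup>+x. ennreal ((4 * ((x::R4) \<bullet> x) * log_profile2 e (x \<bullet> x) + 8 * log_profile1 e (x \<bullet> x))^2) \<partial>lborel)
    \<le> ennreal (0 - F 0)"
  proof (rule nn_integral_radial_le[where g = "\<lambda>s. (4 * s * log_profile2 e s + 8 * log_profile1 e s)^2" and H = H])
    show "(\<lambda>s. (4 * s * log_profile2 e s + 8 * log_profile1 e s)^2) \<in> borel_measurable borel"
      unfolding log_profile1_def log_profile2_def by measurable
    show "H \<in> borel_measurable borel" unfolding H_def by measurable
    show "(F has_real_derivative H s) (at s)" if s: "s \<ge> 0" for s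
    proof -
      have t: "s + e \<noteq> 0" using s e by simp
      define i where "i = (\<lambda>s. 1 / (s+e))"
      have 1: "(i has_real_derivative - (1 / (s+e)^2)) (at s)"
        unfolding i_def using t by (auto intro!: derivative_eq_intros simp: power2_eq_square)
      have 2: "(log_profile e has_real_derivative log_profile1 e s) (at s)"
        by (rule log_profile_deriv[OF e(1) s])
      have "((\<lambda>s. pi^2 * (- 32 * log_profile e s - 384 * e * i s - 288 * e^2 * (i s)^2)) has_real_derivative
          pi^2 * (- 32 * log_profile1 e s - 384 * e * - (1 / (s+e)^2) - 288 * e^2 * (2 * i s * - (1 / (s+e)^2)))) (at s)"
        by (auto intro!: derivative_eq_intros 1 2)
      then have "(F has_real_derivative pi^2 * (- 32 * log_profile1 e s - 384 * e * - (1 / (s+e)^2)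
          - 288 * e^2 * (2 * (1 / (s+e)) * - (1 / (s+e)^2)))) (at s)"
        unfolding F_def i_def .
      moreover have "pi^2 * (- 32 * log_profile1 e s - 384 * e * - (1 / (s+e)^2) - 288 * e^2 * (2 * (1 / (s+e)) * - (1 / (s+e)^2))) = H s"
        by (simp add: H_def log_profile1_def power2_eq_square power3_eq_cube)
      ultimately show ?thesis by simp
    qed
    show "(F \<longlongrightarrow> 0) at_top"
    proof -
      have inv: "((\<lambda>s. 1 / (s+e)) \<longlongrightarrow> 0) at_top"
        unfolding add.commute[of _ e]
        by (intro tendsto_divide_0[OF tendsto_const] filterlim_at_top_imp_at_infinity
            filterlim_tendsto_add_at_top[OF tendsto_const] filterlim_ident)
      have "((\<lambda>s. ln (1 + (1 / (s+e))^2)) \<longlongrightarrow> ln (1 + 0^2)) at_top"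
        by (intro tendsto_intros inv) simp
      then have "(log_profile e \<longlongrightarrow> 0) at_top" by (simp add: log_profile_def[abs_def] power_divide)
      then have "(F \<longlongrightarrow> pi^2 * (- 32 * 0 - 384 * e * 0 - 288 * e^2 * 0^2)) at_top"
        unfolding F_def by (intro tendsto_intros inv)
      then show ?thesis by simp
    qed
    show "0 \<le> H s" if "s \<ge> 0" for s
      using that e unfolding H_def by (intro mult_nonneg_nonneg add_nonneg_nonneg divide_nonneg_nonneg) auto
    show "pi^2 * s * (4 * s * log_profile2 e s + 8 * log_profile1 e s)^2 \<le> H s" if s: "s > 0" for s
    proof -
      define t where "t = s + e"
      have t: "t > 0" "s \<le> t" "s = t - e" using s e by (auto simp: t_def)
      define r where "r = t^2 + 1"
      have r: "r \<ge> 1" by (simp add: r_def)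
      define D where "D = 4 * s * log_profile2 e s + 8 * log_profile1 e s"
      have D: "D = (8 * t ^ 3 - 8 * t - 8 * e * (3 * t^2 + 1)) / (t^2 * r^2)"
      proof -
        have l1: "log_profile1 e s = - 2 / (t * r)" and l2: "log_profile2 e s = 2 * (3 * t^2 + 1) / (t^2 * r^2)"
          by (simp_all add: log_profile1_def log_profile2_def t_def r_def)
        have "16 / (t * r) = 16 * (t * r) / (t^2 * r^2)"
          using t(1) r by (simp add: power2_eq_square)
        moreover have "D = 4 * s * (2 * (3 * t^2 + 1)) / (t^2 * r^2) - 16 / (t * r)"
          unfolding D_def l1 l2 by simp
        ultimately have "D = 4 * (t - e) * (2 * (3 * t^2 + 1)) / (t^2 * r^2) - 16 * (t * r) / (t^2 * r^2)"
          unfolding t(3) by simp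
        also have "\<dots> = (4 * (t - e) * (2 * (3 * t^2 + 1)) - 16 * (t * r)) / (t^2 * r^2)"
          by (rule diff_divide_distrib[symmetric])
        also have "4 * (t - e) * (2 * (3 * t^2 + 1)) - 16 * (t * r) = 8 * t ^ 3 - 8 * t - 8 * e * (3 * t^2 + 1)"
          by (simp add: r_def power2_eq_square power3_eq_cube algebra_simps)
        finally show ?thesis .
      qed
      \<comment> \<open>The bound is arranged so that one factor r cancels; the square of 8 t + 24 e
        then produces the coefficients 64, 384 and 576 of \<open>H\<close>.\<close>
      have N: "\<bar>8 * t ^ 3 - 8 * t - 8 * e * (3 * t^2 + 1)\<bar> \<le> (8 * t + 24 * e) * r"
      proof -
        have eq: "(8 * t + 24 * e) * r = 8 * t ^ 3 + 8 * t + 24 * (e * t^2) + 24 * e"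
          "8 * t ^ 3 - 8 * t - 8 * e * (3 * t^2 + 1) = 8 * t ^ 3 - 8 * t - 24 * (e * t^2) - 8 * e"
          by (simp_all add: r_def power2_eq_square power3_eq_cube algebra_simps)
        have "0 \<le> t ^ 3" "0 \<le> e * t^2" using t e by auto
        then show ?thesis unfolding eq using t e by linarith
      qed
      have "\<bar>D\<bar> \<le> (8 * t + 24 * e) * r / (t^2 * r^2)"
        unfolding D using N by (simp add: divide_right_mono)
      also have "\<dots> = (8 * t + 24 * e) / (t^2 * r)" using r by (simp add: power2_eq_square)
      finally have "D^2 \<le> ((8 * t + 24 * e) / (t^2 * r))^2"
        using power_mono[of "\<bar>D\<bar>" _ 2] by simp
      then have "s * D^2 \<le> t * ((8 * t + 24 * e) / (t^2 * r))^2"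
        using t s by (intro mult_mono) auto
      also have "\<dots> = (64 * t^2 + 384 * e * t + 576 * e^2) / (t ^ 3 * r^2)"
        using t r by (simp add: power2_eq_square power3_eq_cube field_simps)
      also have "\<dots> = 64 / (t * r^2) + 384 * e / (t^2 * r^2) + 576 * e^2 / (t ^ 3 * r^2)"
        using t r by (simp add: add_divide_distrib power2_eq_square power3_eq_cube)
      also have "\<dots> \<le> 64 / (t * r) + 384 * e / t^2 + 576 * e^2 / t ^ 3"
      proof -
        have r2: "r \<le> r^2" "1 \<le> r^2" using r by (auto simp: power2_eq_square mult_le_cancel_left1 one_le_power[of r 2, unfolded power2_eq_square])
        have "64 / (t * r^2) \<le> 64 / (t * r)" by (rule frac_le) (use t r r2 in auto)
        moreover have "384 * e / (t^2 * r^2) \<le> 384 * e / t^2" by (rule frac_le) (use t r2 e in auto)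
        moreover have "576 * e^2 / (t ^ 3 * r^2) \<le> 576 * e^2 / t ^ 3" by (rule frac_le) (use t r2 e in auto)
        ultimately show ?thesis by linarith
      qed
      finally have "pi^2 * (s * D^2) \<le> pi^2 * (64 / (t * r) + 384 * e / t^2 + 576 * e^2 / t ^ 3)"
        by (rule mult_left_mono) simp
      then show ?thesis by (simp add: H_def D_def t_def r_def mult.assoc)
    qed
  qed
  also have "0 - F 0 = 32 * pi^2 * ln (1 + 1 / e^2) + 672 * pi^2"
    using e by (simp add: F_def log_profile_def power_divide algebra_simps)
  finally show ?thesis .
qed

text \<open>With t = s + e one has s^2/t^2 \<le> 1 and (1+s)^2 \<le> 2 (t^2+1)^2, so the bound is
  uniform in e and the gradient adds only a constant to the energy.\<close>

lemma nn_integral_gradient_log_fun_le: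
  assumes e: "0 < e" "e < 1"
  shows "(\<integral>\<^sup>+x. ennreal (4 * ((x::R4) \<bullet> x) * (log_profile1 e (x \<bullet> x))^2) \<partial>lborel) \<le> ennreal (pi^2 * 64)"
proof (rule nn_integral_radial_le_rational[where g = "\<lambda>s. 4 * s * (log_profile1 e s)^2"])
  show "(\<lambda>s. 4 * s * (log_profile1 e s)^2) \<in> borel_measurable borel"
    unfolding log_profile1_def by measurable
  fix s :: real assume s: "s > 0"
  define t where "t = s + e"
  have t: "t > 0" "s \<le> t" using s e by (auto simp: t_def)
  have "s^2 \<le> t^2" using s t by (intro power_mono) auto
  have "(1+s)^2 \<le> 2 * (1 + s^2)"
    using zero_le_power2[of "1 - s"] by (simp add: power2_eq_square algebra_simps)
  also have "\<dots> \<le> 2 * (t^2 + 1)" using \<open>s^2 \<le> t^2\<close> by simp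
  also have "\<dots> \<le> 2 * (t^2 + 1)^2"
    using self_le_power[of "t^2 + 1" 2] by simp
  finally have r: "(1+s)^2 \<le> 2 * (t^2 + 1)^2" .
  have "s * (4 * s * (log_profile1 e s)^2) = 16 * (s^2 / t^2) * (1 / (t^2 + 1)^2)"
    using t by (simp add: log_profile1_def t_def[symmetric] power_divide power_mult_distrib) (simp add: power2_eq_square[of s])
  also have "\<dots> \<le> 16 * 1 * (2 / (1+s)^2)"
  proof (intro mult_mono)
    show "s^2 / t^2 \<le> 1" using \<open>s^2 \<le> t^2\<close> t by simp
    have "2 / (2 * (t^2 + 1)^2) \<le> 2 / (1+s)^2"
      by (rule frac_le) (use r s in auto)
    then show "1 / (t^2 + 1)^2 \<le> 2 / (1+s)^2" by simp
  qed auto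
  also have "\<dots> \<le> 64 / (1+s)^2" using s by (simp add: divide_right_mono)
  finally show "s * (4 * s * (log_profile1 e s)^2) \<le> 64 / (1+s)^2" .
qed auto

text \<open>For a bound uniform in e the profile is replaced by ln(1 + 1/s^2). This is at most
  4/sqrt s for s \<le> 1 and at most 1/s^2 beyond, so s times its square is bounded and decays fast
  enough.\<close>

lemma nn_integral_log_fun_square_le:
  assumes e: "0 < e" "e < 1"
  shows "(\<integral>\<^sup>+x. ennreal ((log_profile e ((x::R4) \<bullet> x))^2) \<partial>lborel) \<le> ennreal (pi^2 * 64)"
proof (rule nn_integral_radial_le_rational[where g = "\<lambda>s. (log_profile e s)^2"])
  show "(\<lambda>s. (log_profile e s)^2) \<in> borel_measurable borel"
    unfolding log_profile_def by measurable
  fix s :: real assume s: "s > 0"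
  have G0: "0 \<le> log_profile e s" using s e by (simp add: log_profile_def)
  have G: "log_profile e s \<le> ln (1 + 1 / s^2)"
  proof -
    have "1 / (s+e)^2 \<le> 1 / s^2" by (rule frac_le[OF _ _ _ power_mono]) (use s e in auto)
    then show ?thesis using s e by (simp add: log_profile_def add_pos_nonneg)
  qed
  show "s * (log_profile e s)^2 \<le> 64 / (1+s)^2"
  proof (cases "s \<le> 1")
    case True
    define r where "r = sqrt s"
    have r: "r > 0" "r^2 = s" using s by (auto simp: r_def)
    \<comment> \<open>Here 1/s^2 = (1/r)^4. Pulling the fourth power out of the logarithm before
      using ln(1+y) \<le> y weakens the singularity to s^(-1/2).\<close>
    have "1 + 1 / s^2 \<le> (1 + 1 / r) ^ 4"
    proof -
      have "(1 + y)^4 = 1 + y^4 + (4 * y + 6 * y^2 + 4 * y^3)" for y :: real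
        by (simp add: power4_eq_xxxx power2_eq_square power3_eq_cube algebra_simps)
      then have "(1 + 1/r)^4 = 1 + (1/r)^4 + (4 * (1/r) + 6 * (1/r)^2 + 4 * (1/r)^3)" .
      moreover have "0 \<le> 4 * (1/r) + 6 * (1/r)^2 + 4 * (1/r)^3" using r by simp
      moreover have "1 / s^2 = (1/r)^4" by (simp add: r(2)[symmetric] power_divide flip: power_mult)
      ultimately show ?thesis by linarith
    qed
    moreover have "0 < 1 + 1 / s^2" using s by (simp add: add_pos_nonneg)
    ultimately have "ln (1 + 1 / s^2) \<le> ln ((1 + 1 / r) ^ 4)" by (rule ln_mono)
    also have "\<dots> = 4 * ln (1 + 1 / r)" using r by (simp add: ln_realpow add_pos_pos)
    also have "\<dots> \<le> 4 * (1 / r)" using r ln_add_one_self_le_self[of "1/r"] by simp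
    finally have "log_profile e s \<le> 4 / r" using G by simp
    then have "(log_profile e s)^2 \<le> (4 / r)^2" using G0 by (intro power_mono)
    also have "\<dots> = 16 / s" by (simp add: power_divide r)
    finally have "s * (log_profile e s)^2 \<le> s * (16 / s)" using s by (intro mult_left_mono) auto
    also have "\<dots> = 64 / 2^2" using s by simp
    also have "\<dots> \<le> 64 / (1+s)^2" by (rule frac_le[OF _ _ _ power_mono]) (use s True in auto)
    finally show ?thesis .
  next
    case False
    have "log_profile e s \<le> 1 / s^2" using G ln_add_one_self_le_self[of "1/s^2"] by simp
    then have "(log_profile e s)^2 \<le> (1 / s^2)^2" using G0 by (intro power_mono)
    then have "s * (log_profile e s)^2 \<le> s * (1 / s^2)^2" using s by (intro mult_left_mono) auto
    also have "\<dots> = 1 / s ^ 3" using s by (simp add: power2_eq_square power3_eq_cube)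
    also have "\<dots> \<le> 1 / s^2" using False by (intro frac_le power_increasing) auto
    also have "\<dots> = 64 / (8 * s)^2" by (simp add: power_mult_distrib)
    also have "\<dots> \<le> 64 / (1+s)^2" by (rule frac_le[OF _ _ _ power_mono]) (use False in auto)
    finally show ?thesis .
  qed
qed auto

lemma log_fun_energy_le:
  assumes e: "0 < e" "e < 1" and \<tau>: "\<tau> > 0" and \<sigma>: "\<sigma> > 0"
  shows "(\<integral>\<^sup>+x. ennreal ((\<Sum>i\<in>UNIV. cpartial i (cpartial i (log_fun e)) x)^2
      + \<tau> * (\<Sum>i\<in>UNIV. (cpartial i (log_fun e) x)^2) + \<sigma> * (log_fun e x)^2) \<partial>lborel)
    \<le> ennreal (32 * pi^2 * ln (1 + 1 / e^2) + (672 * pi^2 + 64 * pi^2 * (\<tau> + \<sigma>)))"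
proof -
  let ?D = "\<lambda>x::R4. (4 * (x \<bullet> x) * log_profile2 e (x \<bullet> x) + 8 * log_profile1 e (x \<bullet> x))^2"
  let ?G = "\<lambda>x::R4. 4 * (x \<bullet> x) * (log_profile1 e (x \<bullet> x))^2"
  let ?U = "\<lambda>x::R4. (log_profile e (x \<bullet> x))^2"
  have [measurable]: "?D \<in> borel_measurable borel" "?G \<in> borel_measurable borel" "?U \<in> borel_measurable borel"
    unfolding log_profile_def log_profile1_def log_profile2_def by measurable
  have g: "(\<Sum>i\<in>UNIV. (cpartial i (log_fun e) x)^2) = ?G x" for x
  proof -
    have "(\<Sum>i\<in>UNIV. (x $ i)^2) = x \<bullet> x" by (simp add: inner_vec_def power2_eq_square)
    then show ?thesis
      by (simp add: log_fun_derivs(1)[OF e] power_mult_distrib sum_distrib_left[symmetric] sum_distrib_right[symmetric])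
  qed
  have "(\<integral>\<^sup>+x. ennreal ((\<Sum>i\<in>UNIV. cpartial i (cpartial i (log_fun e)) x)^2
      + \<tau> * (\<Sum>i\<in>UNIV. (cpartial i (log_fun e) x)^2) + \<sigma> * (log_fun e x)^2) \<partial>lborel)
    = (\<integral>\<^sup>+x. ennreal (?D x) + ennreal \<tau> * ennreal (?G x) + ennreal \<sigma> * ennreal (?U x) \<partial>lborel)"
    using \<tau> \<sigma> unfolding log_fun_derivs(3)[OF e] g log_fun_def
    by (intro nn_integral_cong) (simp add: ennreal_plus ennreal_mult)
  also have "\<dots> = (\<integral>\<^sup>+x. ennreal (?D x) \<partial>lborel) + ennreal \<tau> * (\<integral>\<^sup>+x. ennreal (?G x) \<partial>lborel)
      + ennreal \<sigma> * (\<integral>\<^sup>+x. ennreal (?U x) \<partial>lborel)"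
    by (simp add: nn_integral_add nn_integral_cmult)
  also have "\<dots> \<le> ennreal (32 * pi^2 * ln (1 + 1 / e^2) + 672 * pi^2) + ennreal \<tau> * ennreal (pi^2 * 64)
      + ennreal \<sigma> * ennreal (pi^2 * 64)"
    by (intro add_mono mult_left_mono nn_integral_laplacian_log_fun_le nn_integral_gradient_log_fun_le nn_integral_log_fun_square_le e) auto
  also have "\<dots> = ennreal (32 * pi^2 * ln (1 + 1 / e^2) + (672 * pi^2 + 64 * pi^2 * (\<tau> + \<sigma>)))"
  proof -
    have "0 \<le> ln (1 + 1 / e^2)" by simp
    then have "0 \<le> 32 * pi^2 * ln (1 + 1 / e^2) + 672 * pi^2" by simp
    then show ?thesis using \<tau> \<sigma>
      by (simp add: ennreal_mult[symmetric] ennreal_plus[symmetric] algebra_simps del: ennreal_plus)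
  qed
  finally show ?thesis .
qed

lemma log_fun_admissible:
  assumes e: "0 < e" "e < 1" and \<tau>: "\<tau> > 0" and \<sigma>: "\<sigma> > 0"
    and A: "A = 32 * pi^2 * ln (1 + 1 / e^2) + (672 * pi^2 + 64 * pi^2 * (\<tau> + \<sigma>))"
  shows "(\<lambda>x. 1 / sqrt A * log_fun e x) \<in> admissible \<tau> \<sigma>"
proof -
  have A0: "A > 0" unfolding A using \<tau> \<sigma> by (intro add_nonneg_pos) auto
  define c where "c = 1 / sqrt A"
  have c2: "c^2 = 1 / A" using A0 by (simp add: c_def power_divide)
  let ?I = "\<lambda>x. (\<Sum>i\<in>UNIV. cpartial i (cpartial i (log_fun e)) x)^2
      + \<tau> * (\<Sum>i\<in>UNIV. (cpartial i (log_fun e) x)^2) + \<sigma> * (log_fun e x)^2"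
  have W: "W22_derivs (log_fun e) (\<lambda>i. cpartial i (log_fun e)) (\<lambda>i j. cpartial j (cpartial i (log_fun e)))"
    by (rule log_fun_W22[OF e])
  then have [measurable]: "log_fun e \<in> borel_measurable lebesgue" "\<And>i. cpartial i (log_fun e) \<in> borel_measurable lebesgue"
    "\<And>i j. cpartial j (cpartial i (log_fun e)) \<in> borel_measurable lebesgue"
    by (auto simp: W22_derivs_def L2_def)
  have "(\<integral>\<^sup>+x. ennreal ((\<Sum>i\<in>UNIV. c * cpartial i (cpartial i (log_fun e)) x)^2
      + \<tau> * (\<Sum>i\<in>UNIV. (c * cpartial i (log_fun e) x)^2) + \<sigma> * (c * log_fun e x)^2) \<partial>lebesgue)
    = (\<integral>\<^sup>+x. ennreal (1/A) * ennreal (?I x) \<partial>lebesgue)"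
  proof (rule nn_integral_cong)
    fix x
    have "(\<Sum>i\<in>UNIV. c * cpartial i (cpartial i (log_fun e)) x)^2
      + \<tau> * (\<Sum>i\<in>UNIV. (c * cpartial i (log_fun e) x)^2) + \<sigma> * (c * log_fun e x)^2 = c^2 * ?I x"
      by (simp only: sum_distrib_left[symmetric] power_mult_distrib) (simp add: algebra_simps)
    then show "ennreal ((\<Sum>i\<in>UNIV. c * cpartial i (cpartial i (log_fun e)) x)^2
      + \<tau> * (\<Sum>i\<in>UNIV. (c * cpartial i (log_fun e) x)^2) + \<sigma> * (c * log_fun e x)^2) = ennreal (1/A) * ennreal (?I x)"
      using A0 by (simp only: c2) (rule ennreal_mult', simp)
  qed
  also have "\<dots> = ennreal (1/A) * (\<integral>\<^sup>+x. ennreal (?I x) \<partial>lebesgue)"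
    by (rule nn_integral_cmult) measurable
  also have "\<dots> \<le> ennreal (1/A) * ennreal A"
    unfolding A nn_integral_completion by (intro mult_left_mono log_fun_energy_le e \<tau> \<sigma>) simp
  also have "\<dots> = 1" using A0 by (simp add: ennreal_mult[symmetric])
  finally show ?thesis
    unfolding admissible_def c_def[symmetric] using W22_derivs_cmult[OF W, of c] by blast
qed

text \<open>On |x| \<le> sqrt e one has s + e \<le> 2 e, so the profile loses at most ln 4 against
  its value ln(1 + 1/e^2) at the origin. The ball has measure (pi^2/2) e^2 and the weight there is
  at least e^(-\<beta>/2), which together give (e^2)^(1 - \<beta>/4).\<close>

lemma TM_log_fun_ge:
  assumes e: "0 < e" "e < 1" and A: "A > 0" and \<alpha>: "\<alpha> > 0" and \<beta>: "0 \<le> \<beta>"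
    and L: "ln 4 \<le> ln (1 + 1 / e^2)"
  shows "ennreal ((exp (\<alpha> * (ln (1 + 1 / e^2) - ln 4)^2 / A) - 1) * (pi^2 / 2) * (e^2) powr (1 - \<beta>/4))
    \<le> TM \<alpha> \<beta> (\<lambda>x. 1 / sqrt A * log_fun e x)"
proof -
  define K where "K = exp (\<alpha> * (ln (1 + 1 / e^2) - ln 4)^2 / A) - 1"
  have K: "K \<ge> 0" using \<alpha> A by (simp add: K_def)
  have [measurable]: "cball (0::R4) (sqrt e) \<in> sets borel" by (rule borel_closed) simp
  have "ennreal (K * (pi^2 / 2) * (e^2) powr (1 - \<beta>/4)) = ennreal (K / e powr (\<beta>/2)) * emeasure lborel (cball (0::R4) (sqrt e))"
  proof -
    have "emeasure lborel (cball (0::R4) (sqrt e)) = ennreal (pi^2 / 2 * e^2)"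
      using e power_mult[of "sqrt e" 2 2] by (simp add: emeasure_cball unit_ball_vol_4)
    moreover have "(e^2) powr (1 - \<beta>/4) = e^2 / e powr (\<beta>/2)"
    proof -
      have "(e powr 2) powr (\<beta>/4) = e powr (\<beta>/2)" by (simp add: powr_powr)
      moreover have "e powr 2 = e^2" using e by (simp add: powr_numeral)
      ultimately have "(e^2) powr (\<beta>/4) = e powr (\<beta>/2)" by simp
      then show ?thesis using e by (simp add: powr_diff)
    qed
    ultimately show ?thesis using K e by (simp add: ennreal_mult[symmetric])
  qed
  also have "\<dots> = (\<integral>\<^sup>+x. ennreal (K / e powr (\<beta>/2)) * indicator (cball (0::R4) (sqrt e)) x \<partial>lborel)"
    by (simp add: nn_integral_cmult_indicator)
  also have "\<dots> \<le> (\<integral>\<^sup>+x. ennreal ((exp (\<alpha> * (1 / sqrt A * log_fun e x)^2) - 1) / norm x powr \<beta>) \<partial>lborel)"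
  \<comment> \<open>The origin is left out because the division by
    \<open>norm x powr \<beta>\<close> returns 0 there.\<close>
  proof (rule nn_integral_mono_AE)
    show "AE x in lborel. ennreal (K / e powr (\<beta>/2)) * indicator (cball (0::R4) (sqrt e)) x
      \<le> ennreal ((exp (\<alpha> * (1 / sqrt A * log_fun e x)^2) - 1) / norm x powr \<beta>)"
      using AE_lborel_singleton[of "0::R4"]
    proof eventually_elim
      case (elim x)
      show ?case
      proof (cases "x \<in> cball 0 (sqrt e)")
        case True
        then have nx: "0 < norm x" "norm x \<le> sqrt e" using elim by auto
        define s where "s = x \<bullet> x"
        have s: "0 \<le> s" "s \<le> e" using nx power_mono[OF nx(2), of 2] e by (auto simp: s_def dot_square_norm)
        have "ln z - ln 4 = ln (z / 4)" if "z > 0" for z :: real using that by (simp add: ln_div)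
        then have "ln (1 + 1 / e^2) - ln 4 = ln ((1 + 1 / e^2) / 4)" using e by (simp add: add_pos_pos)
        also have "\<dots> \<le> log_profile e s"
          unfolding log_profile_def
        proof (subst ln_le_cancel_iff)
          have "(1 + 1 / e^2) / 4 \<le> 1 + 1 / (2 * e)^2" by (simp add: power_mult_distrib)
          also have "1 / (2 * e)^2 \<le> 1 / (s+e)^2" by (rule frac_le[OF _ _ _ power_mono]) (use s e in auto)
          finally show "(1 + 1 / e^2) / 4 \<le> 1 + 1 / (s+e)^2" by simp
        qed (use s e in \<open>auto simp: add_pos_pos\<close>)
        finally have "(ln (1 + 1 / e^2) - ln 4)^2 \<le> (log_profile e s)^2"
          using L by (intro power_mono) auto
        then have "\<alpha> * (ln (1 + 1 / e^2) - ln 4)^2 / A \<le> \<alpha> * (log_profile e s)^2 / A"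
          using \<alpha> A by (intro divide_right_mono mult_left_mono) auto
        also have "\<dots> = \<alpha> * (1 / sqrt A * log_fun e x)^2"
          using A by (simp add: log_fun_def s_def power_divide power_mult_distrib)
        finally have "K \<le> exp (\<alpha> * (1 / sqrt A * log_fun e x)^2) - 1" by (simp add: K_def)
        moreover have "norm x powr \<beta> \<le> e powr (\<beta>/2)"
        proof -
          have "norm x powr \<beta> \<le> sqrt e powr \<beta>" using nx \<beta> by (intro powr_mono2) auto
          then show ?thesis using e by (simp add: powr_half_sqrt[symmetric] powr_powr)
        qed
        ultimately have "K / e powr (\<beta>/2) \<le> (exp (\<alpha> * (1 / sqrt A * log_fun e x)^2) - 1) / norm x powr \<beta>"
          using K nx \<alpha> by (intro frac_le) auto
        then show ?thesis using True by (simp add: ennreal_leI)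
      qed simp
    qed
  qed
  also have "\<dots> = TM \<alpha> \<beta> (\<lambda>x. 1 / sqrt A * log_fun e x)"
    by (simp add: TM_def nn_integral_completion)
  finally show ?thesis by (simp add: K_def)
qed

text \<open>With L = ln(1 + 1/e^2) the exponent \<alpha> (L - ln 4)^2/(32 pi^2 L + C) grows like (b
  + 2 \<delta>) L, while (e^2)^b is at least exp(-b L). One half of the gap 2 \<delta> absorbs the
  lower-order terms, the other makes the product grow like exp(\<delta> L).\<close>

lemma TM_supercritical:
  assumes \<beta>: "0 \<le> \<beta>" "\<beta> < 4" and \<tau>: "\<tau> > 0" and \<sigma>: "\<sigma> > 0" and \<alpha>: "\<alpha> > 32 * pi^2 * (1 - \<beta>/4)"
  shows "(SUP u\<in>admissible \<tau> \<sigma>. TM \<alpha> \<beta> u) = \<infinity>"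
proof -
  define b where "b = 1 - \<beta>/4"
  define p where "p = \<alpha> / (32 * pi^2)"
  define \<delta> where "\<delta> = (p - b) / 2"
  define C where "C = 672 * pi^2 + 64 * pi^2 * (\<tau> + \<sigma>)"
  have b: "b > 0" using \<beta> by (simp add: b_def)
  have "32 * pi^2 > 0" by simp
  then have \<alpha>0: "\<alpha> > 0" using \<alpha> b by (metis b_def less_trans mult_pos_pos)
  have "b < p" using \<alpha> by (simp add: p_def b_def pos_less_divide_eq mult.commute)
  then have \<delta>: "\<delta> > 0" by (simp add: \<delta>_def)
  have "b + 2 * \<delta> = p" by (simp add: \<delta>_def diff_divide_distrib)
  then have \<alpha>\<delta>: "\<alpha> = 32 * pi^2 * (b + 2 * \<delta>)" by (simp add: p_def)
  have C: "C > 0" using \<tau> \<sigma> by (simp add: C_def add_pos_pos)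
  have big: "\<exists>u\<in>admissible \<tau> \<sigma>. ennreal K \<le> TM \<alpha> \<beta> u" if K: "K \<ge> 0" for K
  proof -
    \<comment> \<open>The summands ensure in turn e < 1, L - ln 4 \<ge> 0, the absorption of the
      terms linear in L, and (pi^2/2) \<delta> L \<ge> K.\<close>
    define L where "L = 1 + ln 4 + (2 * ln 4 * \<alpha> + (b + \<delta>) * C) / (32 * pi^2 * \<delta>) + K / (pi^2 / 2 * \<delta>)"
    have parts: "0 \<le> (2 * ln 4 * \<alpha> + (b + \<delta>) * C) / (32 * pi^2 * \<delta>)" "0 \<le> K / (pi^2 / 2 * \<delta>)" "0 < ln (4::real)"
      using \<alpha>0 b \<delta> C K by auto
    then have L1: "L > 1" "L \<ge> ln 4" "L \<ge> (2 * ln 4 * \<alpha> + (b + \<delta>) * C) / (32 * pi^2 * \<delta>)" "L \<ge> K / (pi^2 / 2 * \<delta>)"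
      unfolding L_def by linarith+
    have eL: "exp L > 2" using exp_ge_add_one_self[of L] L1 by linarith
    \<comment> \<open>The solution of ln(1 + 1/e^2) = L.\<close>
    define e where "e = 1 / sqrt (exp L - 1)"
    have e2: "e^2 = 1 / (exp L - 1)" using eL L1(1) by (simp add: e_def power_divide)
    have e: "0 < e" "e < 1" using eL L1(1) by (auto simp: e_def)
    have lnL: "ln (1 + 1 / e^2) = L" using eL L1(1) by (simp add: e2)
    define A where "A = 32 * pi^2 * L + C"
    have A: "A > 0" using L1 C by (simp add: A_def add_pos_pos)
    have "(\<lambda>x. 1 / sqrt A * log_fun e x) \<in> admissible \<tau> \<sigma>"
      by (rule log_fun_admissible[OF e \<tau> \<sigma>]) (simp add: A_def C_def lnL)
    moreover have "ennreal K \<le> TM \<alpha> \<beta> (\<lambda>x. 1 / sqrt A * log_fun e x)"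
    proof -
      have "(b + \<delta>) * L \<le> \<alpha> * (L - ln 4)^2 / A"
      proof -
        have "2 * ln 4 * \<alpha> + (b + \<delta>) * C \<le> L * (32 * pi^2 * \<delta>)"
          using L1(3) \<delta> by (simp add: pos_divide_le_eq)
        then have "L * (2 * ln 4 * \<alpha> + (b + \<delta>) * C) \<le> L * (L * (32 * pi^2 * \<delta>))"
          using L1 by (intro mult_left_mono) auto
        then have "(b + \<delta>) * L * A \<le> \<alpha> * (L^2 - 2 * ln 4 * L)"
          by (simp add: A_def \<alpha>\<delta> power2_eq_square algebra_simps)
        also have "\<dots> \<le> \<alpha> * (L - ln 4)^2"
          using \<alpha>0 by (intro mult_left_mono) (auto simp: power2_diff)
        finally show ?thesis using A by (simp add: pos_le_divide_eq)
      qed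
      then have 1: "exp ((b + \<delta>) * L) - 1 \<le> exp (\<alpha> * (L - ln 4)^2 / A) - 1" by simp
      have 2: "exp (- (b * L)) \<le> (e^2) powr b"
      proof -
        have "exp (- L) \<le> e^2" unfolding e2 exp_minus inverse_eq_divide
          by (rule frac_le) (use eL L1(1) in auto)
        then have "exp (- L) powr b \<le> (e^2) powr b" using b by (intro powr_mono2) auto
        then show ?thesis by (simp add: exp_powr_real mult.commute)
      qed
      have "K \<le> pi^2 / 2 * (\<delta> * L)" using L1(4) \<delta> by (simp add: pos_divide_le_eq mult_ac)
      also have "\<dots> \<le> pi^2 / 2 * (exp (\<delta> * L) - exp (- (b * L)))"
      proof (rule mult_left_mono)
        have "exp (- (b * L)) \<le> 1" using b L1 by simp
        then show "\<delta> * L \<le> exp (\<delta> * L) - exp (- (b * L))"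
          using exp_ge_add_one_self[of "\<delta> * L"] by linarith
      qed simp
      also have "\<dots> = (exp ((b + \<delta>) * L) - 1) * (pi^2 / 2) * exp (- (b * L))"
        by (simp add: left_diff_distrib mult_exp_exp algebra_simps)
      also have "\<dots> \<le> (exp (\<alpha> * (L - ln 4)^2 / A) - 1) * (pi^2 / 2) * (e^2) powr b"
      proof (intro mult_mono 1 2 order_refl)
        have "0 \<le> \<alpha> * (L - ln 4)^2 / A" using \<alpha>0 A by simp
        then show "0 \<le> exp (\<alpha> * (L - ln 4)^2 / A) - 1" by simp
        then show "0 \<le> (exp (\<alpha> * (L - ln 4)^2 / A) - 1) * (pi^2 / 2)" by simp
      qed auto
      finally have "ennreal K \<le> ennreal ((exp (\<alpha> * (L - ln 4)^2 / A) - 1) * (pi^2 / 2) * (e^2) powr b)"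
        by (rule ennreal_leI)
      also have "\<dots> \<le> TM \<alpha> \<beta> (\<lambda>x. 1 / sqrt A * log_fun e x)"
        using TM_log_fun_ge[OF e A \<alpha>0 \<beta>(1)] L1(2) unfolding lnL b_def by simp
      finally show ?thesis .
    qed
    ultimately show ?thesis by blast
  qed
  show ?thesis
  proof (rule ccontr)
    assume "(SUP u\<in>admissible \<tau> \<sigma>. TM \<alpha> \<beta> u) \<noteq> \<infinity>"
    then obtain r where r: "(SUP u\<in>admissible \<tau> \<sigma>. TM \<alpha> \<beta> u) = ennreal r" "r \<ge> 0"
      by (cases "SUP u\<in>admissible \<tau> \<sigma>. TM \<alpha> \<beta> u") auto
    obtain u where u: "u \<in> admissible \<tau> \<sigma>" "ennreal (r + 1) \<le> TM \<alpha> \<beta> u" using big[of "r+1"] r by auto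
    have "TM \<alpha> \<beta> u \<le> ennreal r" unfolding r(1)[symmetric] by (rule SUP_upper[OF u(1)])
    with u(2) have "ennreal (r + 1) \<le> ennreal r" by (rule order_trans)
    then show False using r(2) by simp
  qed
qed

theorem theorem1p1:
  fixes \<beta> :: real
  assumes "0 \<le> \<beta>" and "\<beta> < 4"
  shows "(\<forall>\<alpha>>0. \<forall>u\<in>W22. TM \<alpha> \<beta> u < \<infinity>)
    \<and> (\<forall>\<tau>>0. \<forall>\<sigma>>0. \<forall>\<alpha>. \<alpha> < 32 * pi\<^sup>2 * (1 - \<beta> / 4) \<longrightarrow>
          (SUP u\<in>admissible \<tau> \<sigma>. TM \<alpha> \<beta> u) < \<infinity>)
    \<and> (\<forall>\<tau>>0. \<forall>\<sigma>>0. \<forall>\<alpha>. \<alpha> > 32 * pi\<^sup>2 * (1 - \<beta> / 4) \<longrightarrow>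
          (SUP u\<in>admissible \<tau> \<sigma>. TM \<alpha> \<beta> u) = \<infinity>)"
proof (intro conjI allI ballI impI)
  show "TM \<alpha> \<beta> u < \<infinity>" if "\<alpha> > 0" "u \<in> W22" for \<alpha> u
    using TM_finite[OF that(1) assms that(2)] .
  show "(SUP u\<in>admissible \<tau> \<sigma>. TM \<alpha> \<beta> u) < \<infinity>"
    if "\<tau> > 0" "\<sigma> > 0" "\<alpha> < 32 * pi\<^sup>2 * (1 - \<beta> / 4)" for \<tau> \<sigma> \<alpha>
    using TM_subcritical[OF assms that] .
  show "(SUP u\<in>admissible \<tau> \<sigma>. TM \<alpha> \<beta> u) = \<infinity>"
    if "\<tau> > 0" "\<sigma> > 0" "\<alpha> > 32 * pi\<^sup>2 * (1 - \<beta> / 4)" for \<tau> \<sigma> \<alpha>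
    using TM_supercritical[OF assms that] .
qed

end
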